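(* Let $G$ be a dihedral group of order $2n$, where $n\ge 3$ is odd. Then $\Delta(G)=[1,2n-2]$ and $\mathsf{Ca}(G)=[2,2n]$.
   Context: For integers $a\le b$, $[a,b]=\{x\in\mathbb Z: a\le x\le b\}$. Let $G$ be a finite group, written multiplicatively, with identity $1_G$. A sequence over $G$ is an element of the free abelian monoid $\mathcal F(G)$ with basis $G$ (a finite unordered list of elements of $G$, repetition allowed), the operation being concatenation. A sequence is product-one if its terms can be ordered so that their product in $G$ equals $1_G$ (the empty sequence is product-one). $\mathcal B(G)$ is the monoid of product-one sequences over $G$. An atom of $\mathcal B(G)$ is a nonempty product-one sequence that is not the concatenation of two nonempty product-one sequences; $\mathcal A(G)$ is the set of atoms. For $A\in\mathcal B(G)$, a factorization of $A$ is an element $z=U_1\cdots U_k$ of the free abelian monoid with basis $\mathcal A(G)$ (a finite multiset of atoms) whose concatenation is $A$; its length is $|z|=k$. $\mathsf Z(A)$ is the set of factorizations of $A$ and $\mathsf L(A)=\{|z|: z\in\mathsf Z(A)\}$ is the set of lengths of $A$. For $L\subset\mathbb Z$, $\Delta(L)$ is the set of all $d\in\mathbb N$ for which there is $a\in L$ with $L\cap[a,a+d]=\{a,a+d\}$. The set of distances is $\Delta(G)=\bigcup_{A\in\mathcal B(G)}\Delta(\mathsf L(A))$. For factorizations $z,z'$ write uniquely $z=u_1\cdots u_\ell v_1\cdots v_m$, $z'=u_1\cdots u_\ell w_1\cdots w_k$ with all $u_i,v_j,w_r$ atoms and $\{v_1,\dots,v_m\}\cap\{w_1,\dots,w_k\}=\emptyset$,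 and put $\mathsf d(z,z')=\max\{m,k\}$. For $A\in\mathcal B(G)$, the catenary degree $\mathsf c(A)$ is the smallest $N\in\mathbb N_0\cup\{\infty\}$ such that for any $z,z'\in\mathsf Z(A)$ there are $z=z_0,z_1,\dots,z_k=z'$ in $\mathsf Z(A)$ with $\mathsf d(z_{i-1},z_i)\le N$ for all $i\in[1,k]$. The set of (positive) catenary degrees is $\mathsf{Ca}(G)=\{\mathsf c(A): A\in\mathcal B(G),\ \mathsf c(A)>0\}$. *)

theory Defs
  imports "HOL-Algebra.Algebra" "HOL-Library.Multiset" "HOL-Library.Extended_Nat"
begin

(* The presentation <a, t | a^n = t^2 = 1, t a = a^{-1} t>: a group of order 2n satisfying it is
   a quotient, of full order, of the group so presented, hence isomorphic to it. *)
definition dihedral_group :: "('a, 'b) monoid_scheme \<Rightarrow> nat \<Rightarrow> bool" where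
  "dihedral_group G n \<longleftrightarrow>
     group G \<and> order G = 2 * n \<and>
     (\<exists>a \<in> carrier G. \<exists>t \<in> carrier G.
        generate G {a, t} = carrier G \<and>
        a [^]\<^bsub>G\<^esub> n = \<one>\<^bsub>G\<^esub> \<and>
        t [^]\<^bsub>G\<^esub> (2::nat) = \<one>\<^bsub>G\<^esub> \<and>
        t \<otimes>\<^bsub>G\<^esub> a = inv\<^bsub>G\<^esub> a \<otimes>\<^bsub>G\<^esub> t)"

(* Sequences over G are multisets over carrier G; concatenation is multiset addition. *)
definition sequences_over :: "('a, 'b) monoid_scheme \<Rightarrow> 'a multiset set" where
  "sequences_over G = {S. set_mset S \<subseteq> carrier G}"

definition product_one :: "('a, 'b) monoid_scheme \<Rightarrow> 'a multiset \<Rightarrow> bool" where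
  "product_one G S \<longleftrightarrow> (\<exists>xs. mset xs = S \<and> foldr (\<otimes>\<^bsub>G\<^esub>) xs \<one>\<^bsub>G\<^esub> = \<one>\<^bsub>G\<^esub>)"

definition product_one_monoid :: "('a, 'b) monoid_scheme \<Rightarrow> 'a multiset set" where
  "product_one_monoid G = {S \<in> sequences_over G. product_one G S}"

definition product_one_atoms :: "('a, 'b) monoid_scheme \<Rightarrow> 'a multiset set" where
  "product_one_atoms G =
     {U \<in> product_one_monoid G. U \<noteq> {#} \<and>
        \<not> (\<exists>S \<in> product_one_monoid G. \<exists>T \<in> product_one_monoid G.
              S \<noteq> {#} \<and> T \<noteq> {#} \<and> U = S + T)}"

definition factorizations ::
    "('a, 'b) monoid_scheme \<Rightarrow> 'a multiset \<Rightarrow> 'a multiset multiset set" where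
  "factorizations G A = {z. set_mset z \<subseteq> product_one_atoms G \<and> \<Sum>\<^sub># z = A}"

definition length_set :: "('a, 'b) monoid_scheme \<Rightarrow> 'a multiset \<Rightarrow> nat set" where
  "length_set G A = size ` factorizations G A"

(* Distances are positive: without 0 < d every nonempty L would have 0 as a distance. *)
definition distances :: "int set \<Rightarrow> nat set" where
  "distances L = {d. 0 < d \<and> (\<exists>a \<in> L. L \<inter> {a..a + int d} = {a, a + int d})}"

definition set_of_distances :: "('a, 'b) monoid_scheme \<Rightarrow> nat set" where
  "set_of_distances G = (\<Union>A \<in> product_one_monoid G. distances (int ` length_set G A))"

(* Multiset difference cancels the common part u_1 ... u_l, so that z - z' = v_1 ... v_m and
   z' - z = w_1 ... w_k. *)
definition factorization_dist :: "'b multiset \<Rightarrow> 'b multiset \<Rightarrow> nat" where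
  "factorization_dist z z' = max (size (z - z')) (size (z' - z))"

definition chain_connected ::
    "('a, 'b) monoid_scheme \<Rightarrow> 'a multiset \<Rightarrow> enat \<Rightarrow>
     'a multiset multiset \<Rightarrow> 'a multiset multiset \<Rightarrow> bool" where
  "chain_connected G A N z z' \<longleftrightarrow>
     (\<exists>(k::nat) y. y 0 = z \<and> y k = z' \<and>
        (\<forall>i \<le> k. y i \<in> factorizations G A) \<and>
        (\<forall>i \<in> {1..k}. enat (factorization_dist (y (i - 1)) (y i)) \<le> N))"

definition catenary_degree :: "('a, 'b) monoid_scheme \<Rightarrow> 'a multiset \<Rightarrow> enat" where
  "catenary_degree G A =
     (LEAST N. \<forall>z \<in> factorizations G A. \<forall>z' \<in> factorizations G A. chain_connected G A N z z')"

definition set_of_catenary_degrees :: "('a, 'b) monoid_scheme \<Rightarrow> enat set" where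
  "set_of_catenary_degrees G =
     {catenary_degree G A | A. A \<in> product_one_monoid G \<and> catenary_degree G A > 0}"

end

(* Write the group as {a^i, a^i t}. A sequence with at least one reflection is product-one iff its
   terms can be given signs such that the signs of the reflections add up to 0 and the signed sum
   of all exponents is divisible by n; without reflections all signs have to agree. So
   factorizations become partitions of the terms into signed zero-sum pieces.

   Upper bound: let z have more than 2n atoms and let w be any factorization of the same sequence.
   Give all terms the signs of w. If the reflections of every atom of z are balanced for them, a
   pigeonhole argument (n integers have a nonempty subsum divisible by n) yields product-one pieces
   that allow to pass from z to w through factorizations with common atoms; cancelling a common
   atom, one concludes by induction on the length of the sequence. Otherwise some reflections have
   equal and others have opposite signs in z and w. The terms of each kind form a zero-sum piece,
   and refining this decomposition gives a factorization that is linked to z and to w. Hence any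
   two factorizations are linked by steps of distance at most 2n. A step across a gap d of the set
   of lengths has distance at least d + 2, so d is at most 2n - 2.

   Lower bound: with x = t and x' = a t, the sequence x^(n+c) x'^(n+c) a^c has lengths {2, 2c+1}, the
   sequence x^(n+c-1) x'^(n+c) (a^c t) has lengths {2, 2c}, and x^(2n) x'^(2n) has lengths {2, 2n}.
   Catenary degree 2 is that of x^2 x'^2 a^2. *)
theory Submission
  imports Defs
begin

section \<open>Signed zero-sum sets\<close>

text \<open>Two obstacles shape the proof. First, signs belong to a factorization and not to the
  sequence: a set that is zero-sum for the signs of one factorization need not be so for those of
  another. The bridge is that the terms on which two sign functions differ form a zero-sum set; this
  needs \<open>n\<close> odd, since only twice their sum is known to be divisible by
  \<open>n\<close>. Second, removing a product-one part leaves a zero-sum set, but possibly one of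
  rotations with mixed signs, which need not be product-one. So nearly every selection first sets
  aside a reflection that stays in the remainder. The constant \<open>2 n\<close> has two sources.
  Factorizations with at most \<open>2 n\<close> atoms are joined by a single step. And an
  irreducible zero-sum set with a reflection has at most \<open>2 n\<close> terms: besides two
  opposite reflections set aside, \<open>2 n - 1\<close> terms with balanced reflections already
  yield \<open>n\<close> units of one sign (rotations of that sign, or opposite pairs of
  reflections). In the lower bound, parity governs the atoms: in a product-one sequence over two
  reflections, odd multiplicities force each to occur at least \<open>n\<close> times.\<close>

lemma zero_sum_subset:
  fixes w :: "'a \<Rightarrow> int"
  assumes fin: "finite J" and card: "n \<le> card J" and n: "0 < n"
  shows "\<exists>I\<subseteq>J. I \<noteq> {} \<and> int n dvd sum w I"
proof -
  obtain e where e: "bij_betw e {..<card J} J"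
    using fin by (metis bij_betw_from_nat_into_finite)
  \<comment> \<open>The \<open>n + 1\<close> prefix sums \<open>S 0, ..., S n\<close> take at most
    \<open>n\<close> residues, so two agree modulo \<open>n\<close>; the terms between them form
    \<open>I\<close>.\<close>
  define S where "S k = (\<Sum>i<k. w (e i))" for k
  have "card ((\<lambda>k. S k mod int n) ` {..n}) \<le> card {0..<int n}"
    by (rule card_mono) (use n in auto)
  hence "card ((\<lambda>k. S k mod int n) ` {..n}) < card {..n}" by simp
  hence "\<not> inj_on (\<lambda>k. S k mod int n) {..n}" by (rule pigeonhole)
  then obtain j' k' where jk': "j' \<le> n" "k' \<le> n" "j' \<noteq> k'" "S j' mod int n = S k' mod int n"
    by (auto simp: inj_on_def)
  define j where "j = min j' k'"
  define k where "k = max j' k'"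
  have jk: "j \<le> n" "k \<le> n" "j < k" "S j mod int n = S k mod int n"
    using jk' by (auto simp: j_def k_def min_def max_def)
  have "S k - S j = (\<Sum>i=j..<k. w (e i))"
    unfolding S_def using jk(3) sum_diff_nat_ivl[of 0 j k "\<lambda>i. w (e i)"]
    by (simp add: atLeast0LessThan)
  hence d: "int n dvd (\<Sum>i=j..<k. w (e i))"
    using jk(4) by (metis mod_eq_dvd_iff)
  have inj: "inj_on e {j..<k}"
    using e jk(2) card by (auto simp: bij_betw_def intro: inj_on_subset)
  show ?thesis
  proof (intro exI[of _ "e ` {j..<k}"] conjI)
    show "e ` {j..<k} \<subseteq> J" using e jk(2) card by (auto simp: bij_betw_def)
    show "e ` {j..<k} \<noteq> {}" using jk(3) by simp
    show "int n dvd sum w (e ` {j..<k})" using d by (simp add: sum.reindex[OF inj])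
  qed
qed

text \<open>An index stands for a term \<open>a\<^sup>v\<close> (\<open>r\<close> false) or \<open>a\<^sup>v t\<close> (\<open>r\<close> true) of a sequence, where \<open>v\<close> is
  taken modulo \<open>n\<close>. As \<open>t a = a\<^sup>-\<^sup>1 t\<close>, the exponents in a product are added with signs, which change
  after every reflection. So \<open>po\<close> says that the terms can be ordered to product one, the signs of
  the witness \<open>s\<close> being those in such an ordering.\<close>

locale signed_sequences =
  fixes n :: nat and r :: "'i \<Rightarrow> bool" and v :: "'i \<Rightarrow> int"
  assumes n_pos: "0 < n" and n_odd: "odd n"
begin

definition sg :: "('i \<Rightarrow> int) \<Rightarrow> bool" where
  "sg s \<longleftrightarrow> (\<forall>i. s i = 1 \<or> s i = -1)"

definition rb :: "('i \<Rightarrow> int) \<Rightarrow> 'i set \<Rightarrow> int" where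
  "rb s W = (\<Sum>i\<in>W. if r i then s i else 0)"

definition rv :: "('i \<Rightarrow> int) \<Rightarrow> 'i set \<Rightarrow> int" where
  "rv s W = (\<Sum>i\<in>W. s i * v i)"

definition zs :: "('i \<Rightarrow> int) \<Rightarrow> 'i set \<Rightarrow> bool" where
  "zs s W \<longleftrightarrow> rb s W = 0 \<and> int n dvd rv s W"

text \<open>\<open>zs\<close> passes to differences of nested sets, \<open>compat\<close> does not:
  the remainder may consist of rotations of mixed signs. Since signs change only after a reflection,
  a set of rotations has to carry one sign.\<close>

definition compat :: "('i \<Rightarrow> int) \<Rightarrow> 'i set \<Rightarrow> bool" where
  "compat s W \<longleftrightarrow> zs s W \<and> ((\<exists>i\<in>W. r i) \<or> (\<exists>c. \<forall>i\<in>W. s i = c))"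

definition po :: "'i set \<Rightarrow> bool" where
  "po W \<longleftrightarrow> (\<exists>s. sg s \<and> compat s W)"

lemma poI: "sg s \<Longrightarrow> compat s W \<Longrightarrow> po W"
  by (auto simp: po_def)

lemma compat_zs: "compat s W \<Longrightarrow> zs s W"
  by (simp add: compat_def)

lemma compatI: "zs s W \<Longrightarrow> i \<in> W \<Longrightarrow> r i \<Longrightarrow> compat s W"
  by (auto simp: compat_def)

lemma rb_Un: "finite W \<Longrightarrow> finite Y \<Longrightarrow> W \<inter> Y = {} \<Longrightarrow> rb s (W \<union> Y) = rb s W + rb s Y"
  unfolding rb_def by (rule sum.union_disjoint)

lemma rv_Un: "finite W \<Longrightarrow> finite Y \<Longrightarrow> W \<inter> Y = {} \<Longrightarrow> rv s (W \<union> Y) = rv s W + rv s Y"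
  unfolding rv_def by (rule sum.union_disjoint)

lemma rb_diff: "finite W \<Longrightarrow> Y \<subseteq> W \<Longrightarrow> rb s (W - Y) = rb s W - rb s Y"
  unfolding rb_def by (rule sum_diff)

lemma rv_diff: "finite W \<Longrightarrow> Y \<subseteq> W \<Longrightarrow> rv s (W - Y) = rv s W - rv s Y"
  unfolding rv_def by (rule sum_diff)

lemma rb_UN: "finite F \<Longrightarrow> (\<And>W. W \<in> F \<Longrightarrow> finite W) \<Longrightarrow> disjoint F \<Longrightarrow> rb s (\<Union>F) = (\<Sum>W\<in>F. rb s W)"
  unfolding rb_def by (simp add: sum.Union_disjoint_sets)

lemma rv_UN: "finite F \<Longrightarrow> (\<And>W. W \<in> F \<Longrightarrow> finite W) \<Longrightarrow> disjoint F \<Longrightarrow> rv s (\<Union>F) = (\<Sum>W\<in>F. rv s W)"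
  unfolding rv_def by (simp add: sum.Union_disjoint_sets)

lemma zs_diff: "finite W \<Longrightarrow> Y \<subseteq> W \<Longrightarrow> zs s W \<Longrightarrow> zs s Y \<Longrightarrow> zs s (W - Y)"
  by (simp add: zs_def rb_diff rv_diff)

lemma rb_cong: "(\<And>i. i \<in> W \<Longrightarrow> r i \<Longrightarrow> s i = s' i) \<Longrightarrow> rb s W = rb s' W"
  unfolding rb_def by (rule sum.cong) auto

lemma rv_cong: "(\<And>i. i \<in> W \<Longrightarrow> s i = s' i) \<Longrightarrow> rv s W = rv s' W"
  unfolding rv_def by (rule sum.cong) auto

lemma zs_cong: "(\<And>i. i \<in> W \<Longrightarrow> s i = s' i) \<Longrightarrow> zs s W = zs s' W"
  unfolding zs_def using rb_cong[of W s s'] rv_cong[of W s s'] by simp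

lemma compat_cong: "(\<And>i. i \<in> W \<Longrightarrow> s i = s' i) \<Longrightarrow> compat s W = compat s' W"
  unfolding compat_def using zs_cong[of W s s'] by auto

lemma rb_uminus: "rb (\<lambda>i. - s i) W = - rb s W"
  unfolding rb_def sum_negf[symmetric] by (rule sum.cong) auto

lemma rv_uminus: "rv (\<lambda>i. - s i) W = - rv s W"
  unfolding rv_def sum_negf[symmetric] by (rule sum.cong) auto

lemma zs_uminus: "zs (\<lambda>i. - s i) W = zs s W"
  by (simp add: zs_def rb_uminus rv_uminus)

lemma compat_uminus: "compat (\<lambda>i. - s i) W = compat s W"
proof -
  have "(\<exists>c. \<forall>i\<in>W. - s i = c) = (\<exists>c. \<forall>i\<in>W. s i = c)"
    by (metis minus_minus)
  thus ?thesis by (simp add: compat_def zs_uminus)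
qed

lemma sg_uminus: "sg s \<Longrightarrow> sg (\<lambda>i. - s i)"
  by (auto simp: sg_def)

lemma rb_no_refl: "(\<And>i. i \<in> W \<Longrightarrow> \<not> r i) \<Longrightarrow> rb s W = 0"
  unfolding rb_def by (rule sum.neutral) auto

text \<open>If all reflections of \<open>W\<close> had the sign of \<open>x\<close>, their signs
  would add up to plus or minus their number, which is not 0 as \<open>x\<close> is counted.\<close>

lemma rb_opposite:
  assumes "finite W" "sg s" "rb s W = 0" "x \<in> W" "r x"
  obtains y where "y \<in> W" "r y" "s y = - s x"
proof (rule ccontr)
  assume *: "\<not> thesis"
  have "\<forall>y\<in>W. r y \<longrightarrow> s y = s x" using that * assms(2) unfolding sg_def by (metis add.inverse_inverse)
  hence "rb s W = (\<Sum>i\<in>W. if r i then s x else 0)" unfolding rb_def by (intro sum.cong) auto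
  also have "\<dots> = int (card {i\<in>W. r i}) * s x"
    using assms(1) by (simp add: sum.inter_filter[symmetric])
  finally have "card {i\<in>W. r i} = 0" using assms(2)[unfolded sg_def, rule_format, of x] assms(3) by auto
  thus False using assms by auto
qed

text \<open>Each unit contributes the integer \<open>rv s u\<close> and no imbalance of reflections,
  so \<open>zero_sum_subset\<close> selects some of them. The sign \<open>c\<close> is shared by all
  units of rotations, so a selection without reflections is still \<open>compat\<close>.\<close>

lemma zero_sum_units:
  assumes fin: "finite \<U>" and n: "n \<le> card \<U>" and dis: "disjoint \<U>"
    and u: "\<And>u. u \<in> \<U> \<Longrightarrow> finite u \<and> u \<noteq> {} \<and> rb s u = 0 \<and> ((\<exists>i\<in>u. r i) \<or> (\<forall>i\<in>u. s i = c))"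
  shows "\<exists>\<J>\<subseteq>\<U>. \<Union>\<J> \<noteq> {} \<and> compat s (\<Union>\<J>)"
proof -
  obtain \<J> where J: "\<J> \<subseteq> \<U>" "\<J> \<noteq> {}" "int n dvd (\<Sum>u\<in>\<J>. rv s u)"
    using zero_sum_subset[OF fin n n_pos] by blast
  have fJ: "finite \<J>" using J(1) fin finite_subset by blast
  have dJ: "disjoint \<J>" using dis J(1) by (meson disjoint_def subsetD)
  have f: "\<And>W. W \<in> \<J> \<Longrightarrow> finite W" using u J(1) by blast
  have "rb s (\<Union>\<J>) = 0" using rb_UN[OF fJ f dJ, of s] u J(1) by (simp add: subset_iff)
  moreover have "int n dvd rv s (\<Union>\<J>)" using rv_UN[OF fJ f dJ, of s] J(3) by simp
  moreover have "(\<exists>i\<in>\<Union>\<J>. r i) \<or> (\<exists>c. \<forall>i\<in>\<Union>\<J>. s i = c)"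
  proof (cases "\<exists>i\<in>\<Union>\<J>. r i")
    case False
    hence "\<forall>i\<in>\<Union>\<J>. s i = c" using u J(1) by blast
    thus ?thesis by blast
  qed simp
  moreover have "\<Union>\<J> \<noteq> {}" using J(1,2) u by blast
  ultimately show ?thesis using J(1) unfolding compat_def zs_def by blast
qed

text \<open>Rotations of one sign, together with disjoint pairs of reflections of opposite signs, are
  units for which \<open>zero_sum_units\<close> applies; the bound on the cardinality provides \<open>n\<close> of them.\<close>

lemma compat_subset_exists:
  assumes fin: "finite Y" and s: "sg s" and card: "2 * int n - 1 + \<bar>rb s Y\<bar> \<le> int (card Y)"
  shows "\<exists>Q\<subseteq>Y. Q \<noteq> {} \<and> compat s Q"
proof -
  define P where "P = {i\<in>Y. r i \<and> s i = 1}"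
  define M where "M = {i\<in>Y. r i \<and> s i = -1}"
  define R where "R c = {i\<in>Y. \<not> r i \<and> s i = c}" for c
  have fins: "finite P" "finite M" "finite (R c)" for c using fin by (auto simp: P_def M_def R_def)
  have dj: "P \<inter> M = {}" "(P \<union> M) \<inter> (R 1 \<union> R (-1)) = {}" "R 1 \<inter> R (-1) = {}"
    unfolding P_def M_def R_def by auto
  have Y: "Y = P \<union> M \<union> (R 1 \<union> R (-1))" using s by (auto simp: P_def M_def R_def sg_def)
  have "card Y = card (P \<union> M) + card (R 1 \<union> R (-1))"
    unfolding Y using fins dj by (intro card_Un_disjoint) blast+
  also have "card (P \<union> M) = card P + card M"
    using fins dj by (intro card_Un_disjoint) blast+
  also have "card (R 1 \<union> R (-1)) = card (R 1) + card (R (-1))"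
    using fins dj by (intro card_Un_disjoint) blast+
  finally have cY: "card Y = card P + card M + (card (R 1) + card (R (-1)))" .
  have "rb s Y = rb s (P \<union> M) + rb s (R 1 \<union> R (-1))"
    unfolding Y using fins dj by (intro rb_Un) blast+
  also have "rb s (P \<union> M) = rb s P + rb s M"
    using fins dj by (intro rb_Un) blast+
  also have "rb s P = int (card P)" unfolding rb_def P_def by simp
  also have "rb s M = - int (card M)" unfolding rb_def M_def by simp
  also have "rb s (R 1 \<union> R (-1)) = 0" by (rule rb_no_refl) (auto simp: R_def)
  finally have rbY: "rb s Y = int (card P) - int (card M)" by simp
  define m where "m = min (card P) (card M)"
  \<comment> \<open>The unpaired reflections number \<open>\<bar>rb s Y\<bar>\<close>, so the
    hypothesis bounds the rest from below. Each of the \<open>m\<close> pairs counts for both signs,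
    hence one sign has at least \<open>n\<close> units.\<close>
  have "2 * n - 1 \<le> (card (R 1) + m) + (card (R (-1)) + m)"
    using card unfolding cY rbY m_def by linarith
  hence "n \<le> card (R 1) + m \<or> n \<le> card (R (-1)) + m" by linarith
  then obtain c where c: "n \<le> card (R c) + m" by blast
  obtain P' where P': "P' \<subseteq> P" "card P' = m"
    by (metis m_def min.cobounded1 obtain_subset_with_card_n)
  obtain M' where M': "M' \<subseteq> M" "card M' = m"
    by (metis m_def min.cobounded2 obtain_subset_with_card_n)
  have fP': "finite P'" and fM': "finite M'" using P' M' fins finite_subset by blast+
  obtain g where g: "bij_betw g P' M'"
    using finite_same_card_bij[OF fP' fM'] P' M' by auto
  have gM: "g x \<in> M" if "x \<in> P'" for x using g M' that by (auto simp: bij_betw_def)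
  define \<U> where "\<U> = (\<lambda>i. {i}) ` R c \<union> (\<lambda>x. {x, g x}) ` P'"
  have cPM: "P \<inter> M = {}" "P \<inter> R c = {}" "M \<inter> R c = {}" by (auto simp: P_def M_def R_def)
  have ginj: "g x = g y \<longleftrightarrow> x = y" if "x \<in> P'" "y \<in> P'" for x y
    using g that by (auto simp: bij_betw_def inj_on_def)
  have inj2: "inj_on (\<lambda>x. {x, g x}) P'"
  proof (rule inj_onI)
    fix x y assume xy: "x \<in> P'" "y \<in> P'" "{x, g x} = {y, g y}"
    have "g x \<noteq> y" using gM[OF xy(1)] xy(2) P' cPM by auto
    thus "x = y" using xy(3) by (metis doubleton_eq_iff)
  qed
  have "card \<U> = card ((\<lambda>i. {i}) ` R c) + card ((\<lambda>x. {x, g x}) ` P')"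
    unfolding \<U>_def
  proof (rule card_Un_disjoint)
    show "(\<lambda>i. {i}) ` R c \<inter> (\<lambda>x. {x, g x}) ` P' = {}"
    proof (rule equals0I)
      fix u assume "u \<in> (\<lambda>i. {i}) ` R c \<inter> (\<lambda>x. {x, g x}) ` P'"
      then obtain i x where ix: "u = {i}" "u = {x, g x}" "x \<in> P'" by blast
      hence "x \<in> {i}" "g x \<in> {i}" by auto
      hence "x = g x" by simp
      thus False using gM[OF ix(3)] ix(3) P'(1) cPM(1) by auto
    qed
  qed (use fins fP' in auto)
  also have "\<dots> = card (R c) + m" using inj2 P' by (simp add: card_image)
  finally have cU: "n \<le> card \<U>" using c by simp
  have "disjoint \<U>"
  proof (rule disjointI)
    fix u u' assume uu: "u \<in> \<U>" "u' \<in> \<U>" "u \<noteq> u'"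
    have PR: "i \<noteq> x \<and> i \<noteq> g x" if "i \<in> R c" "x \<in> P'" for i x
      using that gM[of x] P'(1) cPM by auto
    have PP: "{x, g x} \<inter> {y, g y} = {}" if "x \<in> P'" "y \<in> P'" "x \<noteq> y" for x y
      using that gM[of x] gM[of y] ginj[of x y] P'(1) cPM(1) by auto
    have "(\<exists>i\<in>R c. u = {i}) \<or> (\<exists>x\<in>P'. u = {x, g x})" "(\<exists>i\<in>R c. u' = {i}) \<or> (\<exists>x\<in>P'. u' = {x, g x})"
      using uu(1,2) unfolding \<U>_def by blast+
    thus "u \<inter> u' = {}"
    proof (elim disjE bexE)
      fix x y assume xy: "x \<in> P'" "u = {x, g x}" "y \<in> P'" "u' = {y, g y}"
      hence "x \<noteq> y" using uu(3) by auto
      thus ?thesis using PP[OF xy(1,3)] xy(2,4) by simp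
    qed (use uu(3) PR in auto)
  qed
  moreover have "finite u \<and> u \<noteq> {} \<and> rb s u = 0 \<and> ((\<exists>i\<in>u. r i) \<or> (\<forall>i\<in>u. s i = c))" if uU: "u \<in> \<U>" for u
  proof -
    consider i where "i \<in> R c" "u = {i}" | x where "x \<in> P'" "u = {x, g x}"
      using uU unfolding \<U>_def by blast
    thus ?thesis
    proof cases
      case 1 thus ?thesis by (simp add: R_def rb_def)
    next
      case 2
      have "x \<in> P" "g x \<in> M" using 2 P' gM by auto
      moreover from this have "x \<noteq> g x" using cPM(1) by auto
      ultimately show ?thesis using 2 by (auto simp: rb_def P_def M_def)
    qed
  qed
  moreover have "finite \<U>" using fins fP' by (simp add: \<U>_def)
  ultimately have "\<exists>\<J>\<subseteq>\<U>. \<Union>\<J> \<noteq> {} \<and> compat s (\<Union>\<J>)"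
    using cU by (intro zero_sum_units[where c = c]) simp_all
  then obtain \<J> where J: "\<J> \<subseteq> \<U>" "\<Union>\<J> \<noteq> {}" "compat s (\<Union>\<J>)" by blast
  have "\<Union>\<U> \<subseteq> Y" using P' gM by (auto simp: \<U>_def P_def M_def R_def)
  thus ?thesis using J by (intro exI[of _ "\<Union>\<J>"]) blast
qed

text \<open>Two opposite reflections \<open>x\<close>, \<open>y\<close> are set aside. If
  \<open>W\<close> had more than \<open>2 * n\<close> terms, the at least \<open>2 * n - 1\<close>
  others, being balanced, would contain a \<open>compat\<close> set \<open>Q\<close>; and
  \<open>W - Q\<close> would be \<open>compat\<close> because it still contains
  \<open>x\<close>.\<close>

lemma irreducible_card:
  assumes fin: "finite W" and s: "sg s" and z: "zs s W" and x: "x \<in> W" "r x"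
    and irr: "\<And>Y. Y \<subseteq> W \<Longrightarrow> Y \<noteq> {} \<Longrightarrow> compat s Y \<Longrightarrow> compat s (W - Y) \<Longrightarrow> Y = W"
  shows "card W \<le> 2 * n"
proof (rule ccontr)
  assume "\<not> card W \<le> 2 * n"
  obtain y where y: "y \<in> W" "r y" "s y = - s x"
    using rb_opposite[OF fin s _ x] z unfolding zs_def by auto
  have xy: "x \<noteq> y" using y(3) s[unfolded sg_def, rule_format, of x] by auto
  have rbxy: "rb s {x, y} = 0" using xy x y by (simp add: rb_def)
  have "rb s (W - {x, y}) = 0"
    using z rbxy x y fin by (subst rb_diff) (auto simp: zs_def)
  moreover have "card (W - {x, y}) = card W - 2"
    using xy x y fin by (subst card_Diff_subset) auto
  ultimately have "2 * int n - 1 + \<bar>rb s (W - {x, y})\<bar> \<le> int (card (W - {x, y}))"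
    using \<open>\<not> card W \<le> 2 * n\<close> by simp
  then obtain Q where Q: "Q \<subseteq> W - {x, y}" "Q \<noteq> {}" "compat s Q"
    using compat_subset_exists[of "W - {x, y}" s] fin s by auto
  have "compat s (W - Q)"
    by (rule compatI[of _ _ x]) (use Q x fin z in \<open>auto intro!: zs_diff simp: compat_def\<close>)
  with Q irr[of Q] show False using x by auto
qed

end

lemma card_1_eqI: "card S = 1 \<Longrightarrow> y \<in> S \<Longrightarrow> S = {y}"
  by (metis card_1_singletonE singletonD)

section \<open>Partitions: common parts, and blocks that avoid a given part\<close>

context signed_sequences
begin

definition blocks :: "'i set set \<Rightarrow> 'i set \<Rightarrow> bool" where
  "blocks \<B> A \<longleftrightarrow> disjoint \<B> \<and> \<Union>\<B> = A \<and> {} \<notin> \<B>"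

lemma blocks_finite:
  assumes "blocks \<B> A" "finite A"
  shows "finite \<B>" "B \<in> \<B> \<Longrightarrow> finite B" "B \<in> \<B> \<Longrightarrow> B \<subseteq> A" "B \<in> \<B> \<Longrightarrow> B \<noteq> {}"
  using assms unfolding blocks_def by (auto intro: finite_UnionD finite_subset)

lemma blocks_disj: "blocks \<B> A \<Longrightarrow> B \<in> \<B> \<Longrightarrow> B' \<in> \<B> \<Longrightarrow> B \<noteq> B' \<Longrightarrow> B \<inter> B' = {}"
  unfolding blocks_def disjoint_def by blast

lemma blocks_mem: "blocks \<B> A \<Longrightarrow> x \<in> A \<Longrightarrow> \<exists>B\<in>\<B>. x \<in> B"
  unfolding blocks_def by blast

lemma card_blocks_Int:
  assumes "blocks \<B> A" "finite A" "V \<subseteq> A"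
  shows "(\<Sum>B\<in>\<B>. card (V \<inter> B)) = card V"
proof -
  have "V = (\<Union>B\<in>\<B>. V \<inter> B)" using assms unfolding blocks_def by blast
  hence "card V = card (\<Union>B\<in>\<B>. V \<inter> B)" by simp
  also have "\<dots> = (\<Sum>B\<in>\<B>. card (V \<inter> B))"
    by (rule card_UN_disjoint) (use assms blocks_finite[OF assms(1,2)] blocks_disj[OF assms(1)] in blast)+
  finally show ?thesis by simp
qed

lemma po_if_zs:
  assumes "sg s" "zs s W" "i \<in> W" "r i" shows "po W"
  using assms by (auto intro: poI compatI)

text \<open>The removal of a block \<open>V\<close> of one factorization and of a set \<open>\<Union>I\<close> of blocks of another one
  leave room for a common product-one part \<open>Q\<close>.\<close>

lemma common_part:
  assumes fin: "finite A" and s: "sg s" and zA: "zs s A"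
    and bl: "blocks \<B> A" and k: "2 * n + 1 \<le> card \<B>"
    and B2: "\<And>B. B \<in> \<B> \<Longrightarrow> po B \<and> 2 \<le> card B \<and> rb s B = 0"
    and V: "V \<subseteq> A" "zs s V" "v0 \<in> V" "r v0" "card V \<le> 2 * n"
    and AV: "(\<exists>i\<in>A - V. r i) \<or> (\<exists>c. \<forall>i\<in>A - V. s i = c)"
  shows "\<exists>Q. Q \<noteq> {} \<and> Q \<subseteq> A - V \<and> po Q \<and> po (A - V - Q) \<and>
           (Q \<in> \<B> \<or> (\<exists>I\<subseteq>\<B>. I \<noteq> {} \<and> \<Union>I \<inter> Q = {} \<and> po (A - \<Union>I - Q)))"
proof -
  note finB = blocks_finite[OF bl fin]
  note disB = blocks_disj[OF bl]
  have s1: "s i = 1 \<or> s i = -1" for i using s by (simp add: sg_def)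
  have zAV: "zs s (A - V)" using zs_diff[OF fin V(1) zA V(2)] .
  show ?thesis
  proof (cases "\<exists>B\<in>\<B>. B \<inter> V = {} \<and> (\<forall>i\<in>B. \<not> r i) \<and> (\<exists>c. \<forall>i\<in>B. s i = c)")
    case True
    \<comment> \<open>A reflection-free block outside \<open>V\<close> on which \<open>s\<close> is
      constant serves itself as \<open>Q\<close>: its own sign function is constant too, hence equal
      to \<open>s\<close> up to a global sign.\<close>
    then obtain B c where B: "B \<in> \<B>" "B \<inter> V = {}" "\<forall>i\<in>B. \<not> r i" "\<forall>i\<in>B. s i = c" by blast
    obtain i0 where i0: "i0 \<in> B" using finB(4)[OF B(1)] by blast
    obtain s' where s': "sg s'" "compat s' B" using B2[OF B(1)] by (auto simp: po_def)
    then obtain c' where c': "\<forall>i\<in>B. s' i = c'" using B(3) by (auto simp: compat_def)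
    have cc: "c = 1 \<or> c = -1" using s1[of i0] B(4) i0 by auto
    have cc': "c' = 1 \<or> c' = -1" using s'(1) c' i0 unfolding sg_def by metis
    have "(\<forall>i\<in>B. s i = s' i) \<or> (\<forall>i\<in>B. s i = - s' i)" using cc cc' B(4) c' by auto
    hence cB: "compat s B"
    proof
      assume "\<forall>i\<in>B. s i = s' i"
      thus ?thesis using compat_cong[of B s s'] s' by simp
    next
      assume "\<forall>i\<in>B. s i = - s' i"
      thus ?thesis using compat_cong[of B s "\<lambda>i. - s' i"] s' compat_uminus by simp
    qed
    have sub: "B \<subseteq> A - V" using B finB by blast
    have "compat s (A - V - B)"
      unfolding compat_def using zs_diff[OF _ sub zAV compat_zs[OF cB]] fin AV B(3) by auto
    thus ?thesis using B(1) sub i0 poI[OF s] cB by (intro exI[of _ B]) blast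
  next
    case no1: False
    show ?thesis
    proof (cases "\<exists>B\<in>\<B>. card B = 2 \<and> (\<forall>i\<in>B. r i) \<and> card (V \<inter> B) = 1")
      case True
      \<comment> \<open>Here \<open>I\<close> is \<open>{B}\<close>. On a pair of reflections any
        two balanced sign functions agree up to a global sign, so \<open>B\<close> is zero-sum for
        \<open>s\<close>. The partner \<open>y\<close> outside \<open>V\<close> is kept out of
        \<open>Q\<close> and is the reflection left in \<open>A - V - Q\<close>; the one left in
        \<open>A - B - Q\<close> is \<open>w\<close> in \<open>V\<close>, opposite to
        \<open>x\<close>.\<close>
      then obtain B where B: "B \<in> \<B>" "card B = 2" "\<forall>i\<in>B. r i" "card (V \<inter> B) = 1" by blast
      obtain x where x: "V \<inter> B = {x}" using B(4) by (auto simp: card_1_singleton_iff)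
      have xB: "x \<in> B" using x by blast
      have "card (B - {x}) = 1" using B(2) xB by simp
      then obtain y where "B - {x} = {y}" by (auto simp: card_1_singleton_iff)
      hence y: "B = {x, y}" "y \<noteq> x" using xB by auto
      have yV: "y \<notin> V" using x y by auto
      have yA: "y \<in> A - V" using y yV finB(3)[OF B(1)] by auto
      have syx: "s y = - s x" using B2[OF B(1)] B(3) y by (simp add: rb_def)
      obtain s' where s': "sg s'" "compat s' B" using B2[OF B(1)] by (auto simp: po_def)
      have "s' x + s' y = 0" using s' B(3) y by (simp add: compat_def zs_def rb_def)
      hence sy': "s' y = - s' x" by simp
      have "s x = s' x \<or> s x = - s' x"
        using s1[of x] s'(1)[unfolded sg_def, rule_format, of x] by auto
      hence "(\<forall>i\<in>B. s i = s' i) \<or> (\<forall>i\<in>B. s i = - s' i)"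
        unfolding y(1) using syx sy' by auto
      hence zB: "zs s B"
        using compat_zs[OF s'(2)] zs_cong[of B s s'] zs_cong[of B s "\<lambda>i. - s' i"] zs_uminus[of s'] by auto
      define Y where "Y = A - V - {y}"
      have "card A \<ge> 2 * card \<B>"
      proof -
        have "card A = (\<Sum>B\<in>\<B>. card (A \<inter> B))" using card_blocks_Int[OF bl fin] by simp
        also have "\<dots> = (\<Sum>B\<in>\<B>. card B)" using finB(3) by (intro sum.cong) (auto simp: Int_absorb1)
        also have "\<dots> \<ge> (\<Sum>B\<in>\<B>. 2)" by (rule sum_mono) (use B2 in blast)
        finally show ?thesis by simp
      qed
      moreover have "card Y = card A - card V - 1"
        unfolding Y_def using fin yA V(1) by (simp add: card_Diff_subset finite_subset)
      moreover have "rb s Y = - s y"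
        unfolding Y_def using zAV yA fin B(3) y by (subst rb_diff) (auto simp: zs_def rb_def)
      moreover have "\<bar>s y\<bar> = 1" using s1[of y] by auto
      \<comment> \<open>\<open>A\<close> has at least \<open>4 * n + 2\<close> terms and
        \<open>V\<close> at most \<open>2 * n\<close>, so \<open>Y\<close> has at least
        \<open>2 * n + 1\<close>; with imbalance 1, already \<open>2 * n\<close> would do.\<close>
      ultimately have "2 * int n - 1 + \<bar>rb s Y\<bar> \<le> int (card Y)" using k V(5) by simp
      then obtain Q where Q: "Q \<subseteq> Y" "Q \<noteq> {}" "compat s Q"
        using compat_subset_exists[of Y s] fin s unfolding Y_def by auto
      have z1: "zs s (A - V - Q)"
        by (rule zs_diff) (use Q zAV fin in \<open>auto simp: Y_def compat_def\<close>)
      have "zs s (A - B)" by (rule zs_diff) (use fin zA zB finB(3)[OF B(1)] in auto)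
      hence z2: "zs s (A - B - Q)"
        by (rule zs_diff[rotated 2]) (use fin Q x y in \<open>auto simp: Y_def compat_def\<close>)
      obtain w where w: "w \<in> V" "r w" "s w = - s x"
        by (rule rb_opposite[of V s x]) (use s V fin x B(3) y in \<open>auto simp: zs_def intro: finite_subset\<close>)
      have "w \<noteq> x" using w(3) s1[of x] by auto
      hence "w \<in> A - B - Q" using w V(1) y yV Q(1) unfolding Y_def by auto
      hence p2: "po (A - B - Q)" using po_if_zs[OF s z2] w by blast
      have "y \<in> A - V - Q" using yA Q(1) unfolding Y_def by auto
      hence p1: "po (A - V - Q)" using po_if_zs[OF s z1] B(3) y by blast
      have "B \<inter> Q = {}" using Q(1) x y unfolding Y_def by auto
      hence "\<exists>I\<subseteq>\<B>. I \<noteq> {} \<and> \<Union>I \<inter> Q = {} \<and> po (A - \<Union>I - Q)"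
        using p2 B(1) by (intro exI[of _ "{B}"]) auto
      moreover have "Q \<subseteq> A - V" using Q(1) unfolding Y_def by blast
      ultimately show ?thesis using Q(2) p1 poI[OF s Q(3)] by blast
    next
      case no2: False
      \<comment> \<open>Units outside \<open>V\<close>: a pair of opposite reflections
        (\<open>a B\<close>) is a unit for both signs, a rotation (\<open>b c B\<close>) only for
        its own sign \<open>c\<close>.\<close>
      define a where "a B \<longleftrightarrow> (\<exists>x\<in>B - V. \<exists>y\<in>B - V. r x \<and> r y \<and> s x = 1 \<and> s y = -1)" for B
      define b where "b c B \<longleftrightarrow> (\<exists>i\<in>B - V. \<not> r i \<and> s i = c)" for c B
      define N where "N c = {B\<in>\<B>. a B \<or> b c B}" for c
      have fN: "finite (N c)" for c using finB(1) by (simp add: N_def)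
      \<comment> \<open>A block short of units makes up for it by meeting \<open>V\<close>; the two
        cases excluded above are those in which it would not.\<close>
      have key: "2 \<le> (if a B \<or> b 1 B then 1 else 0) + (if a B \<or> b (-1) B then 1 else 0) + card (V \<inter> B)"
        if B: "B \<in> \<B>" for B
      proof -
        have fB: "finite B" and rbB: "rb s B = 0" and cB: "2 \<le> card B" using finB B2 B by auto
        consider "a B" | "b 1 B" "b (-1) B" | c where "\<not> a B" "c = 1 \<or> c = -1" "b c B" "\<not> b (- c) B"
          | "\<not> a B" "\<not> b 1 B" "\<not> b (-1) B" by force
        thus ?thesis
        proof cases
          case (3 c)
          have "V \<inter> B \<noteq> {}"
          proof
            assume VB: "V \<inter> B = {}"
            have nr: "\<forall>i\<in>B. \<not> r i"
            proof (rule ccontr)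
              assume "\<not> (\<forall>i\<in>B. \<not> r i)"
              then obtain x where x: "x \<in> B" "r x" by blast
              then obtain y where y: "y \<in> B" "r y" "s y = - s x" using rb_opposite[OF fB s rbB] by blast
              have xy: "x \<in> B - V" "y \<in> B - V" using x(1) y(1) VB by blast+
              have "s x = 1 \<and> s y = -1 \<or> s y = 1 \<and> s x = -1" using s1[of x] y(3) by auto
              hence "a B" unfolding a_def using xy x(2) y(2) by blast
              thus False using 3 by simp
            qed
            have "\<forall>i\<in>B. s i = c" using 3(2,4) nr VB s1 unfolding b_def by fastforce
            thus False using no1 B VB nr by blast
          qed
          hence "1 \<le> card (V \<inter> B)" using fB by (simp add: Suc_le_eq card_gt_0_iff)
          thus ?thesis using 3 by auto
        next
          case 4
          have "2 \<le> card (V \<inter> B)"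
          proof (cases "B \<subseteq> V")
            case True thus ?thesis using cB by (simp add: Int_absorb1)
          next
            case False
            then obtain x where x: "x \<in> B" "x \<notin> V" by blast
            have rall: "r i" if "i \<in> B - V" for i using 4(2,3) s1[of i] that unfolding b_def by blast
            have sall: "s i = s x" if "i \<in> B - V" for i
              using 4(1) s1[of i] s1[of x] that x rall unfolding a_def by (metis DiffI)
            have rx: "r x" using rall x by auto
            obtain y where y: "y \<in> B" "r y" "s y = - s x" using rb_opposite[OF fB s rbB x(1) rx] by blast
            have yV: "y \<in> V" using sall[of y] y s1[of x] by (cases "y \<in> V") auto
            show ?thesis
            proof (rule ccontr)
              assume "\<not> 2 \<le> card (V \<inter> B)"
              moreover have "card (V \<inter> B) \<noteq> 0" using yV y(1) fB by auto
              ultimately have c1: "card (V \<inter> B) = 1" by linarith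
              hence VB: "V \<inter> B = {y}" using yV y(1) by (intro card_1_eqI) auto
              \<comment> \<open>If \<open>y\<close> is the only term of \<open>B\<close> in
                \<open>V\<close>, it alone balances the \<open>card B - 1\<close> reflections of the
                opposite sign, so \<open>B\<close> is a pair of reflections, which
                \<open>no2\<close> excludes.\<close>
              have "0 = s y + (\<Sum>i\<in>B - {y}. if r i then s i else 0)"
                using rbB y(2) sum.remove[OF fB y(1), of "\<lambda>i. if r i then s i else 0"]
                unfolding rb_def by simp
              also have "(\<Sum>i\<in>B - {y}. if r i then s i else 0) = (\<Sum>i\<in>B - {y}. s x)"
                proof (rule sum.cong)
                fix i assume "i \<in> B - {y}"
                hence "i \<in> B - V" using VB by auto
                thus "(if r i then s i else 0) = s x" using rall[of i] sall[of i] by simp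
              qed simp
              also have "\<dots> = int (card B - 1) * s x" using fB y(1) by simp
              finally have e: "0 = s y + int (card B - 1) * s x" .
              have "int (card B - 1) = 1"
                using s1[of x]
              proof
                assume "s x = 1" thus ?thesis using e unfolding y(3) by simp
              next
                assume "s x = -1" thus ?thesis using e unfolding y(3) by simp
              qed
              hence "card B = 2" using cB by linarith
              moreover have "r i" if "i \<in> B" for i
                by (cases "i \<in> V") (use that VB rall[of i] y(2) in auto)
              ultimately show False using no2 B c1 by metis
            qed
          qed
          thus ?thesis by simp
        qed auto
      qed
      have "2 * card \<B> = (\<Sum>B\<in>\<B>. 2)" by simp
      also have "\<dots> \<le> (\<Sum>B\<in>\<B>. (if a B \<or> b 1 B then 1 else 0) + (if a B \<or> b (-1) B then 1 else 0) + card (V \<inter> B))"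
        by (rule sum_mono) (rule key)
      also have "\<dots> = card (N 1) + card (N (-1)) + card V"
        unfolding N_def sum.distrib card_blocks_Int[OF bl fin V(1)]
        using finB(1) by (simp add: sum.inter_filter[symmetric])
      \<comment> \<open>The left side is at least \<open>4 * n + 2\<close>, of which
        \<open>V\<close> accounts for at most \<open>2 * n\<close>.\<close>
      finally have "2 * n + 2 \<le> card (N 1) + card (N (-1))" using k V(5) by linarith
      hence "n + 1 \<le> card (N 1) \<or> n + 1 \<le> card (N (-1))" by linarith
      then obtain c where c: "n + 1 \<le> card (N c)" by blast
      \<comment> \<open>Only \<open>n\<close> of the \<open>n + 1\<close> blocks are needed. The
        spare one is chosen with a pair of opposite reflections outside \<open>V\<close> whenever
        such a block exists, which keeps a reflection in \<open>A - V - Q\<close>.\<close>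
      obtain G where G: "G \<subseteq> N c" "card G = n" "(\<exists>B\<in>N c - G. a B) \<or> (\<forall>B\<in>\<B>. \<not> a B)"
      proof (cases "\<exists>B\<in>N c. a B")
        case True
        then obtain B where B: "B \<in> N c" "a B" by blast
        have "n \<le> card (N c - {B})" using c B fN by simp
        then obtain G where "G \<subseteq> N c - {B}" "card G = n" by (metis obtain_subset_with_card_n)
        thus thesis using B that[of G] by blast
      next
        case False
        have "n \<le> card (N c)" using c by simp
        then obtain G where "G \<subseteq> N c" "card G = n" by (metis obtain_subset_with_card_n)
        thus thesis using False that[of G] unfolding N_def by blast
      qed
      have GB: "G \<subseteq> \<B>" using G(1) unfolding N_def by blast
      have fG: "finite G" using GB finB(1) finite_subset by blast
      have "\<exists>u. u \<noteq> {} \<and> u \<subseteq> B - V \<and> rb s u = 0 \<and> ((\<exists>i\<in>u. r i) \<and> a B \<or> (\<forall>i\<in>u. \<not> r i \<and> s i = c))"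
        if BG: "B \<in> G" for B
      proof -
        consider "a B" | "b c B" using BG G(1) unfolding N_def by blast
        thus ?thesis
        proof cases
          case 1
          then obtain x y where "x \<in> B - V" "y \<in> B - V" "r x" "r y" "s x = 1" "s y = -1"
            unfolding a_def by blast
          moreover from this have "x \<noteq> y" by auto
          ultimately show ?thesis using 1 by (intro exI[of _ "{x, y}"]) (auto simp: rb_def)
        next
          case 2
          then obtain i where "i \<in> B - V" "\<not> r i" "s i = c" unfolding b_def by blast
          thus ?thesis by (intro exI[of _ "{i}"]) (auto simp: rb_def)
        qed
      qed
      then obtain u where u: "\<And>B. B \<in> G \<Longrightarrow> u B \<noteq> {} \<and> u B \<subseteq> B - V \<and> rb s (u B) = 0 \<and>
          ((\<exists>i\<in>u B. r i) \<and> a B \<or> (\<forall>i\<in>u B. \<not> r i \<and> s i = c))" by metis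
      have ud: "u B \<inter> u B' = {}" if "B \<in> G" "B' \<in> G" "B \<noteq> B'" for B B'
        using u[OF that(1)] u[OF that(2)] disB[of B B'] that GB by blast
      have inj: "inj_on u G" by (rule inj_onI) (metis ud u Int_absorb)
      have cu: "card (u ` G) = n" using inj G(2) by (simp add: card_image)
      have "disjoint (u ` G)" by (rule disjointI) (use ud in blast)
      moreover have "finite w \<and> w \<noteq> {} \<and> rb s w = 0 \<and> ((\<exists>i\<in>w. r i) \<or> (\<forall>i\<in>w. s i = c))"
        if wG: "w \<in> u ` G" for w
      proof -
        obtain B where B: "B \<in> G" "w = u B" using wG by blast
        have "finite (u B)" using u[OF B(1)] finB(2)[of B] B(1) GB by (meson Diff_subset finite_subset subsetD)
        thus ?thesis using u[OF B(1)] B(2) by blast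
      qed
      ultimately have "\<exists>\<J>\<subseteq>u ` G. \<Union>\<J> \<noteq> {} \<and> compat s (\<Union>\<J>)"
        using fG cu by (intro zero_sum_units[where c = c]) simp_all
      then obtain \<J> where J: "\<J> \<subseteq> u ` G" "\<Union>\<J> \<noteq> {}" "compat s (\<Union>\<J>)" by blast
      define Q where "Q = \<Union>\<J>"
      have QG: "Q \<subseteq> \<Union>G - V" unfolding Q_def using J(1) u by blast
      have QA: "Q \<subseteq> A - V" using QG GB finB(3) by blast
      have zQ: "zs s Q" using J(3) by (simp add: Q_def compat_def)
      have z1: "zs s (A - V - Q)" by (rule zs_diff[OF _ QA zAV zQ]) (use fin in auto)
      have c1: "compat s (A - V - Q)"
      proof (cases "\<exists>B\<in>N c - G. a B")
        case True
        then obtain B where B: "B \<in> N c" "B \<notin> G" "a B" by blast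
        obtain x where x: "x \<in> B - V" "r x" using B(3) unfolding a_def by blast
        have BB: "B \<in> \<B>" using B(1) by (simp add: N_def)
        have "x \<notin> \<Union>G" using x disB[OF BB] B(2) GB by blast
        hence "x \<in> A - V - Q" using x QG finB(3)[OF BB] by blast
        thus ?thesis using compatI[OF z1] x(2) by blast
      next
        case False
        hence "\<forall>B\<in>G. \<not> a B" using G(3) GB by blast
        hence "\<forall>i\<in>Q. \<not> r i" unfolding Q_def using J(1) u by blast
        thus ?thesis using z1 AV unfolding compat_def by blast
      qed
      \<comment> \<open>The at least \<open>n + 1\<close> blocks outside \<open>G\<close> are
        disjoint from \<open>Q\<close> and balanced. Since \<open>n\<close> of them suffice for a
        zero-sum union \<open>\<Union>I\<close>, one with a reflection can be spared; if none has a
        reflection, \<open>v0\<close> remains.\<close>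
      define M where "M = \<B> - G"
      have fM: "finite M" using finB(1) by (simp add: M_def)
      have cM: "n + 1 \<le> card M" unfolding M_def using card_Diff_subset[OF fG GB] k G(2) by simp
      have MQ: "B \<inter> Q = {}" if "B \<in> M" for B
        using that QG disB GB unfolding M_def by blast
      obtain M' where M': "M' \<subseteq> M" "n \<le> card M'" "(\<exists>B\<in>M - M'. \<exists>i\<in>B. r i) \<or> (\<forall>B\<in>M. \<forall>i\<in>B. \<not> r i)"
      proof (cases "\<exists>B\<in>M. \<exists>i\<in>B. r i")
        case True
        then obtain B where B: "B \<in> M" "\<exists>i\<in>B. r i" by blast
        show thesis by (rule that[of "M - {B}"]) (use cM B fM in auto)
      next
        case False
        show thesis by (rule that[of M]) (use cM False in auto)
      qed
      obtain I where I: "I \<subseteq> M'" "I \<noteq> {}" "int n dvd (\<Sum>B\<in>I. rv s B)"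
        using zero_sum_subset[of M' n "rv s"] M' n_pos finite_subset[OF M'(1) fM] by blast
      have IB: "I \<subseteq> \<B>" and IM: "I \<subseteq> M" using I(1) M'(1) unfolding M_def by blast+
      have fI: "finite I" using IB finB(1) finite_subset by blast
      have dI: "disjoint I" using bl IB unfolding blocks_def disjoint_def by blast
      have "rb s (\<Union>I) = 0" using rb_UN[OF fI _ dI, of s] finB(2) IB B2 by (simp add: subset_iff)
      moreover have "int n dvd rv s (\<Union>I)" using rv_UN[OF fI _ dI, of s] finB(2) IB I(3) by (simp add: subset_iff)
      ultimately have zI: "zs s (\<Union>I)" by (simp add: zs_def)
      have IA: "\<Union>I \<subseteq> A" using IB finB(3) by blast
      have IQ: "\<Union>I \<inter> Q = {}" using MQ IM by blast
      have z2: "zs s (A - \<Union>I - Q)"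
        by (rule zs_diff[OF _ _ zs_diff[OF fin IA zA zI] zQ]) (use fin QA IQ in auto)
      have "\<exists>i\<in>A - \<Union>I - Q. r i"
      proof (cases "\<exists>B\<in>M - M'. \<exists>i\<in>B. r i")
        case True
        then obtain B i where B: "B \<in> M" "B \<notin> M'" "i \<in> B" "r i" by blast
        have BB: "B \<in> \<B>" using B(1) by (simp add: M_def)
        have "i \<notin> \<Union>I" using disB[OF BB] B(2,3) I(1) IB by blast
        moreover have "i \<notin> Q" using MQ[OF B(1)] B(3) by blast
        ultimately show ?thesis using B(3,4) finB(3)[OF BB] by blast
      next
        case False
        hence "\<forall>B\<in>M. \<forall>i\<in>B. \<not> r i" using M'(3) by blast
        hence "v0 \<notin> \<Union>I" using IM V(4) by blast
        moreover have "v0 \<notin> Q" using QA V(3) by blast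
        ultimately show ?thesis using V by blast
      qed
      hence "po (A - \<Union>I - Q)" using po_if_zs[OF s z2] by blast
      moreover have "Q \<noteq> {}" using J(2) by (simp add: Q_def)
      moreover have "po Q" using poI[OF s] J(3) by (simp add: Q_def)
      ultimately show ?thesis using QA poI[OF s c1] IB I(2) IQ by blast
    qed
  qed
qed

text \<open>An irreducible part \<open>P\<close> meets at most \<open>2 n\<close> blocks, so it avoids some block.\<close>

lemma disjoint_block:
  assumes fin: "finite A" and s: "sg s" and zA: "zs s A"
    and bl: "blocks \<B> A" and k: "2 * n + 1 \<le> card \<B>" and cB: "\<And>B. B \<in> \<B> \<Longrightarrow> zs s B"
    and P: "P \<subseteq> A" "zs s P" "card P \<le> 2 * n" "p \<in> P" "r p" "q \<in> A - P" "r q"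
  shows "\<exists>U\<in>\<B>. U \<inter> P = {} \<and> po (A - P - U)"
proof -
  note finB = blocks_finite[OF bl fin]
  note disB = blocks_disj[OF bl]
  define N where "N = {U\<in>\<B>. U \<inter> P = {}}"
  have main: "po (A - P - U)" if "U \<in> N" "\<exists>i\<in>A - P - U. r i" for U
  proof -
    have "zs s (A - P - U)"
      by (rule zs_diff[OF _ _ zs_diff[OF fin P(1) zA P(2)]])
        (use fin that(1) finB(3)[of U] cB in \<open>auto simp: N_def\<close>)
    thus ?thesis using po_if_zs[OF s] that(2) by blast
  qed
  have fP: "finite P" using P(1) fin finite_subset by blast
  have sumP: "(\<Sum>B\<in>\<B>. card (P \<inter> B)) = card P" by (rule card_blocks_Int[OF bl fin P(1)])
  have pos: "1 \<le> card (P \<inter> B)" if "B \<in> \<B> - N" for B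
    using that fP by (auto simp: N_def Suc_le_eq card_gt_0_iff Int_commute)
  have "(\<Sum>B\<in>\<B>. card (P \<inter> B)) = (\<Sum>B\<in>\<B> - N. card (P \<inter> B))"
    by (rule sum.mono_neutral_right) (use finB(1) in \<open>auto simp: N_def Int_commute\<close>)
  hence sumP': "(\<Sum>B\<in>\<B> - N. card (P \<inter> B)) = card P" using sumP by simp
  have "card (\<B> - N) \<le> card P"
    using sum_mono[of "\<B> - N" "\<lambda>_. 1" "\<lambda>B. card (P \<inter> B)"] pos sumP' by simp
  moreover have "card (\<B> - N) = card \<B> - card N"
    using finB(1) by (intro card_Diff_subset) (auto simp: N_def)
  moreover have "card N \<le> card \<B>" by (rule card_mono) (use finB(1) in \<open>auto simp: N_def\<close>)
  ultimately have cN: "1 \<le> card N" "card N = 1 \<Longrightarrow> card P \<le> card (\<B> - N)" using k P(3) by linarith+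
  then obtain U where U: "U \<in> N" by (metis card.empty equals0I not_one_le_zero)
  have UB: "U \<in> \<B>" "U \<inter> P = {}" using U by (auto simp: N_def)
  show ?thesis
  proof (cases "\<exists>i\<in>A - P - U. r i")
    case True thus ?thesis using main[OF U] UB by blast
  next
    case no: False
    hence qU: "q \<in> U" using P(6,7) by blast
    show ?thesis
    proof (cases "\<exists>U'\<in>N. U' \<noteq> U")
      case True
      then obtain U' where U': "U' \<in> N" "U' \<noteq> U" by blast
      have "q \<notin> U'" using qU disB[of U U'] U' UB(1) unfolding N_def by blast
      hence "\<exists>i\<in>A - P - U'. r i" using P(6,7) by blast
      thus ?thesis using main[OF U'(1)] U'(1) unfolding N_def by blast
    next
      case False
      \<comment> \<open>The other blocks, at least \<open>2 * n\<close> in number, all meet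
        \<open>P\<close>, which has at most \<open>2 * n\<close> terms, so each meets it exactly
        once. The reflection opposite to \<open>p\<close> in the block of \<open>p\<close> then lies
        outside \<open>P\<close> and \<open>U\<close>, against \<open>no\<close>.\<close>
      hence N1: "N = {U}" using U by blast
      obtain B where B: "B \<in> \<B>" "p \<in> B" using blocks_mem[OF bl] P(1,4) by blast
      obtain y where y: "y \<in> B" "r y" "s y = - s p"
        using rb_opposite[of B s p] finB(2)[OF B(1)] s cB[OF B(1)] B(2) P(5) unfolding zs_def by blast
      have yp: "y \<noteq> p" using y(3) s[unfolded sg_def, rule_format, of p] by auto
      have BU: "B \<noteq> U" using B(2) P(4) UB by blast
      have "card (P \<inter> B) = 1"
      proof (rule ccontr)
        assume "card (P \<inter> B) \<noteq> 1"
        moreover have BN: "B \<in> \<B> - N" using B(1) BU N1 by blast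
        ultimately have "1 < card (P \<inter> B)" using pos[OF BN] by linarith
        hence "(\<Sum>B\<in>\<B> - N. 1) < (\<Sum>B\<in>\<B> - N. card (P \<inter> B))"
          using finB(1) pos BN by (intro sum_strict_mono_ex1) auto
        hence "card (\<B> - N) < card P" using sumP' by simp
        moreover have "card P \<le> card (\<B> - N)" using cN(2) N1 by simp
        ultimately show False by simp
      qed
      hence "P \<inter> B = {p}" using B(2) P(4) by (intro card_1_eqI) auto
      hence "y \<notin> P" using y(1) yp by auto
      moreover have "y \<notin> U" using disB[OF B(1) UB(1) BU] y(1) by blast
      ultimately have "y \<in> A - P - U" using finB(3)[OF B(1)] y(1) by blast
      thus ?thesis using no y(2) by blast
    qed
  qed
qed

end

section \<open>Product-one sequences over a dihedral group\<close>

text \<open>Multiplicities in \<open>mset_set W\<close> are at most 1, so any part of it is again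
  the multiset of a set; some part of it maps to \<open>P\<close>.\<close>

lemma submultiset_image_index:
  assumes "finite W" "P \<subseteq># image_mset f (mset_set W)"
  obtains Y where "Y \<subseteq> W" "image_mset f (mset_set Y) = P"
proof -
  obtain M where "image_mset f (mset_set W) = P + M" using assms(2) by (metis mset_subset_eq_exists_conv)
  then obtain A B where AB: "mset_set W = A + B" "image_mset f A = P"
    by (metis image_mset_eq_plusD)
  have "A \<subseteq># mset_set W" using AB(1) by simp
  have "A = mset_set (set_mset A)"
  proof (rule multiset_eqI)
    fix x
    have "count A x \<le> count (mset_set W) x" using \<open>A \<subseteq># mset_set W\<close> by (rule mset_subset_eq_count)
    also have "\<dots> \<le> 1" by (simp add: count_mset_set')
    finally have "count A x \<le> 1" .
    show "count A x = count (mset_set (set_mset A)) x"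
    proof (cases "count A x = 0")
      case True
      hence "x \<notin># A" by (simp add: not_in_iff)
      thus ?thesis using True by (simp add: count_mset_set')
    next
      case False
      hence "x \<in># A" by (meson not_in_iff)
      moreover have "count A x = 1" using False \<open>count A x \<le> 1\<close> by linarith
      ultimately show ?thesis by (simp add: count_mset_set')
    qed
  qed
  moreover have "set_mset A \<subseteq> W" using \<open>A \<subseteq># mset_set W\<close> assms(1) by (metis finite_set_mset_mset_set set_mset_mono)
  ultimately show ?thesis using that AB(2) by metis
qed

lemma image_mset_set_Un:
  assumes "finite W" "finite Y" "W \<inter> Y = {}"
  shows "image_mset f (mset_set (W \<union> Y)) = image_mset f (mset_set W) + image_mset f (mset_set Y)"
  using assms by (simp add: mset_set_Union)

lemma image_mset_set_diff:
  assumes "finite W" "Y \<subseteq> W"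
  shows "image_mset f (mset_set W) = image_mset f (mset_set Y) + image_mset f (mset_set (W - Y))"
  using image_mset_set_Un[of Y "W - Y" f] assms by (simp add: finite_subset Un_absorb1)

locale dihedral = group G for G (structure) +
  fixes n :: nat and a t
  assumes n_pos: "0 < n" and n_odd: "odd n" and ord: "order G = 2 * n"
    and a: "a \<in> carrier G" and t: "t \<in> carrier G"
    and gen: "generate G {a, t} = carrier G"
    and an: "a [^] n = \<one>" and tt: "t [^] (2::nat) = \<one>" and ta: "t \<otimes> a = inv a \<otimes> t"
begin

definition el :: "int \<Rightarrow> bool \<Rightarrow> 'a" where
  "el i b = a [^] i \<otimes> (if b then t else \<one>)"

lemma pow_carrier[simp, intro]: "a [^] (i::int) \<in> carrier G"
  using a by (rule int_pow_closed)

lemma el_carrier[simp, intro]: "el i b \<in> carrier G"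
  using t by (simp add: el_def)

lemma ttid: "t \<otimes> t = \<one>"
  using tt t by (simp add: numeral_2_eq_2)

lemma pow_n_mult: "a [^] (int n * q) = \<one>"
proof -
  have "a [^] (int n * q) = (a [^] int n) [^] q" by (rule int_pow_pow[OF a, symmetric])
  also have "a [^] int n = \<one>" using an by (simp add: int_pow_int)
  finally show ?thesis by simp
qed

lemma pow_mod: "a [^] (i mod int n) = a [^] i"
proof -
  have "a [^] i = a [^] (int n * (i div int n) + i mod int n)" by simp
  also have "\<dots> = a [^] (int n * (i div int n)) \<otimes> a [^] (i mod int n)"
    by (rule int_pow_mult[OF a])
  finally show ?thesis by (simp add: pow_n_mult)
qed

lemma t_pow_nat: "t \<otimes> a [^] (k::nat) = inv (a [^] k) \<otimes> t"
proof (induction k)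
  case 0 thus ?case using t by simp
next
  case (Suc k)
  have c: "a [^] k \<in> carrier G" using a by simp
  have "t \<otimes> a [^] Suc k = (t \<otimes> a [^] k) \<otimes> a" using a t c by (simp add: m_assoc)
  also have "\<dots> = inv (a [^] k) \<otimes> (t \<otimes> a)" using a t c Suc by (simp add: m_assoc)
  also have "\<dots> = (inv (a [^] k) \<otimes> inv a) \<otimes> t" using a t c by (simp add: ta m_assoc)
  also have "inv (a [^] k) \<otimes> inv a = inv (a \<otimes> a [^] k)" using a c by (simp add: inv_mult_group)
  also have "a \<otimes> a [^] k = a [^] Suc k" using a by (simp add: nat_pow_comm[of a 1 k, simplified])
  finally show ?case .
qed

lemma t_pow: "t \<otimes> a [^] (i::int) = a [^] (- i) \<otimes> t"
proof -
  \<comment> \<open>A nonnegative representative of the exponent modulo \<open>n\<close> reduces the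
    claim to natural powers.\<close>
  define k where "k = nat (i mod int n)"
  have "a [^] k = a [^] i"
    using pow_mod[of i] n_pos by (simp add: k_def flip: int_pow_int)
  thus ?thesis using t_pow_nat[of k] a by (simp add: int_pow_neg)
qed

lemma el_mult: "el i b \<otimes> el j c = el (i + (if b then - j else j)) (b \<noteq> c)"
proof (cases b)
  case False
  have "a [^] i \<otimes> (a [^] j \<otimes> (if c then t else \<one>)) = a [^] (i + j) \<otimes> (if c then t else \<one>)"
    using t by (simp add: int_pow_mult a m_assoc)
  thus ?thesis using False by (simp add: el_def)
next
  case True
  have "el i b \<otimes> el j c = a [^] i \<otimes> ((t \<otimes> a [^] j) \<otimes> (if c then t else \<one>))"
    using True t by (simp add: el_def m_assoc)
  also have "\<dots> = (a [^] i \<otimes> a [^] (- j)) \<otimes> (t \<otimes> (if c then t else \<one>))"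
    unfolding t_pow using t by (simp add: m_assoc)
  also have "a [^] i \<otimes> a [^] (- j) = a [^] (i - j)" by (simp add: int_pow_mult[OF a, symmetric])
  finally show ?thesis using True t by (simp add: el_def ttid)
qed

lemma el_0: "el 0 False = \<one>"
  by (simp add: el_def)

lemma el_mod: "el (i mod int n) b = el i b"
  by (simp add: el_def pow_mod)

lemma carrier_el: "carrier G = case_prod el ` ({0..<int n} \<times> UNIV)"
proof
  have "g \<in> range (case_prod el)" if "g \<in> generate G {a, t}" for g
    using that
  proof (induction rule: generate.induct)
    case one show ?case using el_0 by (metis case_prod_conv rangeI)
  next
    case (incl h)
    have "a = el 1 False" "t = el 0 True" using a t by (simp_all add: el_def)
    thus ?case using incl by (metis case_prod_conv insertE rangeI singletonD)
  next
    case (inv h)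
    have "inv a = el (-1) False" "inv t = el 0 True"
      using a t inv_equality[OF ttid t t] by (simp_all add: el_def int_pow_neg)
    thus ?case using inv by (metis case_prod_conv insertE rangeI singletonD)
  next
    case (eng h1 h2)
    then obtain i b j c where "h1 = el i b" "h2 = el j c" by auto
    thus ?case using el_mult by (metis case_prod_conv rangeI)
  qed
  hence 1: "g \<in> range (case_prod el)" if "g \<in> carrier G" for g using that gen by simp
  show "carrier G \<subseteq> case_prod el ` ({0..<int n} \<times> UNIV)"
  proof
    fix g assume "g \<in> carrier G"
    then obtain i b where "g = el i b" using 1 by fastforce
    hence "g = case_prod el (i mod int n, b)" by (simp add: el_mod)
    thus "g \<in> case_prod el ` ({0..<int n} \<times> UNIV)" by (rule image_eqI) (use n_pos in auto)
  qed
qed auto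

text \<open>The \<open>2 * n\<close> normal forms cover a group of order \<open>2 * n\<close>, so
  they are distinct: it is the order that rules out further relations.\<close>

lemma inj_el: "inj_on (case_prod el) ({0..<int n} \<times> UNIV)"
proof (rule eq_card_imp_inj_on)
  show "card (case_prod el ` ({0..<int n} \<times> UNIV)) = card ({0..<int n} \<times> (UNIV::bool set))"
    using ord carrier_el by (simp add: order_def card_cartesian_product)
qed simp

lemma el_eq_iff: "el i b = el j c \<longleftrightarrow> int n dvd i - j \<and> b = c"
proof
  assume "el i b = el j c"
  hence "case_prod el (i mod int n, b) = case_prod el (j mod int n, c)" by (simp add: el_mod)
  hence "(i mod int n, b) = (j mod int n, c)"
    by (rule inj_onD[OF inj_el]) (use n_pos in auto)
  thus "int n dvd i - j \<and> b = c" by (simp add: mod_eq_dvd_iff)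
next
  assume "int n dvd i - j \<and> b = c"
  hence "i mod int n = j mod int n" "b = c" by (simp_all add: mod_eq_dvd_iff)
  thus "el i b = el j c" using el_mod[of i b] el_mod[of j b] by simp
qed

definition refl :: "'a \<Rightarrow> bool" where
  "refl g \<longleftrightarrow> (\<exists>i. g = el i True)"

text \<open>The exponent is determined only modulo \<open>n\<close> and no normalized representative
  is chosen, so later statements about it are divisibilities.\<close>

definition val :: "'a \<Rightarrow> int" where
  "val g = (SOME i. g = el i (refl g))"

lemma el_val: assumes "g \<in> carrier G" shows "el (val g) (refl g) = g"
proof -
  obtain i b where ib: "g = el i b" using assms carrier_el by auto
  have "refl g = b"
  proof
    assume "refl g" thus b using ib by (auto simp: refl_def el_eq_iff)
  next
    assume b thus "refl g" using ib by (auto simp: refl_def)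
  qed
  hence "\<exists>i. g = el i (refl g)" using ib by blast
  from someI_ex[OF this] show ?thesis unfolding val_def by simp
qed

lemma refl_el[simp]: "refl (el i b) = b"
proof
  assume "refl (el i b)" thus b by (auto simp: refl_def el_eq_iff)
next
  assume b thus "refl (el i b)" by (auto simp: refl_def)
qed

lemma val_el: "int n dvd val (el i b) - i"
  using el_val[OF el_carrier, of i b] by (simp add: el_eq_iff)

text \<open>The exponent of the product of a list: a reflection moved past the rest inverts the
  powers of \<open>a\<close> there, hence the negated tail. The companion \<open>par\<close> records
  whether the product is a reflection.\<close>

primrec alt :: "'a list \<Rightarrow> int" where
  "alt [] = 0"
| "alt (x # xs) = val x + (if refl x then - alt xs else alt xs)"

primrec par :: "'a list \<Rightarrow> bool" where
  "par [] = False"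
| "par (x # xs) = (refl x \<noteq> par xs)"

lemma foldr_mult: "set xs \<subseteq> carrier G \<Longrightarrow> foldr (\<otimes>) xs \<one> = el (alt xs) (par xs)"
proof (induction xs)
  case Nil thus ?case by (simp add: el_0)
next
  case (Cons x xs)
  have "foldr (\<otimes>) (x # xs) \<one> = el (val x) (refl x) \<otimes> el (alt xs) (par xs)"
    using Cons el_val[of x] by simp
  thus ?case by (simp add: el_mult)
qed

definition vs :: "'a multiset \<Rightarrow> int" where
  "vs P = (\<Sum>x\<in>#P. val x)"

definition rc :: "'a multiset \<Rightarrow> int" where
  "rc P = (\<Sum>x\<in>#P. if refl x then 1 else 0)"

lemma vs_simps[simp]: "vs {#} = 0" "vs (add_mset x P) = val x + vs P" "vs (P + Q) = vs P + vs Q"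
  by (simp_all add: vs_def)

lemma rc_simps[simp]: "rc {#} = 0" "rc (add_mset x P) = (if refl x then 1 else 0) + rc P"
  "rc (P + Q) = rc P + rc Q"
  by (simp_all add: rc_def)

lemma rc_nonneg: "0 \<le> rc P"
  by (induction P) auto

lemma rc_eq_0: "rc P = 0 \<longleftrightarrow> (\<forall>x\<in>#P. \<not> refl x)"
proof (induction P)
  case (add x P) thus ?case using rc_nonneg[of P] by auto
qed simp

text \<open>\<open>P\<close> and \<open>M\<close> collect the terms by sign. A reflection put in
  front negates the tail, so the two exchange roles; as reflections alternate in sign starting with
  1, their numbers differ by 0 or 1.\<close>

lemma alt_split:
  "\<exists>P M. P + M = mset xs \<and> alt xs = vs P - vs M \<and> rc P - rc M = (if par xs then 1 else 0)"
proof (induction xs)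
  case Nil show ?case by (intro exI[of _ "{#}"]) simp
next
  case (Cons x xs)
  then obtain P M where PM: "P + M = mset xs" "alt xs = vs P - vs M"
    "rc P - rc M = (if par xs then 1 else 0)" by blast
  show ?case
  proof (cases "refl x")
    case True
    thus ?thesis using PM by (intro exI[of _ "add_mset x M"] exI[of _ P]) (auto simp: union_commute)
  next
    case False
    thus ?thesis using PM by (intro exI[of _ "add_mset x P"] exI[of _ M]) auto
  qed
qed

lemma alt_no_refl: "\<forall>x\<in>set xs. \<not> refl x \<Longrightarrow> alt xs = vs (mset xs) \<and> \<not> par xs"
  by (induction xs) auto

lemma alt_append: "\<forall>x\<in>set xs. \<not> refl x \<Longrightarrow> alt (xs @ ys) = vs (mset xs) + alt ys \<and> par (xs @ ys) = par ys"
  by (induction xs) auto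

lemma alternate_refl:
  "length ps = length ms \<Longrightarrow> \<forall>x\<in>set ps \<union> set ms. refl x \<Longrightarrow>
   \<exists>xs. mset xs = mset ps + mset ms \<and> alt xs = vs (mset ps) - vs (mset ms) \<and> \<not> par xs"
proof (induction ps ms rule: list_induct2)
  case Nil show ?case by (intro exI[of _ "[]"]) simp
next
  case (Cons p ps m ms)
  then obtain xs where "mset xs = mset ps + mset ms" "alt xs = vs (mset ps) - vs (mset ms)" "\<not> par xs" by auto
  thus ?case using Cons.prems by (intro exI[of _ "p # m # xs"]) auto
qed

text \<open>The multiset form of \<open>compat\<close>, with \<open>P\<close> and \<open>M\<close>
  for the signs 1 and -1. For rotations only, the common sign is normalized to 1, which makes
  \<open>M\<close> empty.\<close>

definition balanced :: "'a multiset \<Rightarrow> 'a multiset \<Rightarrow> bool" where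
  "balanced P M \<longleftrightarrow> rc P = rc M \<and> int n dvd vs P - vs M \<and> (0 < rc P \<or> M = {#})"

lemma size_rc: "int (size (filter_mset refl P)) = rc P"
  by (induction P) auto

lemma product_oneI:
  assumes c: "set_mset (P + M) \<subseteq> carrier G" and b: "balanced P M"
  shows "product_one G (P + M)"
proof (cases "M = {#}")
  case True
  obtain xs where xs: "mset xs = P" using ex_mset by blast
  have "\<forall>x\<in>set xs. \<not> refl x" using b True rc_eq_0[of P] xs by (auto simp: balanced_def)
  hence "alt xs = vs P" "\<not> par xs" using alt_no_refl[of xs] xs by auto
  moreover have "set xs \<subseteq> carrier G" using c xs by auto
  ultimately have "foldr (\<otimes>) xs \<one> = el (vs P) False" using foldr_mult by simp
  also have "\<dots> = el 0 False" using b True by (subst el_eq_iff) (simp add: balanced_def)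
  finally show ?thesis unfolding product_one_def using xs True el_0 by auto
next
  case False
  obtain pr where pr: "mset pr = filter_mset (\<lambda>x. \<not> refl x) P" using ex_mset by blast
  obtain mr where mr: "mset mr = filter_mset (\<lambda>x. \<not> refl x) M" using ex_mset by blast
  obtain ps where ps: "mset ps = filter_mset refl P" using ex_mset by blast
  obtain ms where ms: "mset ms = filter_mset refl M" using ex_mset by blast
  have Pd: "P = mset pr + mset ps" unfolding pr ps by (metis multiset_partition union_commute)
  have Md: "M = mset mr + mset ms" unfolding mr ms by (metis multiset_partition union_commute)
  have npr: "\<forall>x\<in>set pr. \<not> refl x" "\<forall>x\<in>set mr. \<not> refl x"
    using pr mr by (auto simp flip: set_mset_mset)
  have rps: "\<forall>x\<in>set ps. refl x" "\<forall>x\<in>set ms. refl x"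
    using ps ms by (auto simp flip: set_mset_mset)
  have "int (length ps) = rc P" "int (length ms) = rc M"
    using size_rc[of P] size_rc[of M] ps ms by (metis size_mset)+
  hence len: "length ps = length ms" "ps \<noteq> []" using b False by (auto simp: balanced_def)
  then obtain p ps' m ms' where pm: "ps = p # ps'" "ms = m # ms'" "length ps' = length ms'"
    by (cases ps; cases ms) auto
  obtain xs where xs: "mset xs = mset ps' + mset ms'" "alt xs = vs (mset ps') - vs (mset ms')" "\<not> par xs"
    using alternate_refl[OF pm(3)] rps pm by auto
  \<comment> \<open>The rotations of \<open>P\<close> precede every reflection and count positively;
    those of \<open>M\<close> follow the single reflection \<open>p\<close> and count negatively.
    Then \<open>m\<close> restores the sign, and the remaining reflections alternate.\<close>
  define ys where "ys = pr @ p # mr @ m # xs"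
  have mys: "mset ys = P + M" unfolding ys_def Pd Md pm using xs by simp
  have rpm: "refl p" "refl m" using rps pm by auto
  have "alt ys = vs P - vs M" "\<not> par ys"
    unfolding ys_def Pd Md pm using xs npr rpm alt_append[of pr] alt_append[of mr] by auto
  moreover have "set ys \<subseteq> carrier G" using c mys by (metis set_mset_mset)
  ultimately have "foldr (\<otimes>) ys \<one> = el (vs P - vs M) False" using foldr_mult by simp
  also have "\<dots> = el 0 False" using b by (subst el_eq_iff) (simp add: balanced_def)
  finally show ?thesis unfolding product_one_def using mys el_0 by auto
qed

lemma product_oneE:
  assumes c: "set_mset S \<subseteq> carrier G" and p: "product_one G S"
  obtains P M where "P + M = S" "balanced P M"
proof -
  obtain xs where xs: "mset xs = S" "foldr (\<otimes>) xs \<one> = \<one>" using p by (auto simp: product_one_def)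
  have "el (alt xs) (par xs) = el 0 False" using xs foldr_mult[of xs] c el_0 by auto
  hence ap: "int n dvd alt xs" "\<not> par xs" by (simp_all add: el_eq_iff)
  obtain P M where PM: "P + M = S" "alt xs = vs P - vs M" "rc P = rc M"
    using alt_split[of xs] xs ap(2) by auto
  show ?thesis
  proof (cases "rc P = 0")
    \<comment> \<open>Without reflections the pair at hand need not be normalized; instead all of
      \<open>S\<close> is taken with sign 1.\<close>
    case True
    hence nr: "\<forall>x\<in>#S. \<not> refl x" using PM rc_eq_0[of P] rc_eq_0[of M] by auto
    hence "alt xs = vs S" using alt_no_refl[of xs] xs by auto
    moreover have "rc S = 0" using nr by (simp add: rc_eq_0)
    ultimately show ?thesis using that[of S "{#}"] ap by (simp add: balanced_def)
  next
    case False
    thus ?thesis using that[of P M] PM ap rc_nonneg[of P] by (simp add: balanced_def)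
  qed
qed

end

locale dihedral_index = dihedral + fixes f :: "'i \<Rightarrow> 'a" assumes fG: "f i \<in> carrier G"
begin

sublocale S: signed_sequences n "\<lambda>i. refl (f i)" "\<lambda>i. val (f i)"
  using n_pos n_odd by unfold_locales

abbreviation im :: "'i set \<Rightarrow> 'a multiset" where
  "im W \<equiv> image_mset f (mset_set W)"

lemma im_carrier: "set_mset (im W) \<subseteq> carrier G"
  using fG by auto

lemma rc_im: "rc (im W) = (\<Sum>i\<in>W. if refl (f i) then 1 else 0)"
  by (simp add: rc_def image_mset.compositionality comp_def sum_unfold_sum_mset)

lemma vs_im: "vs (im W) = (\<Sum>i\<in>W. val (f i))"
  by (simp add: vs_def image_mset.compositionality comp_def sum_unfold_sum_mset)

lemma signed_im:
  assumes fin: "finite W" and s: "\<And>i. i \<in> W \<Longrightarrow> s i = (if i \<in> Y then 1 else -1)" and Y: "Y \<subseteq> W"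
  shows "S.rb s W = rc (im Y) - rc (im (W - Y))" "S.rv s W = vs (im Y) - vs (im (W - Y))"
proof -
  have fY: "finite Y" "finite (W - Y)" using fin Y finite_subset by auto
  have "S.rb s W = S.rb s Y + S.rb s (W - Y)"
    using S.rb_Un[of Y "W - Y" s] fY Y by (simp add: Un_absorb1)
  also have "S.rb s Y = rc (im Y)" unfolding S.rb_def rc_im by (rule sum.cong) (use s Y in auto)
  also have "S.rb s (W - Y) = - rc (im (W - Y))" unfolding S.rb_def rc_im sum_negf[symmetric]
    by (rule sum.cong) (use s Y in auto)
  finally show "S.rb s W = rc (im Y) - rc (im (W - Y))" by simp
  have "S.rv s W = S.rv s Y + S.rv s (W - Y)"
    using S.rv_Un[of Y "W - Y" s] fY Y by (simp add: Un_absorb1)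
  also have "S.rv s Y = vs (im Y)" unfolding S.rv_def vs_im by (rule sum.cong) (use s Y in auto)
  also have "S.rv s (W - Y) = - vs (im (W - Y))" unfolding S.rv_def vs_im sum_negf[symmetric]
    by (rule sum.cong) (use s Y in auto)
  finally show "S.rv s W = vs (im Y) - vs (im (W - Y))" by simp
qed

text \<open>Indices of sign 1 carry \<open>P\<close>, those of sign -1 carry \<open>M\<close>. This
  turns \<open>balanced\<close> into \<open>compat\<close>, up to the normalized sign of
  rotations.\<close>

lemma product_one_im:
  assumes fin: "finite W"
  shows "product_one G (im W) \<longleftrightarrow> S.po W"
proof
  assume "product_one G (im W)"
  then obtain P M where PM: "P + M = im W" "balanced P M" using product_oneE[OF im_carrier] by blast
  obtain Y where Y: "Y \<subseteq> W" "im Y = P"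
    using submultiset_image_index[OF fin, of P f] PM(1) by (metis mset_subset_eq_add_left)
  have M: "im (W - Y) = M" using image_mset_set_diff[OF fin Y(1), of f] PM(1) Y(2) by (metis add_left_cancel)
  define s where "s i = (if i \<in> Y then 1 else -1::int)" for i
  have sg: "S.sg s" by (simp add: S.sg_def s_def)
  have z: "S.zs s W" using signed_im[OF fin _ Y(1), of s] PM(2) Y(2) M
    by (simp add: S.zs_def balanced_def s_def)
  have "(\<exists>i\<in>W. refl (f i)) \<or> (\<exists>c. \<forall>i\<in>W. s i = c)"
  proof (cases "M = {#}")
    case True
    moreover have "finite (W - Y)" using fin by simp
    ultimately have "W - Y = {}" using M by (simp add: mset_set_empty_iff del: Diff_eq_empty_iff)
    thus ?thesis unfolding s_def by auto
  next
    case False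
    hence "rc (im Y) \<noteq> 0" using PM(2) Y(2) by (auto simp: balanced_def)
    then obtain x where "x \<in># im Y" "refl x" using rc_eq_0 by blast
    moreover have "finite Y" using Y(1) fin finite_subset by blast
    ultimately show ?thesis using Y(1) by auto
  qed
  hence "S.compat s W" using z by (simp add: S.compat_def)
  thus "S.po W" using sg S.poI by blast
next
  assume "S.po W"
  then obtain s where s: "S.sg s" "S.compat s W" by (auto simp: S.po_def)
  define Y where "Y = {i\<in>W. s i = 1}"
  have Y: "Y \<subseteq> W" by (auto simp: Y_def)
  have sY: "s i = (if i \<in> Y then 1 else -1)" if "i \<in> W" for i
    using s(1) that by (auto simp: S.sg_def Y_def)
  have z: "rc (im Y) = rc (im (W - Y))" "int n dvd vs (im Y) - vs (im (W - Y))"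
    using signed_im[OF fin sY Y] s(2) by (simp_all add: S.compat_def S.zs_def)
  have fY: "finite Y" using Y fin finite_subset by blast
  have split: "im W = im Y + im (W - Y)" by (rule image_mset_set_diff[OF fin Y])
  have cc: "set_mset (im Y + im (W - Y)) \<subseteq> carrier G" "set_mset (im (W - Y) + {#}) \<subseteq> carrier G"
    using fG by auto
  show "product_one G (im W)"
  proof (cases "\<exists>i\<in>W. refl (f i)")
    case True
    then obtain i where i: "i \<in> W" "refl (f i)" by blast
    have "f i \<in># im W" using i(1) fin by simp
    hence "rc (im W) \<noteq> 0" using i(2) rc_eq_0 by blast
    hence "0 < rc (im Y)" using z(1) split rc_nonneg[of "im Y"] by auto
    hence "balanced (im Y) (im (W - Y))" using z by (simp add: balanced_def)
    thus ?thesis using product_oneI[OF cc(1)] split by simp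
  next
    case False
    then obtain c where c: "\<forall>i\<in>W. s i = c" using s(2) by (auto simp: S.compat_def)
    have r0: "rc (im Y) = 0" "rc (im (W - Y)) = 0" using False Y fin fY by (auto simp: rc_eq_0)
    have "Y = {} \<or> W - Y = {}" using c by (auto simp: Y_def)
    thus ?thesis
    proof
      assume Y0: "Y = {}"
      hence "balanced (im (W - Y)) {#}" using z r0 by (simp add: balanced_def)
      thus ?thesis using product_oneI[OF cc(2)] Y0 by simp
    next
      assume WY: "W - Y = {}"
      have "im (W - Y) = {#}" unfolding WY by simp
      hence "balanced (im Y) (im (W - Y))" using z r0 by (simp add: balanced_def)
      thus ?thesis using product_oneI[OF cc(1)] split by simp
    qed
  qed
qed

end

section \<open>Combining and comparing sign functions\<close>

context signed_sequences
begin

lemma zs_blocks: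
  assumes "blocks \<B> A" "finite A" "\<And>B. B \<in> \<B> \<Longrightarrow> zs s B"
  shows "zs s A"
proof -
  note f = blocks_finite[OF assms(1,2)]
  have d: "disjoint \<B>" "\<Union>\<B> = A" using assms(1) by (auto simp: blocks_def)
  have "rb s A = (\<Sum>B\<in>\<B>. rb s B)" "rv s A = (\<Sum>B\<in>\<B>. rv s B)"
    using rb_UN[OF f(1) f(2) d(1), of s] rv_UN[OF f(1) f(2) d(1), of s] d(2) by simp_all
  thus ?thesis using assms(3) by (auto simp: zs_def intro: dvd_sum)
qed

lemma no_refl_compat_one:
  assumes "finite W" "po W" "\<And>i. i \<in> W \<Longrightarrow> \<not> r i"
  shows "compat (\<lambda>_. 1) W"
proof -
  obtain s where s: "sg s" "compat s W" using assms(2) by (auto simp: po_def)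
  then obtain c where c: "\<forall>i\<in>W. s i = c" using assms(3) by (auto simp: compat_def)
  have "(\<forall>i\<in>W. s i = 1) \<or> (\<forall>i\<in>W. s i = -1)"
    using c s(1) unfolding sg_def by metis
  hence "(\<forall>i\<in>W. 1 = s i) \<or> (\<forall>i\<in>W. 1 = - s i)" by auto
  thus ?thesis
    using compat_cong[of W "\<lambda>_. 1" s] compat_cong[of W "\<lambda>_. 1" "\<lambda>i. - s i"] s(2) compat_uminus[of s] by blast
qed

text \<open>As blocks are disjoint, their separate sign functions combine into one. Reflection-free
  blocks get sign 1, so that a union of several of them still has a constant sign.\<close>

lemma glue_signs:
  assumes bl: "blocks \<B> A" and fin: "finite A" and po: "\<And>B. B \<in> \<B> \<Longrightarrow> po B"
  obtains s where "sg s" "\<And>B. B \<in> \<B> \<Longrightarrow> compat s B"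
    "\<And>B i. B \<in> \<B> \<Longrightarrow> (\<forall>j\<in>B. \<not> r j) \<Longrightarrow> i \<in> B \<Longrightarrow> s i = 1"
proof -
  have "\<exists>s. sg s \<and> compat s B \<and> ((\<forall>j\<in>B. \<not> r j) \<longrightarrow> (\<forall>i. s i = 1))" if B: "B \<in> \<B>" for B
  proof (cases "\<forall>j\<in>B. \<not> r j")
    case True
    hence "compat (\<lambda>_. 1) B"
      using no_refl_compat_one[OF _ po[OF B]] blocks_finite(2)[OF bl fin B] by blast
    thus ?thesis by (intro exI[of _ "\<lambda>_. 1"]) (simp add: sg_def)
  next
    case False
    thus ?thesis using po[OF B] by (auto simp: po_def)
  qed
  then obtain S where S: "\<And>B. B \<in> \<B> \<Longrightarrow> sg (S B) \<and> compat (S B) B \<and> ((\<forall>j\<in>B. \<not> r j) \<longrightarrow> (\<forall>i. S B i = 1))"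
    by metis
  define blk where "blk i = (THE B. B \<in> \<B> \<and> i \<in> B)" for i
  have blk: "blk i = B" if "B \<in> \<B>" "i \<in> B" for i B
    unfolding blk_def using that blocks_disj[OF bl] by (intro the_equality) blast+
  define s where "s i = (if i \<in> A then S (blk i) i else 1)" for i
  have sB: "s i = S B i" if "B \<in> \<B>" "i \<in> B" for i B
    using blk[OF that] that blocks_finite(3)[OF bl fin that(1)] by (auto simp: s_def)
  show ?thesis
  proof (rule that[of s])
    show "sg s" unfolding sg_def
    proof
      fix i show "s i = 1 \<or> s i = - 1"
      proof (cases "i \<in> A")
        case True
        then obtain B where B: "B \<in> \<B>" "i \<in> B" using blocks_mem[OF bl] by blast
        thus ?thesis using sB[OF B] S[OF B(1)] by (simp add: sg_def)
      qed (simp add: s_def)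
    qed
    show "compat s B" if "B \<in> \<B>" for B
      using compat_cong[of B s "S B"] sB[OF that] S[OF that] by blast
    show "s i = 1" if "B \<in> \<B>" "\<forall>j\<in>B. \<not> r j" "i \<in> B" for B i
      using sB[OF that(1,3)] S[OF that(1)] that(2) by simp
  qed
qed

text \<open>The difference of the two sums is twice the sum in question, and \<open>n\<close> is odd.\<close>

lemma zs_differ:
  assumes fin: "finite W" and sg: "sg s" "sg s'" and z: "zs s W" "zs s' W"
  shows "zs s {i\<in>W. s' i \<noteq> s i}"
proof -
  define D where "D = {i\<in>W. s' i \<noteq> s i}"
  have DW: "D \<subseteq> W" by (auto simp: D_def)
  have fD: "finite D" "finite (W - D)" using fin DW finite_subset by auto
  have eq: "s' i = s i" if "i \<in> W - D" for i using that by (auto simp: D_def)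
  have neg: "s' i = - s i" if "i \<in> D" for i
    using that sg(1)[unfolded sg_def, rule_format, of i] sg(2)[unfolded sg_def, rule_format, of i]
    by (auto simp: D_def)
  have "rb s' W = rb s' D + rb s' (W - D)" "rv s' W = rv s' D + rv s' (W - D)"
    "rb s W = rb s D + rb s (W - D)" "rv s W = rv s D + rv s (W - D)"
    using rb_Un[of D "W - D"] rv_Un[of D "W - D"] fD DW by (simp_all add: Un_absorb1)
  moreover have "rb s' D = - rb s D" "rv s' D = - rv s D"
    using rb_cong[of D s' "\<lambda>i. - s i"] rv_cong[of D s' "\<lambda>i. - s i"] neg
    by (simp_all add: rb_uminus rv_uminus)
  moreover have "rb s' (W - D) = rb s (W - D)" "rv s' (W - D) = rv s (W - D)"
    using rb_cong[of "W - D" s' s] rv_cong[of "W - D" s' s] eq by auto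
  ultimately have e: "rb s W - rb s' W = 2 * rb s D" "rv s W - rv s' W = 2 * rv s D" by linarith+
  have "int n dvd 2 * rv s D" using z e(2) unfolding zs_def by (metis dvd_diff)
  moreover have "coprime (int n) 2" using n_odd by simp
  ultimately have "int n dvd rv s D" by (simp add: coprime_dvd_mult_right_iff)
  moreover have "rb s D = 0" using z e(1) by (simp add: zs_def)
  ultimately show ?thesis by (simp add: zs_def D_def)
qed

lemma avoiding_block:
  assumes bl: "blocks \<B> A" and fin: "finite A" and V: "V \<subseteq> A" "card V < card \<B>"
  obtains B where "B \<in> \<B>" "V \<inter> B = {}"
proof (rule ccontr)
  assume "\<not> thesis"
  hence "V \<inter> B \<noteq> {}" if "B \<in> \<B>" for B using that \<open>\<And>B. B \<in> \<B> \<Longrightarrow> V \<inter> B = {} \<Longrightarrow> thesis\<close> by blast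
  moreover have "finite V" using V fin finite_subset by blast
  ultimately have "1 \<le> card (V \<inter> B)" if "B \<in> \<B>" for B
    using that by (simp add: Suc_le_eq card_gt_0_iff)
  hence "(\<Sum>B\<in>\<B>. 1) \<le> (\<Sum>B\<in>\<B>. card (V \<inter> B))" by (rule sum_mono)
  thus False using card_blocks_Int[OF bl fin V(1)] V(2) by simp
qed

end

section \<open>Chains of factorizations\<close>

lemma atom_pom: "U \<in> product_one_atoms G \<Longrightarrow> U \<in> product_one_monoid G"
  by (simp add: product_one_atoms_def)

lemma atom_nonempty: "U \<in> product_one_atoms G \<Longrightarrow> U \<noteq> {#}"
  by (simp add: product_one_atoms_def)

lemma atom_irreducible:
  "U \<in> product_one_atoms G \<Longrightarrow> U = S + T \<Longrightarrow> S \<in> product_one_monoid G \<Longrightarrow> T \<in> product_one_monoid G \<Longrightarrow>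
   S = {#} \<or> T = {#}"
  unfolding product_one_atoms_def by blast

lemma pom_empty: "{#} \<in> product_one_monoid G"
  by (auto simp: product_one_monoid_def sequences_over_def product_one_def)

lemma pom_plus:
  assumes "S \<in> product_one_monoid G" "T \<in> product_one_monoid G"
  shows "S + T \<in> product_one_monoid G"
proof -
  obtain xs ys where xs: "mset xs = S" "foldr (\<otimes>\<^bsub>G\<^esub>) xs \<one>\<^bsub>G\<^esub> = \<one>\<^bsub>G\<^esub>"
    and ys: "mset ys = T" "foldr (\<otimes>\<^bsub>G\<^esub>) ys \<one>\<^bsub>G\<^esub> = \<one>\<^bsub>G\<^esub>"
    using assms by (auto simp: product_one_monoid_def product_one_def)
  have "mset (xs @ ys) = S + T" "foldr (\<otimes>\<^bsub>G\<^esub>) (xs @ ys) \<one>\<^bsub>G\<^esub> = \<one>\<^bsub>G\<^esub>"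
    using xs ys by simp_all
  hence "product_one G (S + T)" unfolding product_one_def by blast
  thus ?thesis using assms by (auto simp: product_one_monoid_def sequences_over_def)
qed

lemma sum_mset_pom: "set_mset z \<subseteq> product_one_atoms G \<Longrightarrow> \<Sum>\<^sub># z \<in> product_one_monoid G"
  by (induction z) (auto simp: pom_empty pom_plus atom_pom)

lemma factorizations_plus:
  "z \<in> factorizations G S \<Longrightarrow> w \<in> factorizations G T \<Longrightarrow> z + w \<in> factorizations G (S + T)"
  by (auto simp: factorizations_def)

lemma factorizations_atom: "U \<in> product_one_atoms G \<Longrightarrow> {#U#} \<in> factorizations G U"
  by (simp add: factorizations_def)

lemma factorization_exists: "S \<in> product_one_monoid G \<Longrightarrow> \<exists>z. z \<in> factorizations G S"
proof (induction "size S" arbitrary: S rule: less_induct)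
  case less
  show ?case
  proof (cases "S = {#} \<or> S \<in> product_one_atoms G")
    case True
    thus ?thesis
    proof
      assume "S = {#}" thus ?thesis by (intro exI[of _ "{#}"]) (simp add: factorizations_def)
    qed (use factorizations_atom in blast)
  next
    case False
    then obtain P Q where PQ: "P \<in> product_one_monoid G" "Q \<in> product_one_monoid G"
      "P \<noteq> {#}" "Q \<noteq> {#}" "S = P + Q" using less.prems by (auto simp: product_one_atoms_def)
    have "size P < size S" "size Q < size S" using PQ by (auto simp: nonempty_has_size)
    then obtain z w where "z \<in> factorizations G P" "w \<in> factorizations G Q"
      using less.hyps PQ by blast
    thus ?thesis using factorizations_plus PQ(5) by blast
  qed
qed

lemma factorizations_empty_iff: "z \<in> factorizations G S \<Longrightarrow> z = {#} \<longleftrightarrow> S = {#}"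
proof -
  assume z: "z \<in> factorizations G S"
  have "U = {#}" if "U \<in># z" "S = {#}" for U
    using z that by (auto simp: factorizations_def)
  moreover have "U \<noteq> {#}" if "U \<in># z" for U
    using z that atom_nonempty by (auto simp: factorizations_def)
  ultimately show ?thesis using z by (auto simp: factorizations_def)
qed

lemma factorizations_remove:
  assumes "z \<in> factorizations G S" "U \<in># z"
  shows "z - {#U#} \<in> factorizations G (S - U)" "S - U \<in> product_one_monoid G" "S = U + (S - U)"
proof -
  obtain z' where z': "z = add_mset U z'" using assms(2) by (metis insert_DiffM)
  have S: "S = U + \<Sum>\<^sub># z'" using assms(1) z' by (auto simp: factorizations_def)
  show "z - {#U#} \<in> factorizations G (S - U)" using assms(1) z' S by (auto simp: factorizations_def)
  hence "set_mset (z - {#U#}) \<subseteq> product_one_atoms G" "\<Sum>\<^sub># (z - {#U#}) = S - U"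
    by (simp_all add: factorizations_def)
  thus "S - U \<in> product_one_monoid G" using sum_mset_pom[of "z - {#U#}" G] by simp
  show "S = U + (S - U)" using S by simp
qed

definition fstep :: "('a, 'b) monoid_scheme \<Rightarrow> nat \<Rightarrow> 'a multiset \<Rightarrow> ('a multiset multiset) rel" where
  "fstep G N A = {(z, w). z \<in> factorizations G A \<and> w \<in> factorizations G A \<and> factorization_dist z w \<le> N}"

lemma chain_connected_if_fstep:
  assumes "(z, z') \<in> (fstep G N A)\<^sup>*" "z \<in> factorizations G A"
  shows "chain_connected G A (enat N) z z'"
  using assms
proof (induction rule: rtrancl_induct)
  case base
  thus ?case unfolding chain_connected_def by (intro exI[of _ 0] exI[of _ "\<lambda>_. z"]) auto
next
  case (step w w')
  define Ch where "Ch k y \<longleftrightarrow> y 0 = z \<and> y k = w \<and> (\<forall>i\<le>k. y i \<in> factorizations G A) \<and>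
    (\<forall>i\<in>{1..k}. enat (factorization_dist (y (i - 1)) (y i)) \<le> enat N)" for k :: nat and y
  have "\<exists>k y. Ch k y" using step(3)[OF step(4)] by (simp only: Ch_def chain_connected_def)
  then obtain k y where "Ch k y" by blast
  hence y: "y 0 = z" "y k = w" "\<forall>i\<le>k. y i \<in> factorizations G A"
    "\<forall>i\<in>{1..k}. enat (factorization_dist (y (i - 1)) (y i)) \<le> enat N" by (simp_all add: Ch_def)
  have w': "w' \<in> factorizations G A" "factorization_dist w w' \<le> N" using step(2) by (auto simp: fstep_def)
  define y' where "y' i = (if i = Suc k then w' else y i)" for i
  have "enat (factorization_dist (y' (i - 1)) (y' i)) \<le> enat N" if "i \<in> {1..Suc k}" for i
    using that y w' by (cases "i = Suc k") (auto simp: y'_def)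
  moreover have "\<forall>i\<le>Suc k. y' i \<in> factorizations G A" using y w' by (auto simp: y'_def le_Suc_eq)
  moreover have "y' 0 = z" "y' (Suc k) = w'" using y by (auto simp: y'_def)
  ultimately show ?case unfolding chain_connected_def by blast
qed

lemma fstep_sym: "(z, w) \<in> (fstep G N A)\<^sup>* \<Longrightarrow> (w, z) \<in> (fstep G N A)\<^sup>*"
proof -
  have "sym (fstep G N A)" by (auto simp: fstep_def sym_def factorization_dist_def max.commute)
  thus "(z, w) \<in> (fstep G N A)\<^sup>* \<Longrightarrow> (w, z) \<in> (fstep G N A)\<^sup>*" by (meson sym_rtrancl symD)
qed

text \<open>A common atom cancels in both multiset differences, so it does not change
  distances.\<close>

lemma fstep_add:
  assumes "(z, w) \<in> (fstep G N A)\<^sup>*" "U \<in> product_one_atoms G"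
  shows "(add_mset U z, add_mset U w) \<in> (fstep G N (U + A))\<^sup>*"
  using assms(1)
proof (induction rule: rtrancl_induct)
  case (step y y')
  have "(add_mset U y, add_mset U y') \<in> fstep G N (U + A)"
    using step(2) assms(2) by (auto simp: fstep_def factorizations_def factorization_dist_def)
  thus ?case using step(3) by (rule rtrancl_into_rtrancl[rotated])
qed simp

definition fconn :: "('a, 'b) monoid_scheme \<Rightarrow> nat \<Rightarrow> 'a multiset \<Rightarrow> bool" where
  "fconn G N A \<longleftrightarrow> (\<forall>z\<in>factorizations G A. \<forall>w\<in>factorizations G A. (z, w) \<in> (fstep G N A)\<^sup>*)"

lemma common_atom_connected:
  assumes IH: "\<And>B. B \<in> product_one_monoid G \<Longrightarrow> size B < size A \<Longrightarrow> fconn G N B"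
    and z: "z \<in> factorizations G A" "U \<in># z" and w: "w \<in> factorizations G A" "U \<in># w"
  shows "(z, w) \<in> (fstep G N A)\<^sup>*"
proof -
  have U: "U \<in> product_one_atoms G" using z by (auto simp: factorizations_def)
  note rz = factorizations_remove[OF z] and rw = factorizations_remove[OF w]
  have "size A = size U + size (A - U)" using rz(3) by (metis size_union)
  hence "size (A - U) < size A" using atom_nonempty[OF U] by (simp add: nonempty_has_size)
  hence "(z - {#U#}, w - {#U#}) \<in> (fstep G N (A - U))\<^sup>*"
    using IH[OF rz(2)] rz(1) rw(1) by (simp add: fconn_def)
  from fstep_add[OF this U] show ?thesis using z(2) w(2) rz(3) by simp
qed

context dihedral_index
begin

lemma im_pom: "finite W \<Longrightarrow> im W \<in> product_one_monoid G \<longleftrightarrow> S.po W"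
  using product_one_im[of W] im_carrier[of W] by (simp add: product_one_monoid_def sequences_over_def)

lemma im_eq_empty: "finite W \<Longrightarrow> im W = {#} \<longleftrightarrow> W = {}"
  by (simp add: mset_set_empty_iff)

text \<open>Equal terms are kept apart by indices, so that a factorization comes from a set partition; the
  disadvantage that it comes from several ones is harmless.\<close>

definition fact :: "'i set set \<Rightarrow> 'a multiset multiset" where
  "fact \<B> = image_mset im (mset_set \<B>)"

definition ablocks :: "'i set set \<Rightarrow> 'i set \<Rightarrow> bool" where
  "ablocks \<B> A \<longleftrightarrow> S.blocks \<B> A \<and> im ` \<B> \<subseteq> product_one_atoms G"

text \<open>The atoms of \<open>z\<close> are lifted to index sets one at a time, each within the
  indices not yet used.\<close>

lemma partition_exists:
  assumes "z \<in> factorizations G (im A)" "finite A"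
  shows "\<exists>\<B>. ablocks \<B> A \<and> z = fact \<B>"
  using assms
proof (induction z arbitrary: A)
  case empty
  hence "A = {}" by (auto simp: factorizations_def mset_set_empty_iff)
  thus ?case by (intro exI[of _ "{}"]) (simp add: ablocks_def S.blocks_def fact_def)
next
  case (add U z)
  have U: "U \<in> product_one_atoms G" and zs: "set_mset z \<subseteq> product_one_atoms G"
    and eq: "im A = U + \<Sum>\<^sub># z" using add.prems by (auto simp: factorizations_def)
  obtain Y where Y: "Y \<subseteq> A" "im Y = U"
    using submultiset_image_index[OF add.prems(2), of U f] eq by (metis mset_subset_eq_add_left)
  have "im (A - Y) = \<Sum>\<^sub># z"
    using image_mset_set_diff[OF add.prems(2) Y(1), of f] eq Y(2) by (metis add_left_cancel)
  hence "z \<in> factorizations G (im (A - Y))" using zs by (simp add: factorizations_def)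
  then obtain \<B> where B: "ablocks \<B> (A - Y)" "z = fact \<B>"
    using add.IH[of "A - Y"] add.prems(2) by auto
  have Yne: "Y \<noteq> {}" using atom_nonempty[OF U] Y(2) by auto
  have bl: "S.blocks \<B> (A - Y)" using B(1) by (simp add: ablocks_def)
  have Yn: "Y \<notin> \<B>" using bl Yne unfolding S.blocks_def by blast
  have dY: "Y \<inter> B' = {}" if "B' \<in> \<B>" for B' using bl that unfolding S.blocks_def by blast
  have "disjoint (insert Y \<B>)"
    using bl dY unfolding S.blocks_def disjoint_def by auto
  hence "S.blocks (insert Y \<B>) A" using bl Yne Y(1) unfolding S.blocks_def by auto
  hence "ablocks (insert Y \<B>) A" using B(1) U Y(2) by (auto simp: ablocks_def)
  moreover have "finite \<B>" using S.blocks_finite(1)[OF bl] add.prems(2) by simp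
  hence "add_mset U z = fact (insert Y \<B>)" using B(2) Y(2) Yn by (simp add: fact_def)
  ultimately show ?case by blast
qed

lemma sum_fact:
  assumes "finite A" "S.blocks \<B> A"
  shows "\<Sum>\<^sub># (fact \<B>) = im A"
proof -
  have "\<Sum>\<^sub># (image_mset im (mset_set \<C>)) = im (\<Union>\<C>)" if "finite \<C>" "\<C> \<subseteq> \<B>" for \<C>
    using that
  proof (induction \<C> rule: finite_induct)
    case (insert C \<C>)
    have fin: "finite C" "finite (\<Union>\<C>)"
      using insert.prems insert.hyps(1) S.blocks_finite(2)[OF assms(2,1)] by auto
    have "C \<inter> \<Union>\<C> = {}" using insert S.blocks_disj[OF assms(2), of C] by blast
    thus ?case using insert image_mset_set_Un[OF fin, of f] by simp
  qed simp
  from this[of \<B>] show ?thesis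
    using S.blocks_finite(1)[OF assms(2,1)] assms(2) by (simp add: fact_def S.blocks_def)
qed

lemma fact_factorization:
  assumes "finite A" "ablocks \<B> A" shows "fact \<B> \<in> factorizations G (im A)"
proof -
  have "finite \<B>" using S.blocks_finite(1) assms by (auto simp: ablocks_def)
  thus ?thesis using sum_fact assms by (auto simp: factorizations_def ablocks_def fact_def)
qed

lemma mem_fact: "finite \<B> \<Longrightarrow> B \<in> \<B> \<Longrightarrow> im B \<in># fact \<B>"
  by (simp add: fact_def)

lemma size_fact: "size (fact \<B>) = card \<B>"
  by (simp add: fact_def)

lemma ablocks_exists: "finite W \<Longrightarrow> S.po W \<Longrightarrow> \<exists>\<B>. ablocks \<B> W"
  using factorization_exists[of "im W" G] im_pom[of W] partition_exists by blast

lemma ablocks_Un: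
  assumes "ablocks \<B> A" "ablocks \<C> C" "A \<inter> C = {}"
  shows "ablocks (\<B> \<union> \<C>) (A \<union> C)"
proof -
  have "disjoint (\<B> \<union> \<C>)"
    using assms by (intro disjoint_union) (auto simp: ablocks_def S.blocks_def)
  thus ?thesis using assms unfolding ablocks_def S.blocks_def by auto
qed

lemma ablocks_sub:
  assumes "ablocks \<B> A" "I \<subseteq> \<B>" shows "ablocks I (\<Union>I)"
proof -
  have "disjoint I" using assms by (auto simp: ablocks_def S.blocks_def intro: pairwise_subset)
  moreover have "{} \<notin> I" "im ` I \<subseteq> product_one_atoms G"
    using assms by (auto simp: ablocks_def S.blocks_def)
  ultimately show ?thesis by (simp add: ablocks_def S.blocks_def)
qed

lemma ablocks_po:
  assumes "finite A" "ablocks \<B> A" "B \<in> \<B>"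
  shows "S.po B" "finite B" "\<And>Y. Y \<subseteq> B \<Longrightarrow> Y \<noteq> {} \<Longrightarrow> S.po Y \<Longrightarrow> S.po (B - Y) \<Longrightarrow> Y = B"
proof -
  have bl: "S.blocks \<B> A" and at: "im B \<in> product_one_atoms G" using assms by (auto simp: ablocks_def)
  show fB: "finite B" using S.blocks_finite(2)[OF bl assms(1,3)] .
  show "S.po B" using im_pom[OF fB] atom_pom[OF at] by blast
  fix Y assume Y: "Y \<subseteq> B" "Y \<noteq> {}" "S.po Y" "S.po (B - Y)"
  have fY: "finite Y" "finite (B - Y)" using fB Y(1) finite_subset by auto
  have "im Y = {#} \<or> im (B - Y) = {#}"
    using atom_irreducible[OF at image_mset_set_diff[OF fB Y(1)]] im_pom fY Y by blast
  thus "Y = B" using im_eq_empty fY Y(1,2) by blast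
qed

lemma ablocks_card_le:
  assumes A: "finite A" "ablocks \<B> A" "B \<in> \<B>" and s: "S.sg s" "S.zs s B" "x \<in> B" "refl (f x)"
  shows "card B \<le> 2 * n"
  using S.irreducible_card[OF ablocks_po(2)[OF A] s] ablocks_po(3)[OF A] S.poI[OF s(1)] by blast

end

section \<open>The induction step: linking a factorization with more than \<open>2 n\<close> atoms
  to any other one\<close>

locale dihedral_step = dihedral_index G n a t f
  for G :: "('a, 'b) monoid_scheme" (structure) and n a t and f :: "'i \<Rightarrow> 'a" +
  fixes A :: "'i set"
  assumes fin: "finite A"
    and IH: "\<And>B. B \<in> product_one_monoid G \<Longrightarrow> size B < size (im A) \<Longrightarrow> fconn G (2 * n) B"
    and no_one: "\<And>i. i \<in> A \<Longrightarrow> f i \<noteq> \<one>"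
begin

abbreviation conn :: "'i set set \<Rightarrow> 'i set set \<Rightarrow> bool" where
  "conn \<B> \<C> \<equiv> (fact \<B>, fact \<C>) \<in> (fstep G (2 * n) (im A))\<^sup>*"

lemma conn_sym: "conn \<B> \<C> \<Longrightarrow> conn \<C> \<B>"
  by (rule fstep_sym)

lemma conn_trans: "conn \<B> \<C> \<Longrightarrow> conn \<C> \<D> \<Longrightarrow> conn \<B> \<D>"
  by (rule rtrancl_trans)

lemma ablocksD:
  assumes "ablocks \<B> A"
  shows "S.blocks \<B> A" "finite \<B>"
  using assms S.blocks_finite(1)[OF _ fin] by (auto simp: ablocks_def)

lemma conn_common:
  assumes "ablocks \<B> A" "ablocks \<C> A" "B \<in> \<B>" "B \<in> \<C>"
  shows "conn \<B> \<C>"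
  using common_atom_connected[OF IH, where U = "im B"] fact_factorization[OF fin] assms mem_fact ablocksD(2)
  by blast

text \<open>An atom of size 1 consists of the identity, which \<open>no_one\<close> excludes. The
  counting in \<open>common_part\<close> relies on blocks with at least two terms; sequences
  containing the identity are treated separately.\<close>

lemma card_block_ge_2:
  assumes "ablocks \<B> A" "B \<in> \<B>"
  shows "2 \<le> card B"
proof (rule ccontr)
  assume "\<not> 2 \<le> card B"
  moreover have "card B \<noteq> 0"
    using S.blocks_finite[OF ablocksD(1)[OF assms(1)] fin] assms(2) by simp
  ultimately have "card B = 1" by linarith
  then obtain i where i: "B = {i}" by (auto simp: card_1_singleton_iff)
  have "product_one G (im B)" using product_one_im ablocks_po[OF fin assms] by blast
  then obtain xs where xs: "mset xs = {#f i#}" "foldr (\<otimes>) xs \<one> = \<one>" using i by (auto simp: product_one_def)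
  hence "xs = [f i]" by (metis mset_single_iff_right)
  hence "f i = \<one>" using xs(2) fG by simp
  thus False using no_one[of i] S.blocks_finite(3)[OF ablocksD(1)[OF assms(1)] fin assms(2)] i by blast
qed

text \<open>The chain runs from \<open>\<B>\<close> through
  \<open>I \<union> \<Q> \<union> \<R>'\<close> and \<open>{V} \<union> \<Q> \<union> \<R>\<close>
  to \<open>\<V>\<close>; consecutive partitions share a block of \<open>I\<close>, a block of
  \<open>\<Q>\<close>, and \<open>V\<close>. If \<open>Q\<close> is a block of \<open>\<B>\<close>,
  it is left whole, and \<open>\<B>\<close> shares it with the second of these directly.\<close>

lemma conn_common_part:
  assumes B: "ablocks \<B> A" and V: "ablocks \<V> A" "V \<in> \<V>"
    and Q: "Q \<noteq> {}" "Q \<subseteq> A - V" "S.po Q" "S.po (A - V - Q)"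
    and *: "Q \<in> \<B> \<or> (\<exists>I\<subseteq>\<B>. I \<noteq> {} \<and> \<Union>I \<inter> Q = {} \<and> S.po (A - \<Union>I - Q))"
  shows "conn \<B> \<V>"
proof -
  have VA: "V \<subseteq> A" using S.blocks_finite(3)[OF ablocksD(1)[OF V(1)] fin V(2)] .
  have fQ: "finite Q" using Q(2) fin finite_subset by blast
  obtain \<Q> where Qb: "ablocks \<Q> Q" "Q \<in> \<B> \<longrightarrow> \<Q> = {Q}"
  proof (cases "Q \<in> \<B>")
    case True
    hence "ablocks {Q} Q" using ablocks_sub[OF B, of "{Q}"] by simp
    thus thesis using that by blast
  next
    case False thus thesis using that ablocks_exists[OF fQ Q(3)] by blast
  qed
  obtain C where C: "C \<in> \<Q>" using Qb(1) Q(1) unfolding ablocks_def S.blocks_def by blast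
  obtain \<R> where R: "ablocks \<R> (A - V - Q)" using ablocks_exists[OF _ Q(4)] fin by auto
  have "ablocks {V} V" using ablocks_sub[OF V(1), of "{V}"] V(2) by simp
  hence "ablocks ({V} \<union> \<Q>) (V \<union> Q)" using ablocks_Un[OF _ Qb(1)] Q(2) by blast
  hence "ablocks ({V} \<union> \<Q> \<union> \<R>) (V \<union> Q \<union> (A - V - Q))" using ablocks_Un[OF _ R] by blast
  moreover have "V \<union> Q \<union> (A - V - Q) = A" using VA Q(2) by blast
  ultimately have F: "ablocks ({V} \<union> \<Q> \<union> \<R>) A" by simp
  have c1: "conn ({V} \<union> \<Q> \<union> \<R>) \<V>" by (rule conn_common[OF F V(1) _ V(2)]) simp
  have "conn \<B> ({V} \<union> \<Q> \<union> \<R>)"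
    using *
  proof
    assume QB: "Q \<in> \<B>"
    show ?thesis by (rule conn_common[OF B F QB]) (use Qb(2) QB in simp)
  next
    assume "\<exists>I\<subseteq>\<B>. I \<noteq> {} \<and> \<Union>I \<inter> Q = {} \<and> S.po (A - \<Union>I - Q)"
    then obtain I where I: "I \<subseteq> \<B>" "I \<noteq> {}" "\<Union>I \<inter> Q = {}" "S.po (A - \<Union>I - Q)" by blast
    obtain B0 where B0: "B0 \<in> I" using I(2) by blast
    obtain \<R>' where R': "ablocks \<R>' (A - \<Union>I - Q)" using ablocks_exists[OF _ I(4)] fin by auto
    have "ablocks (I \<union> \<Q>) (\<Union>I \<union> Q)" using ablocks_Un[OF ablocks_sub[OF B I(1)] Qb(1) I(3)] .
    hence "ablocks (I \<union> \<Q> \<union> \<R>') (\<Union>I \<union> Q \<union> (A - \<Union>I - Q))" using ablocks_Un[OF _ R'] by blast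
    moreover have "\<Union>I \<union> Q \<union> (A - \<Union>I - Q) = A"
      using S.blocks_finite(3)[OF ablocksD(1)[OF B] fin] I(1) Q(2) by blast
    ultimately have F': "ablocks (I \<union> \<Q> \<union> \<R>') A" by simp
    have "conn \<B> (I \<union> \<Q> \<union> \<R>')" by (rule conn_common[OF B F', of B0]) (use B0 I(1) in auto)
    moreover have "conn (I \<union> \<Q> \<union> \<R>') ({V} \<union> \<Q> \<union> \<R>)"
      by (rule conn_common[OF F' F, of C]) (use C in auto)
    ultimately show ?thesis by (rule conn_trans)
  qed
  thus ?thesis using c1 by (rule conn_trans)
qed

text \<open>\<open>common_part\<close> is applied to the block \<open>V0\<close> of
  \<open>\<V>\<close> through the reflection \<open>v0\<close>. The constant sign \<open>c\<close>
  on reflection-free blocks covers the case that \<open>V0\<close> contains all reflections.\<close>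

lemma conn_balanced:
  assumes B: "ablocks \<B> A" "2 * n + 1 \<le> card \<B>" and V: "ablocks \<V> A"
    and s: "S.sg s" "\<And>V. V \<in> \<V> \<Longrightarrow> S.zs s V" "\<And>B. B \<in> \<B> \<Longrightarrow> S.rb s B = 0"
    and c: "\<And>V i. V \<in> \<V> \<Longrightarrow> (\<forall>j\<in>V. \<not> refl (f j)) \<Longrightarrow> i \<in> V \<Longrightarrow> s i = c"
    and v: "v0 \<in> A" "refl (f v0)"
  shows "conn \<B> \<V>"
proof -
  have bV: "S.blocks \<V> A" and bB: "S.blocks \<B> A" using ablocksD B V by blast+
  obtain V0 where V0: "V0 \<in> \<V>" "v0 \<in> V0" using S.blocks_mem[OF bV v(1)] by blast
  have V0A: "V0 \<subseteq> A" using S.blocks_finite(3)[OF bV fin V0(1)] .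
  have cV: "card V0 \<le> 2 * n" using ablocks_card_le[OF fin V V0(1) s(1) s(2)[OF V0(1)] V0(2) v(2)] .
  have zA: "S.zs s A" using S.zs_blocks[OF bV fin s(2)] .
  have AV: "(\<exists>i\<in>A - V0. refl (f i)) \<or> (\<exists>c. \<forall>i\<in>A - V0. s i = c)"
  proof (cases "\<exists>i\<in>A - V0. refl (f i)")
    case False
    have "s i = c" if i: "i \<in> A - V0" for i
    proof -
      obtain V' where V': "V' \<in> \<V>" "i \<in> V'" using S.blocks_mem[OF bV] i by blast
      have "V' \<noteq> V0" using V'(2) i by blast
      hence "V' \<subseteq> A - V0" using S.blocks_disj[OF bV V'(1) V0(1)] S.blocks_finite(3)[OF bV fin V'(1)] by blast
      thus ?thesis using c[OF V'(1) _ V'(2)] False by blast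
    qed
    thus ?thesis by blast
  qed simp
  have B2: "S.po B \<and> 2 \<le> card B \<and> S.rb s B = 0" if "B \<in> \<B>" for B
    using ablocks_po(1)[OF fin B(1) that] card_block_ge_2[OF B(1) that] s(3)[OF that] by blast
  obtain Q where "Q \<noteq> {} \<and> Q \<subseteq> A - V0 \<and> S.po Q \<and> S.po (A - V0 - Q) \<and>
      (Q \<in> \<B> \<or> (\<exists>I\<subseteq>\<B>. I \<noteq> {} \<and> \<Union>I \<inter> Q = {} \<and> S.po (A - \<Union>I - Q)))"
    using S.common_part[OF fin s(1) zA bB B(2) B2 V0A s(2)[OF V0(1)] V0(2) v(2) cV AV] by blast
  thus ?thesis using conn_common_part[OF B(1) V V0(1)] by blast
qed

text \<open>For rotations only, product-one means that \<open>n\<close> divides the sum of the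
  exponents. So an atom has at most \<open>n\<close> terms, \<open>V0\<close> misses some block
  \<open>Q\<close> of \<open>\<B>\<close>, and what remains without both is product-one
  again.\<close>

lemma conn_no_refl:
  assumes B: "ablocks \<B> A" "2 * n + 1 \<le> card \<B>" and V: "ablocks \<V> A" and no: "\<forall>i\<in>A. \<not> refl (f i)"
  shows "conn \<B> \<V>"
proof -
  have bV: "S.blocks \<V> A" and bB: "S.blocks \<B> A" using ablocksD B V by blast+
  have po_iff: "S.po W \<longleftrightarrow> int n dvd S.rv (\<lambda>_. 1) W" if "W \<subseteq> A" for W
  proof
    assume "S.po W"
    hence "S.compat (\<lambda>_. 1) W" using S.no_refl_compat_one[of W] that no fin finite_subset by blast
    thus "int n dvd S.rv (\<lambda>_. 1) W" by (simp add: S.compat_def S.zs_def)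
  next
    assume "int n dvd S.rv (\<lambda>_. 1) W"
    moreover have "S.rb (\<lambda>_. 1) W = 0" using no that by (intro S.rb_no_refl) blast
    ultimately have "S.compat (\<lambda>_. 1) W" by (auto simp: S.compat_def S.zs_def)
    thus "S.po W" using S.poI[of "\<lambda>_. 1"] by (simp add: S.sg_def)
  qed
  have "\<B> \<noteq> {}" using B(2) by auto
  then obtain B0 where "B0 \<in> \<B>" by blast
  hence "B0 \<noteq> {}" "B0 \<subseteq> A" using S.blocks_finite(3,4)[OF bB fin] by auto
  then obtain V0 where V0: "V0 \<in> \<V>" using S.blocks_mem[OF bV] by blast
  have V0A: "V0 \<subseteq> A" using S.blocks_finite(3)[OF bV fin V0] .
  have fV: "finite V0" using V0A fin finite_subset by blast
  have poV: "S.po V0" using ablocks_po(1)[OF fin V V0] .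
  have "card V0 \<le> n"
  proof (rule ccontr)
    assume "\<not> card V0 \<le> n"
    then obtain Y where Y: "Y \<subseteq> V0" "card Y = n" by (metis linorder_not_le obtain_subset_with_card_n order_less_imp_le)
    then obtain I where I: "I \<subseteq> Y" "I \<noteq> {}" "int n dvd sum (\<lambda>i. val (f i)) I"
      using zero_sum_subset[of Y n "\<lambda>i. val (f i)"] fV finite_subset n_pos by auto
    have IV: "I \<subseteq> V0" using I(1) Y(1) by blast
    have nI: "int n dvd S.rv (\<lambda>_. 1) I" using I(3) by (simp add: S.rv_def)
    have "int n dvd S.rv (\<lambda>_. 1) (V0 - I)"
      using S.rv_diff[OF fV IV, of "\<lambda>_. 1"] nI poV po_iff[OF V0A] by simp
    hence "I = V0" using ablocks_po(3)[OF fin V V0 IV I(2)] po_iff nI IV V0A by (meson Diff_subset order_trans)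
    hence "card V0 \<le> n" using I(1) Y card_mono finite_subset fV by metis
    thus False using \<open>\<not> card V0 \<le> n\<close> by simp
  qed
  hence "card V0 < card \<B>" using B(2) by simp
  then obtain Q where Q: "Q \<in> \<B>" "V0 \<inter> Q = {}" using S.avoiding_block[OF bB fin V0A] by blast
  have QA: "Q \<subseteq> A" "Q \<noteq> {}" using S.blocks_finite[OF bB fin] Q(1) by auto
  have poQ: "S.po Q" using ablocks_po(1)[OF fin B(1) Q(1)] .
  have "S.zs (\<lambda>_. 1) A"
  proof (rule S.zs_blocks[OF bB fin])
    fix B assume B': "B \<in> \<B>"
    have BA: "B \<subseteq> A" using S.blocks_finite(3)[OF bB fin B'] .
    show "S.zs (\<lambda>_. 1) B"
      using S.no_refl_compat_one[of B] ablocks_po(1,2)[OF fin B(1) B'] no BA by (auto simp: S.compat_def)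
  qed
  hence "int n dvd S.rv (\<lambda>_. 1) A" by (simp add: S.zs_def)
  moreover have QAV: "Q \<subseteq> A - V0" using QA(1) Q(2) by blast
  have "S.rv (\<lambda>_. 1) (A - V0 - Q) = S.rv (\<lambda>_. 1) A - S.rv (\<lambda>_. 1) V0 - S.rv (\<lambda>_. 1) Q"
    using S.rv_diff[OF fin V0A, of "\<lambda>_. 1"] S.rv_diff[OF _ QAV, of "\<lambda>_. 1"] fin by simp
  moreover have "int n dvd S.rv (\<lambda>_. 1) V0" "int n dvd S.rv (\<lambda>_. 1) Q"
    using poV poQ po_iff[OF V0A] po_iff[OF QA(1)] by simp_all
  ultimately have "int n dvd S.rv (\<lambda>_. 1) (A - V0 - Q)" by (simp add: dvd_diff)
  hence "S.po (A - V0 - Q)" using po_iff[of "A - V0 - Q"] by blast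
  thus ?thesis using conn_common_part[OF B(1) V V0 QA(2) _ poQ] QA Q by blast
qed

lemma conn_rich:
  assumes B: "ablocks \<B> A" "2 * n + 1 \<le> card \<B>" and V: "ablocks \<V> A"
  shows "conn \<B> \<V>"
proof (cases "\<forall>i\<in>A. \<not> refl (f i)")
  case True thus ?thesis using conn_no_refl[OF B V] by blast
next
  case False
  then obtain v0 where v0: "v0 \<in> A" "refl (f v0)" by blast
  have bV: "S.blocks \<V> A" and bB: "S.blocks \<B> A" using ablocksD B V by blast+
  obtain e where e: "S.sg e" "\<And>B. B \<in> \<B> \<Longrightarrow> S.compat e B"
    by (rule S.glue_signs[OF bB fin ablocks_po(1)[OF fin B(1)]]) auto
  obtain h where h: "S.sg h" "\<And>V. V \<in> \<V> \<Longrightarrow> S.compat h V"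
      "\<And>V i. V \<in> \<V> \<Longrightarrow> (\<forall>j\<in>V. \<not> refl (f j)) \<Longrightarrow> i \<in> V \<Longrightarrow> h i = 1"
    by (rule S.glue_signs[OF bV fin ablocks_po(1)[OF fin V]]) auto
  have ze: "S.zs e A" using S.zs_blocks[OF bB fin] e(2) S.compat_zs by blast
  have zh: "S.zs h A" using S.zs_blocks[OF bV fin] h(2) S.compat_zs by blast
  have neg: "e i = - h i" if "e i \<noteq> h i" for i
    using that e(1)[unfolded S.sg_def, rule_format, of i] h(1)[unfolded S.sg_def, rule_format, of i] by auto
  \<comment> \<open>If \<open>D\<close> contains none or all of the reflections, then
    \<open>e\<close> is \<open>h\<close> or \<open>- h\<close> on all reflections, so the blocks of
    \<open>\<B>\<close> are balanced for \<open>h\<close> or for \<open>- h\<close>.\<close>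
  define D where "D = {i\<in>A. e i \<noteq> h i}"
  consider "\<forall>i\<in>D. \<not> refl (f i)" | "\<forall>i\<in>A - D. \<not> refl (f i)"
    | p q where "p \<in> D" "refl (f p)" "q \<in> A - D" "refl (f q)" by blast
  thus ?thesis
  proof cases
    case 1
    have "S.rb h B = 0" if B': "B \<in> \<B>" for B
    proof -
      have BA: "B \<subseteq> A" using S.blocks_finite(3)[OF bB fin B'] .
      have "S.rb h B = S.rb e B" by (rule S.rb_cong) (use 1 BA in \<open>auto simp: D_def\<close>)
      thus ?thesis using e(2)[OF B'] by (simp add: S.compat_def S.zs_def)
    qed
    thus ?thesis using conn_balanced[OF B V h(1) _ _ _ v0, of 1] h(2,3) S.compat_zs by blast
  next
    case 2
    have "S.rb (\<lambda>i. - h i) B = 0" if B': "B \<in> \<B>" for B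
    proof -
      have BA: "B \<subseteq> A" using S.blocks_finite(3)[OF bB fin B'] .
      have "S.rb (\<lambda>i. - h i) B = S.rb e B"
        by (rule S.rb_cong) (use 2 BA neg in \<open>fastforce simp: D_def\<close>)
      thus ?thesis using e(2)[OF B'] by (simp add: S.compat_def S.zs_def)
    qed
    moreover have "S.zs (\<lambda>i. - h i) V'" if "V' \<in> \<V>" for V'
      using h(2)[OF that] by (simp add: S.zs_uminus S.compat_def)
    ultimately show ?thesis
      using conn_balanced[OF B V S.sg_uminus[OF h(1)] _ _ _ v0, of "-1"] h(3) by auto
  next
    case (3 p q)
    \<comment> \<open>A finest decomposition \<open>\<D>\<close> that separates \<open>D\<close> from \<open>A - D\<close> is zero-sum for both sign functions;
      refined into atoms, it is the intermediate factorization between \<open>\<B>\<close> and \<open>\<V>\<close>.\<close>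
    have zD: "S.zs h D" unfolding D_def using S.zs_differ[OF fin h(1) e(1) zh ze] .
    have DA: "D \<subseteq> A" by (auto simp: D_def)
    define ok where "ok \<D> \<longleftrightarrow> S.blocks \<D> A \<and> (\<forall>P\<in>\<D>. S.compat h P \<and> (P \<subseteq> D \<or> P \<subseteq> A - D))" for \<D>
    have "ok {D, A - D}"
      unfolding ok_def S.blocks_def disjoint_def
      using S.compatI[OF zD 3(1,2)] S.compatI[OF S.zs_diff[OF fin DA zh zD] 3(3,4)] DA 3 by auto
    moreover have "card \<D> \<le> card A" if "ok \<D>" for \<D>
    proof -
      have bD: "S.blocks \<D> A" using that by (simp add: ok_def)
      have "(\<Sum>P\<in>\<D>. 1) \<le> (\<Sum>P\<in>\<D>. card (A \<inter> P))"
      proof (rule sum_mono)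
        fix P assume P: "P \<in> \<D>"
        show "1 \<le> card (A \<inter> P)"
          using S.blocks_finite(2,3,4)[OF bD fin P] by (simp add: Int_absorb1 Suc_le_eq card_gt_0_iff)
      qed
      thus ?thesis using S.card_blocks_Int[OF bD fin subset_refl] by simp
    qed
    \<comment> \<open>Nonempty parts number at most \<open>card A\<close>, so a decomposition with
      the most parts exists. Splitting one of its parts would give more parts, hence
      \<open>irr\<close>.\<close>
    ultimately have "\<exists>\<D>. ok \<D> \<and> (\<forall>\<D>'. ok \<D>' \<longrightarrow> card \<D>' \<le> card \<D>)"
      by (intro ex_has_greatest_nat[of ok "{D, A - D}" card "Suc (card A)"]) (auto simp: less_Suc_eq_le)
    then obtain \<D> where D: "ok \<D>" "\<And>\<D>'. ok \<D>' \<Longrightarrow> card \<D>' \<le> card \<D>" by blast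
    have bD: "S.blocks \<D> A" using D(1) by (simp add: ok_def)
    have cD: "S.compat h P" if "P \<in> \<D>" for P using D(1) that by (simp add: ok_def)
    note fD = S.blocks_finite[OF bD fin]
    have irr: "Y = P" if P: "P \<in> \<D>" and Y: "Y \<subseteq> P" "Y \<noteq> {}" "S.compat h Y" "S.compat h (P - Y)" for P Y
    proof (rule ccontr)
      assume "Y \<noteq> P"
      hence PY: "P - Y \<noteq> {}" using Y(1) by blast
      define \<D>' where "\<D>' = insert Y (insert (P - Y) (\<D> - {P}))"
      have n1: "P' \<inter> P = {}" if "P' \<in> \<D> - {P}" for P' using S.blocks_disj[OF bD, of P' P] that P by blast
      have "disjoint \<D>'"
        unfolding disjoint_def
      proof (intro ballI impI)
        fix a b assume ab: "a \<in> \<D>'" "b \<in> \<D>'" "a \<noteq> b"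
        have c: "a' \<in> \<D> - {P} \<or> a' = Y \<or> a' = P - Y" if "a' \<in> \<D>'" for a' using that by (auto simp: \<D>'_def)
        show "a \<inter> b = {}"
          using c[OF ab(1)] c[OF ab(2)] ab(3) n1[of a] n1[of b] Y(1) S.blocks_disj[OF bD, of a b] by blast
      qed
      moreover have "\<Union>\<D>' = A" using bD P Y(1) unfolding \<D>'_def S.blocks_def by blast
      moreover have "{} \<notin> \<D>'" using Y(2) PY bD unfolding \<D>'_def S.blocks_def by blast
      ultimately have "S.blocks \<D>' A" by (simp add: S.blocks_def)
      moreover have "P \<subseteq> D \<or> P \<subseteq> A - D" using D(1) P by (simp add: ok_def)
      ultimately have "ok \<D>'" unfolding ok_def using D(1) Y unfolding ok_def \<D>'_def by blast
      hence "card \<D>' \<le> card \<D>" by (rule D(2))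
      moreover have "Y \<notin> \<D> - {P}" using n1[of Y] Y(1,2) by (metis Int_absorb2)
      moreover have "P - Y \<notin> \<D> - {P}"
      proof
        assume "P - Y \<in> \<D> - {P}"
        hence "(P - Y) \<inter> P = {}" by (rule n1)
        moreover have "(P - Y) \<inter> P = P - Y" by blast
        ultimately show False using PY by simp
      qed
      moreover have "Y \<noteq> P - Y" using Y(2) by (metis Diff_disjoint Int_absorb)
      ultimately have "card \<D>' \<le> card \<D>" "Y \<notin> insert (P - Y) (\<D> - {P})" "P - Y \<notin> \<D> - {P}" by simp_all
      moreover have "finite (\<D> - {P})" using fD(1) by simp
      moreover have "card \<D> = Suc (card (\<D> - {P}))" using fD(1) P by (rule card.remove)
      ultimately have "card \<D>' = Suc (card \<D>)"
        unfolding \<D>'_def by (metis card_insert_disjoint finite_insert)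
      thus False using D(2)[OF \<open>ok \<D>'\<close>] by simp
    qed
    \<comment> \<open>\<open>P1\<close> lies in \<open>D\<close>, where \<open>e\<close> is
      \<open>- h\<close>, so it is zero-sum for both sign functions and can be combined with a block
      of either factorization; \<open>q\<close> is a reflection outside it.\<close>
    obtain P1 where P1: "P1 \<in> \<D>" "p \<in> P1" using S.blocks_mem[OF bD] DA 3(1) by blast
    have P1D: "P1 \<subseteq> D" using D(1) P1 3(1) by (auto simp: ok_def)
    have P1A: "P1 \<subseteq> A" using fD(3)[OF P1(1)] .
    have cP1: "card P1 \<le> 2 * n"
      by (rule S.irreducible_card[OF fD(2)[OF P1(1)] h(1) S.compat_zs[OF cD[OF P1(1)]] P1(2) 3(2)])
        (rule irr[OF P1(1)])
    have zP1h: "S.zs h P1" using S.compat_zs[OF cD[OF P1(1)]] .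
    have "S.zs e P1 = S.zs (\<lambda>i. - h i) P1" by (rule S.zs_cong) (use P1D neg in \<open>auto simp: D_def\<close>)
    hence zP1e: "S.zs e P1" using zP1h by (simp add: S.zs_uminus)
    have qP1: "q \<in> A - P1" using 3(3) P1D by blast
    have "\<exists>\<C>. ablocks \<C> P" if "P \<in> \<D>" for P
      using ablocks_exists[OF fD(2)[OF that]] S.poI[OF h(1) cD[OF that]] by blast
    then obtain c where c: "\<And>P. P \<in> \<D> \<Longrightarrow> ablocks (c P) P" by metis
    define \<E> where "\<E> = (\<Union>P\<in>\<D>. c P)"
    have cU: "\<Union>(c P) = P" if "P \<in> \<D>" for P using c[OF that] by (simp add: ablocks_def S.blocks_def)
    have E: "ablocks \<E> A"
      unfolding ablocks_def S.blocks_def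
    proof (intro conjI)
      show "disjoint \<E>"
        unfolding disjoint_def
      proof (intro ballI impI)
        fix a b assume ab: "a \<in> \<E>" "b \<in> \<E>" "a \<noteq> b"
        obtain P P' where PP: "P \<in> \<D>" "a \<in> c P" "P' \<in> \<D>" "b \<in> c P'" using ab by (auto simp: \<E>_def)
        show "a \<inter> b = {}"
        proof (cases "P = P'")
          case True thus ?thesis using c[OF PP(1)] PP ab(3) unfolding ablocks_def S.blocks_def disjoint_def by blast
        next
          case False
          hence "P \<inter> P' = {}" using S.blocks_disj[OF bD] PP by blast
          thus ?thesis using cU PP by blast
        qed
      qed
      have "\<Union>\<E> = (\<Union>P\<in>\<D>. \<Union>(c P))" by (auto simp: \<E>_def)
      also have "\<dots> = \<Union>\<D>" using cU by simp
      finally show "\<Union>\<E> = A" using bD by (simp add: S.blocks_def)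
      show "{} \<notin> \<E>" "im ` \<E> \<subseteq> product_one_atoms G"
        using c unfolding \<E>_def ablocks_def S.blocks_def by blast+
    qed
    \<comment> \<open>Needed for \<open>\<B>\<close> with the signs \<open>e\<close> and for
      \<open>\<V>\<close> with the signs \<open>h\<close>. The intermediate factorization shares
      \<open>U\<close> with \<open>\<C>\<close> and the atoms of \<open>c P1\<close> with
      \<open>\<E>\<close>.\<close>
    have to_E: "conn \<C> \<E>"
      if C: "ablocks \<C> A" "2 * n + 1 \<le> card \<C>" "\<And>C. C \<in> \<C> \<Longrightarrow> S.zs s C" and s: "S.sg s" "S.zs s A" "S.zs s P1"
      for \<C> s
    proof -
      obtain U where U: "U \<in> \<C>" "U \<inter> P1 = {}" "S.po (A - P1 - U)"
        using S.disjoint_block[OF fin s(1,2) ablocksD(1)[OF C(1)] C(2,3) P1A s(3) cP1 P1(2) 3(2) qP1 3(4)] by blast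
      have UA: "U \<subseteq> A" using S.blocks_finite(3)[OF ablocksD(1)[OF C(1)] fin U(1)] .
      obtain \<R> where R: "ablocks \<R> (A - P1 - U)" using ablocks_exists[OF _ U(3)] fin by auto
      have "ablocks {U} U" using ablocks_sub[OF C(1), of "{U}"] U(1) by simp
      hence "ablocks ({U} \<union> c P1) (U \<union> P1)" using ablocks_Un c[OF P1(1)] U(2) by blast
      hence "ablocks ({U} \<union> c P1 \<union> \<R>) (U \<union> P1 \<union> (A - P1 - U))" using ablocks_Un[OF _ R] by blast
      moreover have "U \<union> P1 \<union> (A - P1 - U) = A" using UA P1A by blast
      ultimately have F: "ablocks ({U} \<union> c P1 \<union> \<R>) A" by simp
      obtain B1 where B1: "B1 \<in> c P1" using cU[OF P1(1)] P1(2) by blast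
      have "conn \<C> ({U} \<union> c P1 \<union> \<R>)" by (rule conn_common[OF C(1) F U(1)]) simp
      moreover have "conn ({U} \<union> c P1 \<union> \<R>) \<E>"
        by (rule conn_common[OF F E, of B1]) (use B1 P1(1) in \<open>auto simp: \<E>_def\<close>)
      ultimately show ?thesis by (rule conn_trans)
    qed
    have BE: "conn \<B> \<E>" by (rule to_E[OF B _ e(1) ze zP1e]) (use e(2) S.compat_zs in blast)
    \<comment> \<open>The atoms inside \<open>P\<close> come with signs \<open>d\<close> of their
      own. By irreducibility of \<open>P\<close> the set where \<open>d\<close> and \<open>h\<close>
      differ cannot separate the reflections of \<open>P\<close>, so \<open>d\<close> is
      \<open>h\<close> or \<open>- h\<close> on all of them.\<close>
    have balE: "S.rb h C = 0" if C: "C \<in> \<E>" for C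
    proof -
      obtain P where P: "P \<in> \<D>" "C \<in> c P" using C by (auto simp: \<E>_def)
      have bP: "S.blocks (c P) P" using c[OF P(1)] by (simp add: ablocks_def)
      have fP: "finite P" using fD(2)[OF P(1)] .
      obtain d where d: "S.sg d" "\<And>C. C \<in> c P \<Longrightarrow> S.compat d C"
        by (rule S.glue_signs[OF bP fP ablocks_po(1)[OF fP c[OF P(1)]]]) auto
      have zd: "S.zs d P" using S.zs_blocks[OF bP fP] d(2) S.compat_zs by blast
      have zhP: "S.zs h P" using S.compat_zs[OF cD[OF P(1)]] .
      define Y where "Y = {i\<in>P. d i \<noteq> h i}"
      have zY: "S.zs h Y" unfolding Y_def using S.zs_differ[OF fP h(1) d(1) zhP zd] .
      have YP: "Y \<subseteq> P" by (auto simp: Y_def)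
      have zPY: "S.zs h (P - Y)" using S.zs_diff[OF fP YP zhP zY] .
      have negd: "d i = - h i" if "d i \<noteq> h i" for i
        using that d(1)[unfolded S.sg_def, rule_format, of i] h(1)[unfolded S.sg_def, rule_format, of i] by auto
      have CP: "C \<subseteq> P" using S.blocks_finite(3)[OF bP fP P(2)] .
      have zC: "S.rb d C = 0" using d(2)[OF P(2)] by (simp add: S.compat_def S.zs_def)
      have "(\<forall>i\<in>Y. \<not> refl (f i)) \<or> (\<forall>i\<in>P - Y. \<not> refl (f i))"
      proof (rule ccontr)
        assume "\<not> ?thesis"
        then obtain i j where ij: "i \<in> Y" "refl (f i)" "j \<in> P - Y" "refl (f j)" by blast
        have "Y = P" using irr[OF P(1) YP _ S.compatI[OF zY ij(1,2)] S.compatI[OF zPY ij(3,4)]] ij(1) by blast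
        thus False using ij(3) by blast
      qed
      thus ?thesis
      proof
        assume *: "\<forall>i\<in>Y. \<not> refl (f i)"
        have "S.rb h C = S.rb d C" by (rule S.rb_cong) (use * CP in \<open>auto simp: Y_def\<close>)
        thus ?thesis using zC by simp
      next
        assume *: "\<forall>i\<in>P - Y. \<not> refl (f i)"
        have "S.rb d C = S.rb (\<lambda>i. - h i) C"
          by (rule S.rb_cong) (use * CP negd in \<open>fastforce simp: Y_def\<close>)
        thus ?thesis using zC by (simp add: S.rb_uminus)
      qed
    qed
    \<comment> \<open>It suffices that \<open>\<E>\<close> or \<open>\<V>\<close> has more than
      \<open>2 * n\<close> blocks; if neither has, a single step joins them.\<close>
    have "conn \<E> \<V>"
    proof (cases "2 * n + 1 \<le> card \<E>")
      case True
      show ?thesis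
        by (rule conn_balanced[OF E True V h(1) _ balE h(3) v0]) (use h(2) S.compat_zs in blast)+
    next
      case E_small: False
      show ?thesis
      proof (cases "2 * n + 1 \<le> card \<V>")
        case True
        have "conn \<V> \<E>" by (rule to_E[OF V True _ h(1) zh zP1h]) (use h(2) S.compat_zs in blast)
        thus ?thesis by (rule conn_sym)
      next
        case False
        have "size (fact \<E> - fact \<V>) \<le> card \<E>" "size (fact \<V> - fact \<E>) \<le> card \<V>"
          using size_mset_mono[OF diff_subset_eq_self] size_fact by metis+
        hence "(fact \<E>, fact \<V>) \<in> fstep G (2 * n) (im A)"
          using fact_factorization[OF fin] E V E_small False by (auto simp: fstep_def factorization_dist_def)
        thus ?thesis by blast
      qed
    qed
    with BE show ?thesis by (rule conn_trans)
  qed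
qed

end

section \<open>The bound for all product-one sequences\<close>

lemma (in group) one_factor:
  assumes z: "z \<in> factorizations G A" and one: "\<one> \<in># A"
  shows "{#\<one>#} \<in># z"
proof -
  obtain U where U: "U \<in># z" "\<one> \<in># U" using z one by (auto simp: factorizations_def)
  have Ua: "U \<in> product_one_atoms G" using z U by (auto simp: factorizations_def)
  then obtain xs where xs: "mset xs = U" "foldr (\<otimes>) xs \<one> = \<one>" and cU: "set_mset U \<subseteq> carrier G"
    by (auto simp: product_one_atoms_def product_one_monoid_def product_one_def sequences_over_def)
  \<comment> \<open>Deleting an entry \<open>\<one>\<close> does not change the product, so an atom
    containing \<open>\<one>\<close> splits unless nothing else is left.\<close>
  obtain ys zs where yz: "xs = ys @ \<one> # zs" using U(2) xs(1) by (metis set_mset_mset split_list)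
  have "set zs \<subseteq> carrier G" using cU xs(1) yz by auto
  hence "foldr (\<otimes>) zs \<one> \<in> carrier G" by (induction zs) auto
  hence "foldr (\<otimes>) (ys @ zs) \<one> = \<one>" using xs(2) yz by simp
  hence "product_one G (mset (ys @ zs))" unfolding product_one_def by blast
  moreover have "set_mset (mset (ys @ zs)) \<subseteq> carrier G" using cU xs(1) yz by auto
  ultimately have 1: "mset (ys @ zs) \<in> product_one_monoid G"
    by (simp add: product_one_monoid_def sequences_over_def)
  have "product_one G {#\<one>#}" unfolding product_one_def by (intro exI[of _ "[\<one>]"]) simp
  hence 2: "{#\<one>#} \<in> product_one_monoid G" by (simp add: product_one_monoid_def sequences_over_def)
  have "U = {#\<one>#} + mset (ys @ zs)" using xs(1) yz by simp
  hence "mset (ys @ zs) = {#}" using atom_irreducible[OF Ua _ 2 1] by auto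
  thus ?thesis using U(1) xs(1) yz by simp
qed

context dihedral
begin

theorem fconn_2n: "A \<in> product_one_monoid G \<Longrightarrow> fconn G (2 * n) A"
proof (induction "size A" arbitrary: A rule: less_induct)
  case less
  have IH: "fconn G (2 * n) B" if "B \<in> product_one_monoid G" "size B < size A" for B
    using less.hyps that by blast
  have rich: "(z, w) \<in> (fstep G (2 * n) A)\<^sup>*"
    if z: "z \<in> factorizations G A" "2 * n + 1 \<le> size z" and w: "w \<in> factorizations G A" for z w
  proof (cases "\<one> \<in># A")
    case True
    thus ?thesis using common_atom_connected[OF IH z(1) _ w] one_factor[OF z(1)] one_factor[OF w] by blast
  next
    case False
    obtain xs where xs: "mset xs = A" using ex_mset by blast
    \<comment> \<open>Beyond the positions of \<open>xs\<close> the value is \<open>\<one>\<close>,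
      because the locale requires values in the carrier at every index.\<close>
    define f where "f i = (if i < length xs then xs ! i else \<one>)" for i
    have cA: "set_mset A \<subseteq> carrier G" using less.prems by (simp add: product_one_monoid_def sequences_over_def)
    have im: "image_mset f (mset_set {..<length xs}) = A"
    proof -
      have "image_mset f (mset_set {..<length xs}) = mset (map f [0..<length xs])"
        by (simp add: atLeast0LessThan)
      also have "map f [0..<length xs] = xs" by (rule nth_equalityI) (auto simp: f_def)
      finally show ?thesis using xs by simp
    qed
    interpret I: dihedral_step G n a t f "{..<length xs}"
    proof unfold_locales
      show "f i \<in> carrier G" for i using cA xs by (auto simp: f_def)
      show "fconn G (2 * n) B" if "B \<in> product_one_monoid G"
        "size B < size (image_mset f (mset_set {..<length xs}))" for B using IH that im by simp
      show "f i \<noteq> \<one>" if "i \<in> {..<length xs}" for i using that False xs by (auto simp: f_def dest: nth_mem)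
    qed simp
    obtain \<B> where B: "I.ablocks \<B> {..<length xs}" "z = I.fact \<B>"
      using I.partition_exists[of z "{..<length xs}"] z(1) im by auto
    obtain \<V> where V: "I.ablocks \<V> {..<length xs}" "w = I.fact \<V>"
      using I.partition_exists[of w "{..<length xs}"] w im by auto
    show ?thesis using I.conn_rich[OF B(1) _ V(1)] z(2) B(2) V(2) I.size_fact im by simp
  qed
  show ?case unfolding fconn_def
  proof (intro ballI)
    fix z w assume zw: "z \<in> factorizations G A" "w \<in> factorizations G A"
    consider "2 * n + 1 \<le> size z" | "2 * n + 1 \<le> size w" | "size z \<le> 2 * n" "size w \<le> 2 * n" by linarith
    thus "(z, w) \<in> (fstep G (2 * n) A)\<^sup>*"
    proof cases
      case 1 thus ?thesis using rich zw by blast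
    next
      case 2 thus ?thesis using rich zw fstep_sym by blast
    next
      case 3
      have "size (z - w) \<le> size z" "size (w - z) \<le> size w" by (simp_all add: size_mset_mono)
      hence "(z, w) \<in> fstep G (2 * n) A" using zw 3 by (auto simp: fstep_def factorization_dist_def)
      thus ?thesis by blast
    qed
  qed
qed

end

section \<open>Sequences with prescribed lengths\<close>

lemma cancel_common:
  assumes "z \<in> factorizations G A" "w \<in> factorizations G A"
  shows "\<Sum>\<^sub># (z - w) = \<Sum>\<^sub># (w - z)" "int (size w) - int (size z) = int (size (w - z)) - int (size (z - w))"
proof -
  have z: "z = z \<inter># w + (z - w)" and w: "w = z \<inter># w + (w - z)"
    by (auto simp: multiset_eq_iff min_def)
  have "\<Sum>\<^sub># z = \<Sum>\<^sub># w" using assms by (simp add: factorizations_def)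
  thus "\<Sum>\<^sub># (z - w) = \<Sum>\<^sub># (w - z)" by (metis z w sum_mset.union add_left_cancel)
  have "size z = size (z \<inter># w) + size (z - w)" "size w = size (z \<inter># w) + size (w - z)"
    by (metis z size_union) (metis w size_union)
  thus "int (size w) - int (size z) = int (size (w - z)) - int (size (z - w))" by simp
qed

lemma sum_atoms_empty: "set_mset u \<subseteq> product_one_atoms G \<Longrightarrow> \<Sum>\<^sub># u = {#} \<Longrightarrow> u = {#}"
  using factorizations_empty_iff[of u G "{#}"] by (simp add: factorizations_def)

lemma sum_atoms_is_atom:
  assumes "set_mset u \<subseteq> product_one_atoms G" "\<Sum>\<^sub># u \<in> product_one_atoms G"
  shows "u = {#\<Sum>\<^sub># u#}"
proof -
  have "u \<noteq> {#}" using assms(2) atom_nonempty by fastforce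
  then obtain V v where u: "u = add_mset V v" by (metis multiset_nonemptyE insert_DiffM)
  have "V \<in> product_one_monoid G" "\<Sum>\<^sub># v \<in> product_one_monoid G" "V \<noteq> {#}"
    using assms(1) u atom_pom atom_nonempty sum_mset_pom[of v G] by auto
  hence "\<Sum>\<^sub># v = {#}" using atom_irreducible[OF assms(2), of V "\<Sum>\<^sub># v"] u by auto
  hence "v = {#}" using sum_atoms_empty[of v G] assms(1) u by simp
  thus ?thesis using u by simp
qed

text \<open>After cancellation both sides have the same concatenation, and the empty sequence or a
  single atom has only one factorization.\<close>

lemma factorization_dist_ge_2:
  assumes z: "z \<in> factorizations G A" and w: "w \<in> factorizations G A" and ne: "z \<noteq> w"
  shows "2 \<le> size (z - w)"
proof (rule ccontr)
  assume "\<not> 2 \<le> size (z - w)"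
  note e = cancel_common[OF z w]
  have at: "set_mset (z - w) \<subseteq> product_one_atoms G" "set_mset (w - z) \<subseteq> product_one_atoms G"
    using z w by (auto simp: factorizations_def dest: in_diffD)
  consider "size (z - w) = 0" | "size (z - w) = 1" using \<open>\<not> 2 \<le> size (z - w)\<close> by linarith
  thus False
  proof cases
    case 1
    hence zw: "z - w = {#}" by simp
    hence "w - z = {#}" using e(1) sum_atoms_empty[OF at(2)] by simp
    thus False using zw ne by (metis Diff_eq_empty_iff_mset subset_mset.antisym)
  next
    case 2
    then obtain U where U: "z - w = {#U#}" by (metis size_1_singleton_mset)
    hence sU: "\<Sum>\<^sub># (w - z) = U" using e(1) by simp
    have "U \<in> product_one_atoms G" using at(1) U by simp
    hence "w - z = {#U#}" using sum_atoms_is_atom[OF at(2)] sU by simp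
    hence "U \<in># w - z" "U \<in># z - w" using U by simp_all
    hence "count z U < count w U" "count w U < count z U" by (simp_all add: in_diff_count)
    thus False by simp
  qed
qed

text \<open>The difference of the lengths is \<open>size (w - z) - size (z - w)\<close>, and the
  number subtracted is at least 2.\<close>

lemma gap_le_dist:
  assumes z: "z \<in> factorizations G A" and w: "w \<in> factorizations G A" and lt: "size z < size w"
  shows "size w + 2 \<le> size z + factorization_dist z w"
proof -
  have "2 \<le> size (z - w)" using factorization_dist_ge_2[OF z w] lt by blast
  thus ?thesis using cancel_common(2)[OF z w] lt by (simp add: factorization_dist_def)
qed

lemma chain_connectedE:
  assumes "chain_connected G A N z w"
  obtains k :: nat and y where "y 0 = z" "y k = w" "\<And>i. i \<le> k \<Longrightarrow> y i \<in> factorizations G A"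
    "\<And>i. i \<in> {1..k} \<Longrightarrow> enat (factorization_dist (y (i - 1)) (y i)) \<le> N"
proof -
  define Ch where "Ch k y \<longleftrightarrow> y 0 = z \<and> y k = w \<and> (\<forall>i\<le>k. y i \<in> factorizations G A) \<and>
    (\<forall>i\<in>{1..k}. enat (factorization_dist (y (i - 1)) (y i)) \<le> N)" for k :: nat and y
  have "\<exists>k y. Ch k y" using assms by (simp only: Ch_def chain_connected_def)
  then obtain k y where "Ch k y" by blast
  thus ?thesis using that[of y k] by (simp add: Ch_def)
qed

text \<open>The first member of the chain with at least \<open>b\<close> atoms follows one with at
  most \<open>a\<close>, so this step crosses the whole gap.\<close>

lemma chain_crosses_gap:
  assumes ch: "chain_connected G A N z w" and z: "size z \<le> a" and w: "b \<le> size w" and ab: "a < b"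
    and gap: "\<And>y. y \<in> factorizations G A \<Longrightarrow> size y \<le> a \<or> b \<le> size y"
  shows "enat (b - a + 2) \<le> N"
proof -
  obtain k :: nat and y where y: "y 0 = z" "y k = w" "\<And>i. i \<le> k \<Longrightarrow> y i \<in> factorizations G A"
    "\<And>i. i \<in> {1..k} \<Longrightarrow> enat (factorization_dist (y (i - 1)) (y i)) \<le> N"
    using chain_connectedE[OF ch] by metis
  define i where "i = (LEAST i. b \<le> size (y i))"
  have i: "b \<le> size (y i)" unfolding i_def by (rule LeastI[of _ k]) (use y(2) w in simp)
  have ik: "i \<le> k" unfolding i_def by (rule Least_le) (use y(2) w in simp)
  have i0: "0 < i" using i y(1) z ab by (cases i) auto
  have "\<not> b \<le> size (y (i - 1))" using not_less_Least[of "i - 1" "\<lambda>i. b \<le> size (y i)"] i0 i_def by simp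
  hence a: "size (y (i - 1)) \<le> a" using gap[OF y(3)[of "i - 1"]] ik by auto
  have "size (y i) + 2 \<le> size (y (i - 1)) + factorization_dist (y (i - 1)) (y i)"
    using gap_le_dist[OF y(3)[of "i - 1"] y(3)[of i]] ik a i ab by linarith
  hence "b - a + 2 \<le> factorization_dist (y (i - 1)) (y i)" using a i ab by linarith
  hence "enat (b - a + 2) \<le> enat (factorization_dist (y (i - 1)) (y i))" by simp
  also have "\<dots> \<le> N" using y(4)[of i] i0 ik by simp
  finally show ?thesis .
qed

lemma chain_nontrivial:
  assumes ch: "chain_connected G A N z w" and ne: "z \<noteq> w"
  shows "enat 2 \<le> N"
proof -
  obtain k :: nat and y where y: "y 0 = z" "y k = w" "\<And>i. i \<le> k \<Longrightarrow> y i \<in> factorizations G A"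
    "\<And>i. i \<in> {1..k} \<Longrightarrow> enat (factorization_dist (y (i - 1)) (y i)) \<le> N"
    using chain_connectedE[OF ch] by metis
  define i where "i = (LEAST i. y i \<noteq> z)"
  have i: "y i \<noteq> z" unfolding i_def by (rule LeastI[of _ k]) (use y(2) ne in simp)
  have ik: "i \<le> k" unfolding i_def by (rule Least_le) (use y(2) ne in simp)
  have i0: "0 < i" using i y(1) by (cases i) auto
  have zi: "y (i - 1) = z" using not_less_Least[of "i - 1" "\<lambda>i. y i \<noteq> z"] i0 i_def by simp
  have "2 \<le> size (y (i - 1) - y i)"
    by (rule factorization_dist_ge_2[OF y(3) y(3)]) (use ik i zi in auto)
  hence "enat 2 \<le> enat (factorization_dist (y (i - 1)) (y i))" by (simp add: factorization_dist_def)
  also have "\<dots> \<le> N" using y(4)[of i] i0 ik by simp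
  finally show ?thesis .
qed

lemma catenary_le: "fconn G N A \<Longrightarrow> catenary_degree G A \<le> enat N"
  unfolding catenary_degree_def
proof (rule Least_le, intro ballI)
  fix z w assume "fconn G N A" "z \<in> factorizations G A" "w \<in> factorizations G A"
  thus "chain_connected G A (enat N) z w" unfolding fconn_def by (intro chain_connected_if_fstep) simp_all
qed

text \<open>With the bound \<open>\<infinity>\<close> any two factorizations are joined by one step,
  so the least bound exists and has the defining property.\<close>

lemma chain_catenary:
  assumes "z \<in> factorizations G A" "w \<in> factorizations G A"
  shows "chain_connected G A (catenary_degree G A) z w"
proof -
  let ?P = "\<lambda>N. \<forall>z\<in>factorizations G A. \<forall>w\<in>factorizations G A. chain_connected G A N z w"
  have "?P \<infinity>"
  proof (intro ballI)
    fix z w assume zw: "z \<in> factorizations G A" "w \<in> factorizations G A"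
    show "chain_connected G A \<infinity> z w"
      unfolding chain_connected_def
      by (intro exI[of _ 1] exI[of _ "\<lambda>i. if i = 0 then z else w"]) (use zw in auto)
  qed
  hence "?P (LEAST N. ?P N)" by (rule LeastI)
  thus ?thesis using assms unfolding catenary_degree_def by blast
qed

lemma catenary_pos_ge_2:
  assumes "0 < catenary_degree G A" shows "enat 2 \<le> catenary_degree G A"
proof -
  have "\<exists>z\<in>factorizations G A. \<exists>w\<in>factorizations G A. z \<noteq> w"
  proof (rule ccontr)
    assume "\<not> ?thesis"
    hence "z = w" if "z \<in> factorizations G A" "w \<in> factorizations G A" for z w using that by blast
    hence "fconn G 0 A" unfolding fconn_def by (metis rtrancl.rtrancl_refl)
    from catenary_le[OF this] show False using assms by (simp add: zero_enat_def[symmetric])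
  qed
  then obtain z w where zw: "z \<in> factorizations G A" "w \<in> factorizations G A" "z \<noteq> w" by blast
  show ?thesis by (rule chain_nontrivial[OF chain_catenary[OF zw(1,2)] zw(3)])
qed

lemma fconn_if_short:
  assumes "\<And>z. z \<in> factorizations G A \<Longrightarrow> size z \<le> N"
  shows "fconn G N A"
  unfolding fconn_def
proof (intro ballI)
  fix z w assume zw: "z \<in> factorizations G A" "w \<in> factorizations G A"
  have "size (z - w) \<le> size z" "size (w - z) \<le> size w" by (simp_all add: size_mset_mono)
  hence "(z, w) \<in> fstep G N A" using zw assms[OF zw(1)] assms[OF zw(2)]
    by (auto simp: fstep_def factorization_dist_def)
  thus "(z, w) \<in> (fstep G N A)\<^sup>*" by blast
qed

text \<open>No factorization has more than \<open>m\<close> atoms, which bounds the catenary degree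
  from above; a chain between the two lengths crosses a gap of \<open>m - 2\<close>, which bounds it
  from below by \<open>m\<close>.\<close>

lemma two_lengths:
  assumes A: "A \<in> product_one_monoid G" and L: "length_set G A = {2, m}" and m: "3 \<le> m"
  shows "m - 2 \<in> set_of_distances G" "catenary_degree G A = enat m"
proof -
  have "int ` {2, m} \<inter> {2..2 + int (m - 2)} = {2, 2 + int (m - 2)}" using m by auto
  hence "m - 2 \<in> distances (int ` length_set G A)"
    unfolding distances_def L using m by auto
  thus "m - 2 \<in> set_of_distances G" unfolding set_of_distances_def using A by blast
  have sz: "size y = 2 \<or> size y = m" if "y \<in> factorizations G A" for y
    using L that unfolding length_set_def by blast
  obtain z w where zw: "z \<in> factorizations G A" "size z = 2" "w \<in> factorizations G A" "size w = m"
  proof -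
    have "2 \<in> length_set G A" "m \<in> length_set G A" by (simp_all add: L)
    thus thesis using that unfolding length_set_def by fastforce
  qed
  have "catenary_degree G A \<le> enat m"
    by (rule catenary_le, rule fconn_if_short) (use sz m in force)
  moreover have "enat (m - 2 + 2) \<le> catenary_degree G A"
    by (rule chain_crosses_gap[OF chain_catenary[OF zw(1,3)]]) (use zw sz m in force)+
  moreover have "m - 2 + 2 = m" using m by simp
  ultimately show "catenary_degree G A = enat m" by (metis order_antisym)
qed

text \<open>Lets atomicity be deduced from equations for the numbers of letters, once the possible
  shapes of atoms are known.\<close>

lemma atom_if_unique_length:
  assumes "S \<in> product_one_monoid G" "\<And>z. z \<in> factorizations G S \<Longrightarrow> size z = 1"
  shows "S \<in> product_one_atoms G"
proof -
  obtain z where z: "z \<in> factorizations G S" using factorization_exists[OF assms(1)] by blast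
  then obtain U where "z = {#U#}" using assms(2) by (metis size_1_singleton_mset)
  thus ?thesis using z by (auto simp: factorizations_def)
qed

lemma sum_replicate_mset: "\<Sum>\<^sub># (replicate_mset m (replicate_mset k x)) = replicate_mset (m * k) x"
  by (induction m) (auto simp: multiset_eq_iff)

lemma factorizations_replicate:
  "U \<in> product_one_atoms G \<Longrightarrow> replicate_mset m U \<in> factorizations G (\<Sum>\<^sub># (replicate_mset m U))"
  by (auto simp: factorizations_def dest: in_replicate_mset[THEN iffD1])

lemma sub_mset_two_letters:
  assumes "P \<subseteq># replicate_mset b x + replicate_mset a y" "x \<noteq> y"
  obtains b' a' where "b' \<le> b" "a' \<le> a" "P = replicate_mset b' x + replicate_mset a' y"
proof -
  have le: "count P c \<le> count (replicate_mset b x + replicate_mset a y) c" for c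
    using mset_subset_eq_count[OF assms(1)] .
  have "P = replicate_mset (count P x) x + replicate_mset (count P y) y"
  proof (rule multiset_eqI)
    fix c
    show "count P c = count (replicate_mset (count P x) x + replicate_mset (count P y) y) c"
      using le[of c] assms(2) by auto
  qed
  thus ?thesis using that[of "count P x" "count P y"] le[of x] le[of y] assms(2) by simp
qed

section \<open>Lower bound: sequences over two reflections and a few further letters\<close>

locale dihedral_ge_3 = dihedral +
  assumes n3: "3 \<le> n"
begin

text \<open>The sequence \<open>x^b x'^e\<close> for the reflections \<open>x = t\<close> and
  \<open>x' = a t\<close>.\<close>

definition mk :: "nat \<Rightarrow> nat \<Rightarrow> 'a multiset" where
  "mk b e = replicate_mset b (el 0 True) + replicate_mset e (el 1 True)"

lemma neq01: "el 0 True \<noteq> el 1 True"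
  using n3 by (simp add: el_eq_iff)

lemma mk_plus: "mk b e + mk b' e' = mk (b + b') (e + e')"
  by (simp add: mk_def multiset_eq_iff)

lemma mk_eq_iff: "mk b e = mk b' e' \<longleftrightarrow> b = b' \<and> e = e'"
proof
  assume "mk b e = mk b' e'"
  hence "count (mk b e) (el 0 True) = count (mk b' e') (el 0 True)"
    "count (mk b e) (el 1 True) = count (mk b' e') (el 1 True)" by simp_all
  thus "b = b' \<and> e = e'" using neq01 by (simp add: mk_def)
qed simp

lemma mk_0: "mk b e = {#} \<longleftrightarrow> b = 0 \<and> e = 0"
  by (auto simp: mk_def)

lemma set_mk: "set_mset (mk b e) \<subseteq> carrier G"
  by (auto simp: mk_def)

lemma rc_replicate: "rc (replicate_mset k x) = (if refl x then int k else 0)"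
  by (induction k) auto

lemma vs_replicate: "vs (replicate_mset k x) = int k * val x"
  by (induction k) (auto simp: algebra_simps)

lemma rc_mk: "rc (mk b e) = int b + int e"
  by (simp add: mk_def rc_replicate)

lemma vs_mk: "int n dvd vs (mk b e) - int e"
proof -
  have "int n dvd int b * (val (el 0 True) - 0) + int e * (val (el 1 True) - 1)"
    using val_el[of 0 True] val_el[of 1 True] by (intro dvd_add dvd_mult)
  thus ?thesis by (simp add: mk_def vs_replicate algebra_simps)
qed

lemma vs_el: "int n dvd vs {#el i c#} - i"
  using val_el[of i c] by simp

lemma pom_balanced:
  assumes "set_mset (P + M) \<subseteq> carrier G" "rc P = rc M" "int n dvd vs P - vs M" "0 < rc P \<or> M = {#}"
  shows "P + M \<in> product_one_monoid G"
  using product_oneI[of P M] assms by (simp add: balanced_def product_one_monoid_def sequences_over_def)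

lemma even_mk_pom:
  assumes "even b" "even e" shows "mk b e \<in> product_one_monoid G"
proof -
  have "mk b e = mk (b div 2) (e div 2) + mk (b div 2) (e div 2)"
    using assms by (auto elim!: evenE simp: mk_plus mult_2)
  moreover have "0 < rc (mk (b div 2) (e div 2)) \<or> mk (b div 2) (e div 2) = {#}"
    by (auto simp: rc_mk mk_0)
  ultimately show ?thesis using pom_balanced[of "mk (b div 2) (e div 2)" "mk (b div 2) (e div 2)"] set_mk by auto
qed

lemma mk_nn_pom: "mk n n \<in> product_one_monoid G"
proof -
  have "int n dvd vs (mk 0 n) - vs (mk n 0)"
  proof -
    have "vs (mk 0 n) - vs (mk n 0) = (vs (mk 0 n) - int n) - (vs (mk n 0) - int 0) + int n" by simp
    thus ?thesis using vs_mk[of 0 n] vs_mk[of n 0] by (metis dvd_add dvd_diff dvd_refl)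
  qed
  thus ?thesis using pom_balanced[of "mk 0 n" "mk n 0"] set_mk n3 by (simp add: rc_mk mk_plus)
qed

text \<open>\<open>s\<close> is the signed number of letters \<open>el 1 True\<close> (negated when the sign of the extra letter is \<open>-1\<close>).\<close>

lemma pom_mk_signed:
  assumes pom: "mk b e + Y \<in> product_one_monoid G"
    and Y: "Y = {#} \<and> \<kappa> = 0 \<and> c = 0 \<or> (\<exists>k. Y = {#el c k#} \<and> \<kappa> = (if k then 1 else 0))"
  obtains s :: int where "\<bar>s\<bar> \<le> int e" "even (s - int e)" "\<bar>s + \<kappa>\<bar> \<le> int b" "even (s + \<kappa> - int b)"
    "int n dvd s + c"
proof -
  note result = that
  have main: thesis if bal: "P + M = mk b e" "rc P + \<kappa> = rc M" "int n dvd vs P + c - vs M" for P M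
  proof -
    obtain b' e' where P: "b' \<le> b" "e' \<le> e" "P = mk b' e'"
      using sub_mset_two_letters[of P b "el 0 True" e "el 1 True"] bal(1) neq01
      unfolding mk_def by (metis mset_subset_eq_add_left)
    have "mk b' e' + M = mk b' e' + mk (b - b') (e - e')" using bal(1) P by (simp add: mk_plus)
    hence M: "M = mk (b - b') (e - e')" by simp
    \<comment> \<open>Positive minus negative letters \<open>el 1 True\<close>, that is
      \<open>e' - (e - e')\<close>. The letters \<open>el 0 True\<close> have exponent 0 modulo
      \<open>n\<close> and only balance the reflections.\<close>
    define s where "s = 2 * int e' - int e"
    have e: "s + \<kappa> = int b - 2 * int b'" using bal(2) P by (simp add: M rc_mk s_def)
    have "s + c = (vs P + c - vs M) - (vs P - int e') + (vs M - int (e - e'))"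
      using P by (simp add: s_def of_nat_diff)
    moreover have "int n dvd vs P - int e'" "int n dvd vs M - int (e - e')"
      using vs_mk[of b' e'] vs_mk[of "b - b'" "e - e'"] by (simp_all only: P(3) M)
    ultimately have "int n dvd s + c" using bal(3) by (metis dvd_add dvd_diff)
    moreover have "\<bar>s\<bar> \<le> int e" "even (s - int e)" using P by (auto simp: s_def)
    moreover have "\<bar>s + \<kappa>\<bar> \<le> int b" "even (s + \<kappa> - int b)" unfolding e using P by auto
    ultimately show thesis using result[of s] by blast
  qed
  have S: "set_mset (mk b e + Y) \<subseteq> carrier G" "product_one G (mk b e + Y)"
    using pom by (simp_all add: product_one_monoid_def sequences_over_def)
  obtain P M where PM: "P + M = mk b e + Y" "balanced P M" using product_oneE[OF S] by blast
  have bal: "rc P = rc M" "int n dvd vs P - vs M" using PM(2) by (simp_all add: balanced_def)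
  have bal': "int n dvd vs M - vs P" using bal(2) by (simp add: dvd_diff_commute)
  show thesis
    using Y
  proof
    assume Y: "Y = {#} \<and> \<kappa> = 0 \<and> c = 0"
    thus thesis using main[of P M] PM(1) bal by simp
  next
    assume "\<exists>k. Y = {#el c k#} \<and> \<kappa> = (if k then 1 else 0)"
    then obtain k where k: "Y = {#el c k#}" "\<kappa> = (if k then 1 else 0)" by blast
    have "el c k \<in># P + M" using PM(1) k by simp
    \<comment> \<open>The extra letter may be taken in \<open>P\<close>; otherwise \<open>P\<close>
      and \<open>M\<close> are exchanged.\<close>
    moreover have *: thesis if "el c k \<in># P" "P + M = mk b e + Y" "rc P = rc M" "int n dvd vs P - vs M" for P M
    proof -
      obtain P' where P': "P = add_mset (el c k) P'" using \<open>el c k \<in># P\<close> by (metis insert_DiffM)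
      have "P' + M = mk b e" using that(2) P' k(1) by simp
      moreover have "rc P' + \<kappa> = rc M" using that(3) P' k(2) by auto
      moreover have "vs P' + c - vs M = (vs P - vs M) - (val (el c k) - c)" using P' by simp
      hence "int n dvd vs P' + c - vs M" using that(4) val_el[of c k] by (metis dvd_diff)
      ultimately show thesis by (rule main)
    qed
    ultimately show thesis using *[of P M] *[of M P] PM(1) bal bal' by (auto simp: union_commute)
  qed
qed

text \<open>With \<open>b\<close> and \<open>e\<close> even, a square splits off. With both odd,
  \<open>s\<close> is an odd multiple of \<open>n\<close>, so each letter occurs at least
  \<open>n\<close> times; then \<open>mk n n\<close> splits off and leaves even exponents.\<close>

lemma atom_mk:
  assumes at: "mk b e \<in> product_one_atoms G"
  shows "(b, e) = (2, 0) \<or> (b, e) = (0, 2) \<or> (b, e) = (n, n)"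
proof -
  obtain s where s: "\<bar>s\<bar> \<le> int e" "even (s - int e)" "\<bar>s\<bar> \<le> int b" "even (s - int b)" "int n dvd s"
    using pom_mk_signed[of b e "{#}" 0 0] atom_pom[OF at] by auto
  have split: "(b, e) = (b0, a0)"
    if "mk b0 a0 \<in> product_one_monoid G" "b0 \<le> b" "a0 \<le> e" "even (b - b0)" "even (e - a0)" "0 < b0 + a0" for b0 a0
  proof -
    have "mk b e = mk b0 a0 + mk (b - b0) (e - a0)" using that by (simp add: mk_plus)
    hence "mk b0 a0 = {#} \<or> mk (b - b0) (e - a0) = {#}"
      using atom_irreducible[OF at _ that(1) even_mk_pom[OF that(4,5)]] by blast
    thus ?thesis using that by (auto simp: mk_0)
  qed
  have ne: "0 < b + e" using atom_nonempty[OF at] by (auto simp: mk_0)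
  show ?thesis
  proof (cases "even e")
    case True
    hence ev: "even b" using s by auto
    show ?thesis
    proof (cases "b = 0")
      case True
      hence "2 \<le> e" using ne \<open>even e\<close> by (auto elim: evenE)
      thus ?thesis using split[of 0 2] even_mk_pom[of 0 2] ev \<open>even e\<close> by simp
    next
      case False
      hence "2 \<le> b" using ev by (auto elim: evenE)
      thus ?thesis using split[of 2 0] even_mk_pom[of 2 0] ev \<open>even e\<close> by simp
    qed
  next
    case False
    hence "odd s" "odd b" using s by auto
    hence "s \<noteq> 0" by auto
    hence "int n \<le> \<bar>s\<bar>" using dvd_imp_le_int[OF _ s(5)] by simp
    hence "n \<le> e" "n \<le> b" using s by linarith+
    thus ?thesis using split[OF mk_nn_pom] n_odd False \<open>odd b\<close> n3 by simp
  qed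
qed

text \<open>\<open>u\<close>, \<open>i\<close> and \<open>j\<close> count the atoms
  \<open>mk n n\<close>, \<open>mk 2 0\<close> and \<open>mk 0 2\<close>.\<close>

lemma length_mk:
  assumes "z \<in> factorizations G (mk b e)"
  shows "\<exists>u i j. size z = u + i + j \<and> b = u * n + 2 * i \<and> e = u * n + 2 * j"
  using assms
proof (induction z arbitrary: b e)
  case empty
  hence "mk b e = {#}" by (simp add: factorizations_def)
  thus ?case by (intro exI[of _ 0]) (simp add: mk_0)
next
  case (add U z)
  have U: "U \<in> product_one_atoms G" and z: "set_mset z \<subseteq> product_one_atoms G" "mk b e = U + \<Sum>\<^sub># z"
    using add.prems by (auto simp: factorizations_def)
  obtain b' e' where ba: "b' \<le> b" "e' \<le> e" "U = mk b' e'"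
    using sub_mset_two_letters[of U b "el 0 True" e "el 1 True"] z(2) neq01
    unfolding mk_def by (metis mset_subset_eq_add_left)
  have "mk b' e' + \<Sum>\<^sub># z = mk b' e' + mk (b - b') (e - e')" using ba z(2) by (simp add: mk_plus)
  hence "z \<in> factorizations G (mk (b - b') (e - e'))" using z(1) by (simp add: factorizations_def)
  then obtain u i j where uij: "size z = u + i + j" "b - b' = u * n + 2 * i" "e - e' = u * n + 2 * j"
    using add.IH by blast
  consider "b' = 2" "e' = 0" | "b' = 0" "e' = 2" | "b' = n" "e' = n" using atom_mk[of b' e'] U ba(3) by auto
  thus ?case
  proof cases
    case 1
    thus ?thesis using uij ba by - (rule exI[of _ u], rule exI[of _ "Suc i"], rule exI[of _ j], simp)
  next
    case 2
    thus ?thesis using uij ba by - (rule exI[of _ u], rule exI[of _ i], rule exI[of _ "Suc j"], simp)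
  next
    case 3
    have "b = Suc u * n + 2 * i" "e = Suc u * n + 2 * j"
      using uij(2,3) ba(1,2) unfolding 3 mult_Suc by linarith+
    thus ?thesis using uij(1) by - (rule exI[of _ "Suc u"], rule exI[of _ i], rule exI[of _ j], simp)
  qed
qed

lemma nn_atom: "mk n n \<in> product_one_atoms G"
proof (rule atom_if_unique_length[OF mk_nn_pom])
  fix z assume "z \<in> factorizations G (mk n n)"
  then obtain u i j where z: "size z = u + i + j" "n = u * n + 2 * i" "n = u * n + 2 * j"
    using length_mk by blast
  have "u \<noteq> 0" using z(2) n_odd by (metis add_0 dvd_triv_left mult_0)
  moreover have "\<not> 2 \<le> u"
  proof
    assume "2 \<le> u"
    hence "2 * n \<le> u * n" by simp
    thus False using z(2) n3 by linarith
  qed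
  ultimately have "u = 1" by linarith
  thus "size z = 1" using z by simp
qed

lemma square_atoms: "mk 2 0 \<in> product_one_atoms G" "mk 0 2 \<in> product_one_atoms G"
proof -
  have *: "size z = 1" if zf: "z \<in> factorizations G (mk b e)" and be: "(b, e) = (2, 0) \<or> (b, e) = (0, 2)" for z b e
  proof -
    obtain u i j where z: "size z = u + i + j" "b = u * n + 2 * i" "e = u * n + 2 * j"
      using length_mk[OF zf] by blast
    have "u = 0"
    proof (rule ccontr)
      assume "u \<noteq> 0"
      hence "n \<le> u * n" by simp
      thus False using z be n3 by auto
    qed
    thus ?thesis using z be by auto
  qed
  show "mk 2 0 \<in> product_one_atoms G" by (rule atom_if_unique_length[OF even_mk_pom]) (use * in auto)
  show "mk 0 2 \<in> product_one_atoms G" by (rule atom_if_unique_length[OF even_mk_pom]) (use * in auto)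
qed

lemma squares_factorization:
  "replicate_mset i (mk 2 0) + replicate_mset j (mk 0 2) \<in> factorizations G (mk (2 * i) (2 * j))"
proof -
  have "\<Sum>\<^sub># (replicate_mset i (mk 2 0)) = mk (2 * i) 0" "\<Sum>\<^sub># (replicate_mset j (mk 0 2)) = mk 0 (2 * j)"
    unfolding mk_def by (simp_all add: sum_replicate_mset mult.commute)
  thus ?thesis
    using factorizations_plus[OF factorizations_replicate[OF square_atoms(1), of i]
        factorizations_replicate[OF square_atoms(2), of j]] by (simp add: mk_plus)
qed

text \<open>As \<open>n\<close> is odd, \<open>2 * n = u * n + 2 * i\<close> forces \<open>u\<close>
  to be even: either \<open>u = 2\<close> and nothing else is left, or \<open>u = 0\<close> and
  there are \<open>2 * n\<close> squares.\<close>

lemma lengths_2_2n: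
  "mk (2 * n) (2 * n) \<in> product_one_monoid G" "length_set G (mk (2 * n) (2 * n)) = {2, 2 * n}"
proof -
  show "mk (2 * n) (2 * n) \<in> product_one_monoid G" by (rule even_mk_pom) auto
  show "length_set G (mk (2 * n) (2 * n)) = {2, 2 * n}"
  proof
    show "length_set G (mk (2 * n) (2 * n)) \<subseteq> {2, 2 * n}"
    proof
      fix l assume "l \<in> length_set G (mk (2 * n) (2 * n))"
      then obtain z where z: "z \<in> factorizations G (mk (2 * n) (2 * n))" "l = size z" by (auto simp: length_set_def)
      obtain u i j where uij: "l = u + i + j" "2 * n = u * n + 2 * i" "2 * n = u * n + 2 * j"
        using length_mk[OF z(1)] z(2) by blast
      have "even (u * n)" using uij(2) by (metis dvd_add_left_iff dvd_triv_left)
      hence "even u" using n_odd by simp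
      moreover have "u \<le> 2"
      proof (rule ccontr)
        assume "\<not> u \<le> 2"
        hence "3 * n \<le> u * n" by simp
        thus False using uij(2) n3 by linarith
      qed
      ultimately have "u = 0 \<or> u = 2" by (auto elim!: evenE)
      thus "l \<in> {2, 2 * n}" using uij by auto
    qed
    have "{#mk n n#} + {#mk n n#} \<in> factorizations G (mk n n + mk n n)"
      by (intro factorizations_plus factorizations_atom nn_atom)
    hence 1: "size ({#mk n n#} + {#mk n n#}) \<in> length_set G (mk (2 * n) (2 * n))"
      unfolding length_set_def mult_2 mk_plus by (rule imageI)
    have 2: "size (replicate_mset n (mk 2 0) + replicate_mset n (mk 0 2)) \<in> length_set G (mk (2 * n) (2 * n))"
      unfolding length_set_def using squares_factorization[of n n] by (rule imageI)
    have "size ({#mk n n#} + {#mk n n#}) = 2"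
      "size (replicate_mset n (mk 2 0) + replicate_mset n (mk 0 2)) = 2 * n" by simp_all
    thus "{2, 2 * n} \<subseteq> length_set G (mk (2 * n) (2 * n))" using 1 2 by (metis insert_subset empty_subsetI)
  qed
qed

text \<open>The atom that contains \<open>y\<close> is \<open>V\<close> or \<open>V'\<close>; what remains is the atom \<open>mk n n\<close> in the first case
  and a product of squares in the second.\<close>

lemma lengths_2_mid:
  assumes k: "\<kappa> = (if k then 1 else 0)" and c: "1 \<le> c" "c < n"
  defines "y \<equiv> el (int c) k"
  defines "A \<equiv> mk (n + c - \<kappa>) (n + c) + {#y#}"
  shows "A \<in> product_one_monoid G" "length_set G A = {2, 2 * c + 1 - \<kappa>}"
proof -
  have kc: "\<kappa> \<le> c" "\<kappa> \<le> 1" using k c by auto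
  have car: "set_mset (mk b e + {#y#}) \<subseteq> carrier G" for b e using set_mk[of b e] by (simp add: y_def)
  \<comment> \<open>In \<open>pom_mk_signed\<close>, \<open>s\<close> is congruent to
    \<open>- c\<close> modulo \<open>n\<close>. \<open>V\<close> and \<open>V'\<close> belong to
    \<open>s = - c\<close> and \<open>s = n - c\<close>, the values of least absolute value in the
    two possible classes modulo \<open>2 * n\<close>.\<close>
  define V where "V = mk (c - \<kappa>) c + {#y#}"
  define V' where "V' = mk (n - c + \<kappa>) (n - c) + {#y#}"
  have rcy: "rc {#y#} = int \<kappa>" using k by (simp add: y_def)
  have vsy: "int n dvd vs {#y#} - int c" using vs_el[of "int c" k] by (simp add: y_def)
  have V: "V \<in> product_one_monoid G"
  proof -
    have "vs (mk 0 c) - vs (mk (c - \<kappa>) 0 + {#y#})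
        = (vs (mk 0 c) - int c) - (vs (mk (c - \<kappa>) 0) - int 0) - (vs {#y#} - int c)" by simp
    hence d: "int n dvd vs (mk 0 c) - vs (mk (c - \<kappa>) 0 + {#y#})"
      using vs_mk[of 0 c] vs_mk[of "c - \<kappa>" 0] vsy by (metis dvd_diff)
    have "rc (mk 0 c) = rc (mk (c - \<kappa>) 0 + {#y#})"
      using kc by (simp only: rc_simps(3) rc_mk rcy)
    moreover have "mk 0 c + (mk (c - \<kappa>) 0 + {#y#}) = V"
      unfolding V_def by (simp only: mk_plus add.assoc[symmetric]) simp
    moreover have "0 < rc (mk 0 c)" using c by (simp add: rc_mk)
    ultimately show ?thesis using pom_balanced[of "mk 0 c" "mk (c - \<kappa>) 0 + {#y#}"] d car unfolding V_def by metis
  qed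
  have V': "V' \<in> product_one_monoid G"
  proof -
    have "vs (mk 0 (n - c) + {#y#}) - vs (mk (n - c + \<kappa>) 0)
        = (vs (mk 0 (n - c)) - int (n - c)) + (vs {#y#} - int c) - (vs (mk (n - c + \<kappa>) 0) - int 0) + int n"
      using c by (simp add: of_nat_diff)
    hence d: "int n dvd vs (mk 0 (n - c) + {#y#}) - vs (mk (n - c + \<kappa>) 0)"
      using vs_mk[of 0 "n - c"] vs_mk[of "n - c + \<kappa>" 0] vsy by (metis dvd_add dvd_diff dvd_refl)
    have "rc (mk 0 (n - c) + {#y#}) = rc (mk (n - c + \<kappa>) 0)"
      by (simp only: rc_simps(3) rc_mk rcy)
    moreover have "(mk 0 (n - c) + {#y#}) + mk (n - c + \<kappa>) 0 = V'"
      unfolding V'_def by (simp add: mk_plus add.commute[of _ "mk (n - c + \<kappa>) 0"] del: union_mset_add_mset_right)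
    moreover have "0 < rc (mk 0 (n - c) + {#y#})" using c rc_nonneg[of "{#y#}"] by (simp add: rc_mk)
    ultimately show ?thesis
      using pom_balanced[of "mk 0 (n - c) + {#y#}" "mk (n - c + \<kappa>) 0"] d car unfolding V'_def by metis
  qed
  have shape: "W = V \<or> W = V'" if W: "W \<in> product_one_atoms G" "W = mk b e + {#y#}" for W b e
  proof -
    have "mk b e + {#y#} \<in> product_one_monoid G" using atom_pom[OF W(1)] W(2) by simp
    moreover have "\<exists>ka. {#y#} = {#el (int c) ka#} \<and> int \<kappa> = (if ka then 1 else 0)"
      by (intro exI[of _ k]) (simp add: y_def k)
    ultimately obtain s where s: "\<bar>s\<bar> \<le> int e" "even (s - int e)" "\<bar>s + int \<kappa>\<bar> \<le> int b" "even (s + int \<kappa> - int b)"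
      "int n dvd s + int c"
      using pom_mk_signed[of b e "{#y#}" "int \<kappa>" "int c"] by blast
    have split: "W = mk b0 a0 + {#y#}"
      if "mk b0 a0 + {#y#} \<in> product_one_monoid G" "b0 \<le> b" "a0 \<le> e" "even (b - b0)" "even (e - a0)" for b0 a0
    proof -
      have e: "W = (mk b0 a0 + {#y#}) + mk (b - b0) (e - a0)"
        using that W(2) mk_plus[of b0 a0 "b - b0" "e - a0"] by (simp add: add.commute[of _ "mk (b - b0) (e - a0)"])
      hence "mk (b - b0) (e - a0) = {#}"
        using atom_irreducible[OF W(1) e that(1) even_mk_pom[OF that(4,5)]] by simp
      thus ?thesis using e by simp
    qed
    obtain q where q: "s + int c = int n * q" using s(5) by (auto elim: dvdE)
    have big: "int n * j \<le> - int n" if "j \<le> -1" for j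
      using mult_left_mono[OF that, of "int n"] by simp
    have big': "int n \<le> int n * j" if "1 \<le> j" for j
      using mult_left_mono[OF that, of "int n"] by simp
    show ?thesis
    \<comment> \<open>The parity of \<open>q\<close> decides between the two classes. The size of
      \<open>s\<close> bounds \<open>e\<close> and \<open>b\<close> from below, and its parity makes
      the excess even, so a product of squares splits off \<open>W\<close> and must be
      empty.\<close>
    proof (cases "even q")
      case True
      then obtain j where j: "q = 2 * j" by (auto elim: evenE)
      have sj: "s = 2 * (int n * j) - int c" using q j by simp
      have "int c \<le> \<bar>s\<bar> \<and> int c - int \<kappa> \<le> \<bar>s + int \<kappa>\<bar>"
      proof -
        consider "int n * j = 0" | "int n \<le> int n * j" | "int n * j \<le> - int n"
          using big[of j] big'[of j] by (cases "j = 0") force+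
        thus ?thesis by cases (use sj c kc in linarith)+
      qed
      hence le: "c \<le> e" "c - \<kappa> \<le> b" using s(1,3) kc by linarith+
      have "even (int e - int c)" "even (int b - (int c - int \<kappa>))"
        using s(2,4) sj by (auto simp: even_diff_iff)
      hence "even (e - c)" "even (b - (c - \<kappa>))" using le kc by (auto simp flip: of_nat_diff)
      thus ?thesis using split[of "c - \<kappa>" c] V le unfolding V_def by blast
    next
      case False
      then obtain j where j: "q = 2 * j + 1" by (auto elim: oddE)
      have sj: "s = 2 * (int n * j) + int n - int c" using q j by (simp add: algebra_simps)
      have "int n - int c \<le> \<bar>s\<bar> \<and> int n - int c + int \<kappa> \<le> \<bar>s + int \<kappa>\<bar>"
      proof -
        consider "int n * j = 0" | "int n \<le> int n * j" | "int n * j \<le> - int n"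
          using big[of j] big'[of j] by (cases "j = 0") force+
        thus ?thesis by cases (use sj c kc in linarith)+
      qed
      hence le: "n - c \<le> e" "n - c + \<kappa> \<le> b" using s(1,3) c kc by linarith+
      have "even (int e - (int n - int c))" "even (int b - (int n - int c + int \<kappa>))"
        using s(2,4) sj by (auto simp: even_diff_iff)
      hence "even (e - (n - c))" "even (b - (n - c + \<kappa>))" using le c by (auto simp flip: of_nat_diff of_nat_add)
      thus ?thesis using split[of "n - c + \<kappa>" "n - c"] V' le unfolding V'_def by blast
    qed
  qed
  have decomp: "\<exists>z' b0 a0. z = add_mset (mk b0 a0 + {#y#}) z' \<and>
      (b0 = c - \<kappa> \<and> a0 = c \<or> b0 = n - c + \<kappa> \<and> a0 = n - c) \<and> b0 \<le> b \<and> a0 \<le> e \<and>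
      z' \<in> factorizations G (mk (b - b0) (e - a0))"
    if z: "z \<in> factorizations G (mk b e + {#y#})" for z b e
  proof -
    have "y \<in># \<Sum>\<^sub># z" using z by (simp add: factorizations_def)
    then obtain W where W: "W \<in># z" "y \<in># W" by auto
    then obtain z' where z': "z = add_mset W z'" by (metis insert_DiffM)
    obtain W' where W': "W = add_mset y W'" using W(2) by (metis insert_DiffM)
    have at: "W \<in> product_one_atoms G" "set_mset z' \<subseteq> product_one_atoms G"
      using z z' by (auto simp: factorizations_def)
    have sum: "W' + \<Sum>\<^sub># z' = mk b e" using z z' W' by (simp add: factorizations_def)
    obtain b0 a0 where ba: "b0 \<le> b" "a0 \<le> e" "W' = mk b0 a0"
      using sub_mset_two_letters[of W' b "el 0 True" e "el 1 True"] sum neq01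
      unfolding mk_def by (metis mset_subset_eq_add_left)
    have WW: "W = mk b0 a0 + {#y#}" using W' ba(3) by simp
    have "mk b0 a0 + \<Sum>\<^sub># z' = mk b0 a0 + mk (b - b0) (e - a0)" using sum ba by (simp add: mk_plus)
    hence f: "z' \<in> factorizations G (mk (b - b0) (e - a0))" using at(2) by (simp add: factorizations_def)
    have "b0 = c - \<kappa> \<and> a0 = c \<or> b0 = n - c + \<kappa> \<and> a0 = n - c"
      using shape[OF at(1) WW] WW unfolding V_def V'_def by (auto simp: mk_eq_iff)
    thus ?thesis using z' WW ba(1,2) f by blast
  qed
  have Vat: "V \<in> product_one_atoms G"
  proof (rule atom_if_unique_length[OF V])
    fix z assume "z \<in> factorizations G V"
    then obtain z' b0 a0 where z: "z = add_mset (mk b0 a0 + {#y#}) z'"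
      "b0 = c - \<kappa> \<and> a0 = c \<or> b0 = n - c + \<kappa> \<and> a0 = n - c" "b0 \<le> c - \<kappa>" "a0 \<le> c"
      "z' \<in> factorizations G (mk (c - \<kappa> - b0) (c - a0))"
      using decomp[of z "c - \<kappa>" c] unfolding V_def by blast
    obtain u i j where uij: "size z' = u + i + j" "c - \<kappa> - b0 = u * n + 2 * i" "c - a0 = u * n + 2 * j"
      using length_mk[OF z(5)] by blast
    have u: "u = 0"
    proof (rule ccontr)
      assume "u \<noteq> 0"
      hence "n \<le> u * n" by simp
      thus False using uij(3) c by linarith
    qed
    \<comment> \<open>As \<open>n\<close> is odd, \<open>V\<close> and \<open>V'\<close> contain
      numbers of \<open>el 1 True\<close> of different parity, whereas \<open>u = 0\<close> leaves
      only squares for the rest.\<close>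
    have "\<not> (b0 = n - c + \<kappa> \<and> a0 = n - c)"
    proof
      assume "b0 = n - c + \<kappa> \<and> a0 = n - c"
      hence "n = 2 * c - 2 * j" using uij(3) u z(4) c by simp
      thus False using n_odd by simp
    qed
    hence "b0 = c - \<kappa> \<and> a0 = c" using z(2) by blast
    thus "size z = 1" using uij u z(1) by simp
  qed
  have Vat': "V' \<in> product_one_atoms G"
  proof (rule atom_if_unique_length[OF V'])
    fix z assume "z \<in> factorizations G V'"
    then obtain z' b0 a0 where z: "z = add_mset (mk b0 a0 + {#y#}) z'"
      "b0 = c - \<kappa> \<and> a0 = c \<or> b0 = n - c + \<kappa> \<and> a0 = n - c" "b0 \<le> n - c + \<kappa>" "a0 \<le> n - c"
      "z' \<in> factorizations G (mk (n - c + \<kappa> - b0) (n - c - a0))"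
      using decomp[of z "n - c + \<kappa>" "n - c"] unfolding V'_def by blast
    obtain u i j where uij: "size z' = u + i + j" "n - c + \<kappa> - b0 = u * n + 2 * i" "n - c - a0 = u * n + 2 * j"
      using length_mk[OF z(5)] by blast
    have u: "u = 0"
    proof (rule ccontr)
      assume "u \<noteq> 0"
      hence "n \<le> u * n" by simp
      thus False using uij(3) c by linarith
    qed
    have "\<not> (b0 = c - \<kappa> \<and> a0 = c)"
    proof
      assume "b0 = c - \<kappa> \<and> a0 = c"
      hence "n = 2 * c + 2 * j" using uij(3) u z(4) c by simp
      thus False using n_odd by simp
    qed
    hence "b0 = n - c + \<kappa> \<and> a0 = n - c" using z(2) by blast
    thus "size z = 1" using uij u z(1) by simp
  qed
  have AV: "A = V + mk n n" using kc mk_plus[of "c - \<kappa>" c n n] unfolding A_def V_def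
    by (simp add: add.commute)
  have sums: "n - c + \<kappa> + 2 * (c - \<kappa>) = n + c - \<kappa>" "n - c + 2 * c = n + c" using kc c by linarith+
  have AV': "A = V' + mk (2 * (c - \<kappa>)) (2 * c)"
    using mk_plus[of "n - c + \<kappa>" "n - c" "2 * (c - \<kappa>)" "2 * c"] unfolding A_def V'_def sums
    by (simp add: add.commute)
  show "A \<in> product_one_monoid G" unfolding AV by (rule pom_plus[OF V mk_nn_pom])
  show "length_set G A = {2, 2 * c + 1 - \<kappa>}"
  proof
    show "length_set G A \<subseteq> {2, 2 * c + 1 - \<kappa>}"
    proof
      fix l assume "l \<in> length_set G A"
      then obtain z where z: "z \<in> factorizations G A" "l = size z" by (auto simp: length_set_def)
      obtain z' b0 a0 where z': "z = add_mset (mk b0 a0 + {#y#}) z'"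
        "b0 = c - \<kappa> \<and> a0 = c \<or> b0 = n - c + \<kappa> \<and> a0 = n - c"
        "z' \<in> factorizations G (mk (n + c - \<kappa> - b0) (n + c - a0))"
        using decomp[of z "n + c - \<kappa>" "n + c"] z(1) unfolding A_def by blast
      obtain u i j where uij: "size z' = u + i + j" "n + c - \<kappa> - b0 = u * n + 2 * i" "n + c - a0 = u * n + 2 * j"
        using length_mk[OF z'(3)] by blast
      show "l \<in> {2, 2 * c + 1 - \<kappa>}"
        using z'(2)
      proof
        assume "b0 = c - \<kappa> \<and> a0 = c"
        hence nn: "n = u * n + 2 * i" "n = u * n + 2 * j" using uij kc by auto
        have "u \<noteq> 0" using nn(1) n_odd by (metis add_0 dvd_triv_left mult_0)
        moreover have "\<not> 2 \<le> u"
        proof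
          assume "2 \<le> u"
          hence "2 * n \<le> u * n" by simp
          thus False using nn n3 by linarith
        qed
        ultimately have "u = 1" by linarith
        thus ?thesis using nn uij(1) z(2) z'(1) by simp
      next
        assume "b0 = n - c + \<kappa> \<and> a0 = n - c"
        hence nn: "2 * (c - \<kappa>) = u * n + 2 * i" "2 * c = u * n + 2 * j" using uij kc c by auto
        have "even (u * n)" using nn(2) by (metis dvd_add_left_iff dvd_triv_left)
        hence "even u" using n_odd by simp
        moreover have "\<not> 2 \<le> u"
        proof
          assume "2 \<le> u"
          hence "2 * n \<le> u * n" by simp
          thus False using nn c by linarith
        qed
        ultimately have "u = 0" by presburger
        thus ?thesis using nn uij(1) z(2) z'(1) kc by auto
      qed
    qed
    have "{#V#} + {#mk n n#} \<in> factorizations G A"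
      unfolding AV by (intro factorizations_plus factorizations_atom Vat nn_atom)
    hence 1: "size ({#V#} + {#mk n n#}) \<in> length_set G A" unfolding length_set_def by (rule imageI)
    have "{#V'#} + (replicate_mset (c - \<kappa>) (mk 2 0) + replicate_mset c (mk 0 2)) \<in> factorizations G A"
      unfolding AV' by (intro factorizations_plus[OF factorizations_atom[OF Vat'] squares_factorization])
    hence "size ({#V'#} + (replicate_mset (c - \<kappa>) (mk 2 0) + replicate_mset c (mk 0 2))) \<in> length_set G A"
      unfolding length_set_def by (rule imageI)
    moreover have "size ({#V'#} + (replicate_mset (c - \<kappa>) (mk 2 0) + replicate_mset c (mk 0 2))) = 2 * c + 1 - \<kappa>"
      using kc by simp
    moreover have "size ({#V#} + {#mk n n#}) = 2" by simp
    ultimately show "{2, 2 * c + 1 - \<kappa>} \<subseteq> length_set G A" using 1 by (metis insert_subset empty_subsetI)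
  qed
qed

lemma pom_even_rc:
  assumes "S \<in> product_one_monoid G"
  shows "even (rc S)" "rc S = 0 \<Longrightarrow> int n dvd vs S"
proof -
  have S: "set_mset S \<subseteq> carrier G" "product_one G S"
    using assms by (simp_all add: product_one_monoid_def sequences_over_def)
  obtain P M where PM: "P + M = S" "balanced P M" using product_oneE[OF S] by blast
  thus "even (rc S)" by (auto simp: balanced_def)
  assume "rc S = 0"
  hence "rc P = 0" using PM by (auto simp: balanced_def)
  hence "M = {#}" using PM(2) by (simp add: balanced_def)
  thus "int n dvd vs S" using PM by (auto simp: balanced_def)
qed

text \<open>The sequence has six terms; an atom of a factorization has at least two terms, and at
  least three if it contains \<open>\<rho>\<close>. So no factorization has more than two atoms,
  while the two rotations can join either of the two squares.\<close>

lemma catenary_2: "\<exists>A\<in>product_one_monoid G. catenary_degree G A = enat 2"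
proof -
  define \<rho> where "\<rho> = el 1 False"
  define R where "R = {#\<rho>, \<rho>#}"
  have rho: "\<not> refl \<rho>" "int n dvd val \<rho> - 1" using val_el[of 1 False] by (simp_all add: \<rho>_def)
  have n1: "\<not> int n dvd 1" "\<not> int n dvd 2" using n3 zdvd_imp_le[of "int n" 1] zdvd_imp_le[of "int n" 2] by auto
  have nval: "\<not> int n dvd val \<rho>" using rho(2) n1(1) by (metis dvd_diff_right_iff dvd_minus_iff minus_diff_eq dvd_diffD1 dvd_diff_commute)
  have n2: "\<not> int n dvd 2 * val \<rho>"
  proof
    assume "int n dvd 2 * val \<rho>"
    moreover have "coprime (int n) 2" using n_odd by simp
    ultimately show False using nval by (simp add: coprime_dvd_mult_right_iff)
  qed
  have mem: "x = \<rho> \<or> refl x" if "x \<in># mk 2 2 + R" for x using that by (auto simp: mk_def R_def)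
  have big: "2 \<le> size W" "\<rho> \<in># W \<Longrightarrow> 3 \<le> size W"
    if W: "W \<in> product_one_atoms G" "W \<subseteq># mk 2 2 + R" for W
  proof -
    have pom: "W \<in> product_one_monoid G" by (rule atom_pom[OF W(1)])
    have memW: "x = \<rho> \<or> refl x" if "x \<in># W" for x using mem that W(2) by (meson mset_subset_eqD)
    have s0: "size W \<noteq> 0" using atom_nonempty[OF W(1)] by simp
    have s1: "size W \<noteq> 1"
    proof
      assume "size W = 1"
      then obtain x where x: "W = {#x#}" by (metis size_1_singleton_mset)
      show False using memW[of x] pom_even_rc[OF pom] x rho(1) nval by (cases "refl x") auto
    qed
    show "2 \<le> size W" using s0 s1 by linarith
    show "3 \<le> size W" if r: "\<rho> \<in># W"
    proof (rule ccontr)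
      assume "\<not> 3 \<le> size W"
      hence s2: "size W = 2" using s0 s1 by linarith
      obtain W' where W': "W = add_mset \<rho> W'" using r by (metis insert_DiffM)
      hence "size W' = 1" using s2 by simp
      then obtain x where x: "W = {#\<rho>, x#}" using W' by (metis size_1_singleton_mset)
      \<comment> \<open>A single reflection has no partner of opposite sign, and
        \<open>\<rho>\<close> twice has exponent 2 modulo \<open>n\<close>, which is not 0.\<close>
      show False using memW[of x] pom_even_rc[OF pom] x rho(1) n2 by (cases "refl x") auto
    qed
  qed
  have sub: "W \<subseteq># B" if "W \<in># z" "z \<in> factorizations G B" for W z B
    using factorizations_remove(3)[OF that(2,1)] by (metis mset_subset_eq_add_left)
  have short: "size z \<le> Suc ((size B - 3) div 2)"
    if z: "z \<in> factorizations G B" "B \<subseteq># mk 2 2 + R" "\<rho> \<in># B" for z B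
  proof -
    obtain W where W: "W \<in># z" "\<rho> \<in># W" using z(1,3) by (auto simp: factorizations_def)
    have at: "U \<in> product_one_atoms G" if "U \<in># z" for U using z(1) that by (auto simp: factorizations_def)
    have sB: "U \<subseteq># mk 2 2 + R" if "U \<in># z" for U using sub[OF that z(1)] z(2) by (rule subset_mset.order_trans)
    obtain z' where z': "z = add_mset W z'" using W(1) by (metis insert_DiffM)
    have "2 * size z' \<le> size (\<Sum>\<^sub># z')"
    proof -
      have "\<And>U. U \<in># z' \<Longrightarrow> 2 \<le> size U" using big(1)[OF at sB] z' by auto
      thus ?thesis by (induction z') (auto, fastforce)
    qed
    moreover have "size B = size W + size (\<Sum>\<^sub># z')" using z(1) z' by (auto simp: factorizations_def)
    moreover have "3 \<le> size W" using big(2)[OF at[OF W(1)] sB[OF W(1)] W(2)] .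
    ultimately show ?thesis using z' by simp
  qed
  have pom4: "mk b e + R \<in> product_one_monoid G" if "(b, e) = (2, 0) \<or> (b, e) = (0, 2)" for b e
  proof -
    \<comment> \<open>Every letter occurs an even number of times, so half of its copies can take
      each sign.\<close>
    define P where "P = mk (b div 2) (e div 2) + {#\<rho>#}"
    have "mk (b div 2) (e div 2) + mk (b div 2) (e div 2) = mk b e"
      using that by (auto simp: mk_plus numeral_2_eq_2)
    hence "mk b e + R = P + P" unfolding P_def R_def by (simp add: add.commute)
    moreover have "set_mset (P + P) \<subseteq> carrier G" using set_mk[of "b div 2" "e div 2"] by (simp add: P_def \<rho>_def)
    moreover have "0 < rc P" using that rho(1) by (auto simp: P_def rc_mk)
    ultimately show ?thesis using pom_balanced[of P P] by simp
  qed
  have at4: "mk b e + R \<in> product_one_atoms G" if ba: "(b, e) = (2, 0) \<or> (b, e) = (0, 2)" for b e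
  proof (rule atom_if_unique_length[OF pom4[OF ba]])
    fix z assume z: "z \<in> factorizations G (mk b e + R)"
    have "mk b e \<subseteq># mk 2 2" using ba mk_plus[of 2 0 0 2] mk_plus[of 0 2 2 0]
      by (metis mset_subset_eq_add_left add_0 add.right_neutral prod.inject)
    hence "size z \<le> Suc ((size (mk b e + R) - 3) div 2)"
      by (intro short[OF z]) (auto simp: R_def intro: subset_mset.add_mono)
    moreover have "size (mk b e + R) = 4" using ba by (auto simp: mk_def R_def)
    moreover have "z \<noteq> {#}" using factorizations_empty_iff[OF z] by (simp add: R_def)
    ultimately have "size z \<le> 1" "size z \<noteq> 0" by auto
    thus "size z = 1" by linarith
  qed
  define A where "A = mk 2 2 + R"
  have A: "A = (mk 2 0 + R) + mk 0 2" "A = (mk 0 2 + R) + mk 2 0"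
    unfolding A_def using mk_plus[of 2 0 0 2] by (simp_all add: ac_simps numeral_2_eq_2)
  define z where "z = {#mk 2 0 + R#} + {#mk 0 2#}"
  define w where "w = {#mk 0 2 + R#} + {#mk 2 0#}"
  have z: "z \<in> factorizations G A" unfolding z_def A(1)
    by (intro factorizations_plus factorizations_atom at4 square_atoms) simp
  have w: "w \<in> factorizations G A" unfolding w_def A(2)
    by (intro factorizations_plus factorizations_atom at4 square_atoms) simp
  have "mk 2 0 \<notin># z"
  proof -
    have "mk 2 0 \<noteq> mk 2 0 + R" "mk 2 0 \<noteq> mk 0 2" by (simp_all add: R_def mk_eq_iff)
    thus ?thesis by (simp add: z_def)
  qed
  moreover have "mk 2 0 \<in># w" by (simp add: w_def)
  ultimately have ne: "z \<noteq> w" by metis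
  have "size A = 6" by (simp add: A_def mk_def R_def)
  hence "size y \<le> 2" if "y \<in> factorizations G A" for y
    using short[OF that] by (simp add: A_def R_def)
  hence "catenary_degree G A \<le> enat 2" by (intro catenary_le fconn_if_short)
  moreover have "enat 2 \<le> catenary_degree G A" by (rule chain_nontrivial[OF chain_catenary[OF z w] ne])
  moreover have "A \<in> product_one_monoid G" unfolding A(1)
    by (intro pom_plus pom4 even_mk_pom) auto
  ultimately show ?thesis by (metis order_antisym)
qed

text \<open>\<open>\<kappa> = 0\<close> gives the odd lengths \<open>2 * c + 1\<close> and
  \<open>\<kappa> = 1\<close> the even lengths \<open>2 * c\<close>; since \<open>c < n\<close>, the
  length \<open>2 * n\<close> has a sequence of its own.\<close>

lemma two_lengths_exists:
  assumes "3 \<le> m" "m \<le> 2 * n"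
  shows "\<exists>A\<in>product_one_monoid G. length_set G A = {2, m}"
proof -
  consider "m = 2 * n" | "odd m" "m < 2 * n" | "even m" "m < 2 * n" using assms by linarith
  thus ?thesis
  proof cases
    case 1 thus ?thesis using lengths_2_2n by blast
  next
    case 2
    then obtain c where c: "m = 2 * c + 1" by (auto elim: oddE)
    show ?thesis using lengths_2_mid[of 0 False c] c assms 2 by force
  next
    case 3
    then obtain c where c: "m = 2 * c" by (auto elim: evenE)
    show ?thesis using lengths_2_mid[of 1 True c] c assms 3 by force
  qed
qed

lemma set_of_distances_eq: "set_of_distances G = {1..2 * n - 2}"
proof
  show "set_of_distances G \<subseteq> {1..2 * n - 2}"
  proof
    fix d assume "d \<in> set_of_distances G"
    then obtain A p where A: "A \<in> product_one_monoid G" "0 < d" "p \<in> int ` length_set G A"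
      "int ` length_set G A \<inter> {p..p + int d} = {p, p + int d}"
      unfolding set_of_distances_def distances_def by auto
    obtain z where z: "z \<in> factorizations G A" "p = int (size z)" using A(3) by (auto simp: length_set_def)
    have "p + int d \<in> int ` length_set G A" using A(4) by blast
    then obtain w where w: "w \<in> factorizations G A" "p + int d = int (size w)" by (auto simp: length_set_def)
    have sw: "size w = size z + d" using w(2) z(2) by linarith
    have gap: "size y \<le> size z \<or> size z + d \<le> size y" if "y \<in> factorizations G A" for y
    proof (rule ccontr)
      assume *: "\<not> ?thesis"
      have "int (size y) \<in> int ` length_set G A" using that by (auto simp: length_set_def)
      hence "int (size y) \<in> int ` length_set G A \<inter> {p..p + int d}" using * z(2) by auto
      hence "int (size y) \<in> {p, p + int d}" by (simp only: A(4))
      thus False using * z(2) by auto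
    qed
    have "chain_connected G A (enat (2 * n)) z w"
      using chain_connected_if_fstep fconn_2n[OF A(1)] z(1) w(1) unfolding fconn_def by blast
    from chain_crosses_gap[OF this, of "size z" "size z + d"] gap sw A(2)
    have "d + 2 \<le> 2 * n" by simp
    thus "d \<in> {1..2 * n - 2}" using A(2) by simp
  qed
  show "{1..2 * n - 2} \<subseteq> set_of_distances G"
  proof
    fix d assume d: "d \<in> {1..2 * n - 2}"
    hence "3 \<le> d + 2" "d + 2 \<le> 2 * n" using n3 by auto
    then obtain A where "A \<in> product_one_monoid G" "length_set G A = {2, d + 2}"
      using two_lengths_exists by blast
    from two_lengths(1)[OF this] show "d \<in> set_of_distances G" using d by simp
  qed
qed

lemma set_of_catenary_degrees_eq: "set_of_catenary_degrees G = enat ` {2..2 * n}"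
proof
  show "set_of_catenary_degrees G \<subseteq> enat ` {2..2 * n}"
  proof
    fix N assume "N \<in> set_of_catenary_degrees G"
    then obtain A where A: "N = catenary_degree G A" "A \<in> product_one_monoid G" "0 < N"
      unfolding set_of_catenary_degrees_def by auto
    have "enat 2 \<le> N" using catenary_pos_ge_2 A by blast
    moreover have "N \<le> enat (2 * n)" using catenary_le[OF fconn_2n[OF A(2)]] A(1) by simp
    ultimately show "N \<in> enat ` {2..2 * n}" by (cases N) auto
  qed
  show "enat ` {2..2 * n} \<subseteq> set_of_catenary_degrees G"
  proof
    fix N assume "N \<in> enat ` {2..2 * n}"
    then obtain m where m: "N = enat m" "2 \<le> m" "m \<le> 2 * n" by auto
    have "\<exists>A\<in>product_one_monoid G. catenary_degree G A = enat m"
    proof (cases "m = 2")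
      case True thus ?thesis using catenary_2 by simp
    next
      case False
      hence "3 \<le> m" using m by simp
      thus ?thesis using two_lengths_exists[of m] two_lengths(2) m(3) by blast
    qed
    moreover have "0 < enat m" using m(2) by (simp add: zero_enat_def)
    ultimately show "N \<in> set_of_catenary_degrees G"
      unfolding set_of_catenary_degrees_def m(1) by force
  qed
qed

end

theorem theorem5p1:
  fixes G :: "('a, 'b) monoid_scheme" and n :: nat
  assumes "dihedral_group G n" and "n \<ge> 3" and "odd n"
  shows "set_of_distances G = {1..2 * n - 2} \<and>
         set_of_catenary_degrees G = enat ` {2..2 * n}"
proof -
  obtain a t where at: "a \<in> carrier G" "t \<in> carrier G" "generate G {a, t} = carrier G"
    "a [^]\<^bsub>G\<^esub> n = \<one>\<^bsub>G\<^esub>" "t [^]\<^bsub>G\<^esub> (2::nat) = \<one>\<^bsub>G\<^esub>" "t \<otimes>\<^bsub>G\<^esub> a = inv\<^bsub>G\<^esub> a \<otimes>\<^bsub>G\<^esub> t"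
    using assms(1) unfolding dihedral_group_def by blast
  interpret group G using assms(1) by (simp add: dihedral_group_def)
  interpret dihedral_ge_3 G n a t
    by unfold_locales (use assms at in \<open>auto simp: dihedral_group_def\<close>)
  show ?thesis using set_of_distances_eq set_of_catenary_degrees_eq by blast
qed

end
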